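(* For each of the seven concrete Catalan families listed in the context, let $\varphi$ be the canonical bijection from rooted plane trees to that family. Then for every plane tree $t$ of size $n$, the canonical statistics transport to native statistics as follows, where the identities for $\mathrm{sub}$ and $\mathrm{rpath}$ hold for all $n\ge 0$ and those for $\mathrm{leaves}$ and $\mathrm{internal}$ hold for all $n\ge 1$. The quadruple $(\mathrm{sub}(t),\mathrm{rpath}(t),\mathrm{leaves}(t),\mathrm{internal}(t))$ equals, evaluated at $\varphi(t)$, (1) $(\mathrm{comp},\mathrm{rcomp},\mathrm{peak},\mathrm{nonpeak})$ on Dyck paths; (2) $(\mathrm{comp},\mathrm{rcomp},\mathrm{tr},\mathrm{nontr})$ on triangulations; (3) $(\mathrm{comp},\mathrm{rmax},\mathrm{rmin},\mathrm{nonrmin})$ on $231$-avoiding permutations; (4) $(\mathrm{comp},\mathrm{rcomp},\mathrm{rmin},\mathrm{nonrmin})$ on $321$-avoiding permutations; (5) $(\mathrm{comp},\mathrm{rcomp},\mathrm{redge},\mathrm{ledge})$ on binary trees; (6) $(\mathrm{comp},\mathrm{rcomp},\mathrm{noncons},\mathrm{cons})$ on $2\times n$ standard Young tableaux; (7) $(\mathrm{comp},\mathrm{rcomp},\mathrm{blocks},\mathrm{nonmin})$ on non-crossing partitions.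
   Context: A Catalan structure is a quadruple $(C,e,\lambda,\oplus)$ where $C=\bigsqcup_{n\ge 0}C_n$ with $C_0=\{e\}$ ($|t|=n$ for $t\in C_n$), $\lambda\colon C_n\to C_{n+1}$, $\oplus\colon C_m\times C_n\to C_{m+n}$, $\oplus$ is associative with two-sided identity $e$, and every $t\in C$ can be written uniquely in exactly one of three forms: $t=e$; $t=\lambda(s)$ (indecomposable); $t=u\oplus v$ with $u$ indecomposable and $v\neq e$ (decomposable). The canonical bijection $\varphi\colon A\to B$ between two Catalan structures is the map determined by $\varphi(e_A)=e_B$, $\varphi(\lambda_A(t))=\lambda_B(\varphi(t))$, $\varphi(u\oplus_A v)=\varphi(u)\oplus_B\varphi(v)$. Rooted plane trees, written as lists of children, form a Catalan structure with $e=[\,]$ (single node), $\lambda(T)=[T]$, $\oplus$ = concatenation of child lists, size = number of edges. The canonical statistics on plane trees are given by (in each clause for $u\oplus v$ both $u,v\ne e$): $\mathrm{leaves}(e)=1$, $\mathrm{leaves}(\lambda(t))=\mathrm{leaves}(t)$, $\mathrm{leaves}(u\oplus v)=\mathrm{leaves}(u)+\mathrm{leaves}(v)$; $\mathrm{internal}(e)=0$, $\mathrm{internal}(\lambda(t))=1+\mathrm{internal}(t)$, $\mathrm{internal}(u\oplus v)=\mathrm{internal}(u)+\mathrm{internal}(v)-1$; $\mathrm{sub}(e)=0$, $\mathrm{sub}(\lambda(t))=1$, $\mathrm{sub}(u\oplus v)=\mathrm{sub}(u)+\mathrm{sub}(v)$; $\mathrm{rpath}(e)=0$, $\mathrm{rpath}(\lambda(t))=1+\mathrm{rpath}(t)$,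 $\mathrm{rpath}(u\oplus v)=\mathrm{rpath}(v)$. Each family below is a Catalan structure with the stated $e,\lambda,\oplus$. (1) Dyck paths of semilength $n$ as words in $u,d$: $e=\epsilon$, $\lambda(w)=uwd$, $w_1\oplus w_2=w_1w_2$. comp = number of returns to the $x$-axis; rcomp = length of the final run of $d$'s; peak = number of factors $ud$; nonpeak = $1$ + number of factors $uu$. (2) Triangulations of the convex $(n+2)$-gon with vertices labeled $1,\dots,n+2$ clockwise (size $n$; size $0$ is the single edge $(1,2)$, which is $e$). $\lambda(T)$: relabel $i\mapsto i+1$ in $T$ (size $n$) and add a new vertex $1$ adjacent to $2$ and $n+3$. $T_1\oplus T_2$ (with $|T_1|=n_1$): identify the edge $(1,n_1+2)$ of $T_1$ with the edge $(1,2)$ of $T_2$, so vertex $1$ of $T_2$ stays $1$ and vertex $j\ge 2$ of $T_2$ becomes $n_1+j$. Edges include boundary edges. comp = (number of edges incident to $1$) $-1$; rcomp = (number of edges incident to $n+2$) $-1$; tr = number of $i\in\{2,\dots,n+1\}$ such that some $j<i$ is adjacent to both $i$ and $i+1$; nontr $=n+1-\mathrm{tr}$. (3) $231$-avoiding permutations of $[n]$: $e=\epsilon$, $\lambda(\pi)=(n+1)\pi$ (prepend a new maximum), $\oplus$ = direct sum ($\pi_1\oplus\pi_2=\pi_1\pi_2'$ with $\pi_2'(i)=\pi_2(i)+|\pi_1|$). comp = number of direct-sum components; rmax = number of right-to-left maxima; rmin = number of right-to-left minima; nonrmin = $1$ + number of entries that are not right-to-left minima. (4) $321$-avoiding permutations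 of $[n]$: $e=\epsilon$, $\oplus$ = direct sum, $\lambda(\epsilon)=1$, and for $n\ge 1$, $\lambda(\pi)$ is obtained as follows: let $i$ be the position of $1$ in $\pi$; box the positions to the right of $i$ that are left-to-right maxima but not right-to-left minima of $\pi$; insert $n+1$ at position $i$ (shifting later entries, and boxes, one place right) and box this position too; then cyclically shift the values at the boxed positions one step to the left (each boxed value moves to the previous boxed position, the first wraps to the last). comp = number of direct-sum components; rcomp $=n-\pi(n)+1$ for $n\ge 1$ and $\mathrm{rcomp}(\epsilon)=0$; rmin, nonrmin as in (3). (5) Binary trees with $n$ nodes: either $\varnothing$ or $(L,R)$ with $L,R$ binary trees. $e=\varnothing$, $\lambda(T)=(T,\varnothing)$, $\varnothing\oplus B=B$, $(T,B_1)\oplus B_2=(T,B_1\oplus B_2)$. The right spine is the maximal sequence of nodes reached from the root along right edges. comp = number of nodes on the right spine; rcomp = number of iterations needed to reach $\varnothing$ when repeatedly replacing the tree by the left subtree of the last node of its right spine; redge = $1$ + number of edges from a node to a nonempty right child; ledge $=n+1-\mathrm{redge}$. (6) $2\times n$ standard Young tableaux: $e$ = empty tableau; $\lambda(T)$ ($T$ of size $n$): increase all entries by $1$, prepend $1$ to the top row and append $2n+2$ to the bottom row; $T_1\oplus T_2$: add $2|T_1|$ to all entries of $T_2$ and adjoin its columns to the right of $T_1$. comp = number of $k\in\{1,\dots,n\}$ such that the first $k$ columns contain exactly $\{1,\dots,2k\}$; rcomp = largest $k$ such that the last $k$ bottom-row entries, read right to left, are $2n,2n-1,\dots,2n-k+1$;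 cons = $1$ + number of top-row entries $i$ with $i+1$ in the top row; noncons = number of top-row entries $i$ with $i+1$ in the bottom row. (7) Non-crossing partitions of $[n]$: $e$ = empty partition; $\lambda(P)$: add $n+1$ to the block containing $1$ (and $\lambda(e)=\{\{1\}\}$); $P_1\oplus P_2=P_1\cup(P_2+|P_1|)$. comp = number of indecomposable summands (equivalently, number of $k\in\{1,\dots,n\}$ such that $[k]$ is a union of blocks); rcomp = number of right-to-left maxima of the flattened form, i.e. the word listing each block in decreasing order, with blocks sorted by minimal element; blocks = number of blocks; nonmin $=n+1-\mathrm{blocks}$. *)

theory Defs
  imports "HOL-Library.FuncSet" "HOL-Library.Disjoint_Sets"
begin

section \<open>Catalan structures\<close>

record 'a catalan =
  graded :: "nat \<Rightarrow> 'a set"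
  neutral :: 'a
  lam :: "'a \<Rightarrow> 'a"
  oplus :: "'a \<Rightarrow> 'a \<Rightarrow> 'a"

definition carrier :: "'a catalan \<Rightarrow> 'a set" where
  "carrier S = (\<Union>n. graded S n)"

definition indecomposables :: "'a catalan \<Rightarrow> 'a set" where
  "indecomposables S = lam S ` carrier S"

definition decomposables :: "'a catalan \<Rightarrow> 'a set" where
  "decomposables S =
     (\<lambda>(u, v). oplus S u v) ` (indecomposables S \<times> (carrier S - {neutral S}))"

definition catalan_structure :: "'a catalan \<Rightarrow> bool" where
  "catalan_structure S \<longleftrightarrow>
     graded S 0 = {neutral S} \<and>
     disjoint_family (graded S) \<and>
     (\<forall>n. \<forall>t \<in> graded S n. lam S t \<in> graded S (Suc n)) \<and>
     (\<forall>m n. \<forall>s \<in> graded S m. \<forall>t \<in> graded S n. oplus S s t \<in> graded S (m + n)) \<and>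
     (\<forall>s \<in> carrier S. \<forall>t \<in> carrier S. \<forall>u \<in> carrier S.
        oplus S (oplus S s t) u = oplus S s (oplus S t u)) \<and>
     (\<forall>t \<in> carrier S. oplus S (neutral S) t = t \<and> oplus S t (neutral S) = t) \<and>
     carrier S = {neutral S} \<union> indecomposables S \<union> decomposables S \<and>
     neutral S \<notin> indecomposables S \<and>
     neutral S \<notin> decomposables S \<and>
     indecomposables S \<inter> decomposables S = {} \<and>
     inj_on (lam S) (carrier S) \<and>
     inj_on (\<lambda>(u, v). oplus S u v) (indecomposables S \<times> (carrier S - {neutral S}))"

text \<open>
  The map from \<open>A\<close> to \<open>B\<close> determined by the three equations. Bijectivity is not demanded here;
  it follows when both arguments are Catalan structures. Outside \<open>carrier A\<close> the value is
  \<^const>\<open>undefined\<close>.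
\<close>

definition canonical_bijection :: "'a catalan \<Rightarrow> 'b catalan \<Rightarrow> 'a \<Rightarrow> 'b" where
  "canonical_bijection A B =
     (THE \<phi>. \<phi> \<in> carrier A \<rightarrow>\<^sub>E carrier B \<and>
        \<phi> (neutral A) = neutral B \<and>
        (\<forall>t \<in> carrier A. \<phi> (lam A t) = lam B (\<phi> t)) \<and>
        (\<forall>u \<in> carrier A. \<forall>v \<in> carrier A. \<phi> (oplus A u v) = oplus B (\<phi> u) (\<phi> v)))"


section \<open>Rooted plane trees\<close>

datatype tree = Node (children: "tree list")

fun edges :: "tree \<Rightarrow> nat" where
  "edges (Node ts) = (\<Sum>t\<leftarrow>ts. 1 + edges t)"

definition plane_trees :: "tree catalan" where
  "plane_trees = \<lparr>
     graded = (\<lambda>n. {t. edges t = n}),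
     neutral = Node [],
     lam = (\<lambda>t. Node [t]),
     oplus = (\<lambda>u v. Node (children u @ children v)) \<rparr>"

lemma catalan_structure_plane_trees: "catalan_structure plane_trees"
proof -
  have carrier: "carrier plane_trees = UNIV"
    by (auto simp: carrier_def plane_trees_def)
  have ind: "indecomposables plane_trees = range (\<lambda>t. Node [t])"
    unfolding indecomposables_def carrier by (simp add: plane_trees_def)
  have dec: "decomposables plane_trees = {Node (t # s # ts) | t s ts. True}" (is "?L = ?R")
  proof (intro equalityI subsetI)
    fix x assume "x \<in> ?L"
    then obtain t v where v: "v \<noteq> Node []" and x: "x = Node (t # children v)"
      unfolding decomposables_def ind carrier by (force simp: plane_trees_def)
    then show "x \<in> ?R"
      by (cases v; cases "children v") auto
  next
    fix x assume "x \<in> ?R"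
    then obtain t s ts where "x = Node (t # s # ts)" by blast
    then show "x \<in> ?L"
      unfolding decomposables_def ind carrier
      by (intro image_eqI[where x = "(Node [t], Node (s # ts))"]) (auto simp: plane_trees_def)
  qed
  have split: "x \<in> {Node []} \<union> range (\<lambda>t. Node [t]) \<union> {Node (t # s # ts) | t s ts. True}" for x
  proof (cases x)
    case (Node ts)
    then show ?thesis by (cases ts rule: remdups_adj.cases) auto
  qed
  have edges0: "edges t = 0 \<longleftrightarrow> t = Node []" for t
    by (cases t) (auto simp: neq_Nil_conv)
  have add: "(\<Sum>s\<leftarrow>children t. Suc (edges s)) = edges t" for t
    by (cases t) simp
  show ?thesis
    unfolding catalan_structure_def carrier ind dec using split
    by (auto simp: plane_trees_def edges0 add disjoint_family_on_def inj_on_def tree.expand)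
qed

text \<open>
  The clauses for \<open>u \<oplus> v\<close> are used as recursion equations with \<open>u\<close> indecomposable; the general
  form, for all \<open>u, v \<noteq> e\<close>, is proved below.
\<close>

fun leaves :: "tree \<Rightarrow> nat" where
  "leaves (Node []) = 1"
| "leaves (Node [t]) = leaves t"
| "leaves (Node (t # s # ts)) = leaves (Node [t]) + leaves (Node (s # ts))"

fun internal :: "tree \<Rightarrow> nat" where
  "internal (Node []) = 0"
| "internal (Node [t]) = 1 + internal t"
| "internal (Node (t # s # ts)) = internal (Node [t]) + internal (Node (s # ts)) - 1"

fun sub :: "tree \<Rightarrow> nat" where
  "sub (Node []) = 0"
| "sub (Node [t]) = 1"
| "sub (Node (t # s # ts)) = sub (Node [t]) + sub (Node (s # ts))"

fun rpath :: "tree \<Rightarrow> nat" where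
  "rpath (Node []) = 0"
| "rpath (Node [t]) = 1 + rpath t"
| "rpath (Node (t # s # ts)) = rpath (Node (s # ts))"

lemma internal_pos: "ts \<noteq> [] \<Longrightarrow> internal (Node ts) \<ge> 1"
  by (induction ts rule: induct_list012) auto

lemma oplus_clauses:
  assumes "us \<noteq> []" "vs \<noteq> []"
  shows "leaves (Node (us @ vs)) = leaves (Node us) + leaves (Node vs)"
    and "internal (Node (us @ vs)) = internal (Node us) + internal (Node vs) - 1"
    and "sub (Node (us @ vs)) = sub (Node us) + sub (Node vs)"
    and "rpath (Node (us @ vs)) = rpath (Node vs)"
proof -
  obtain w ws where vs: "vs = w # ws"
    using assms(2) by (cases vs) auto
  have "leaves (Node (us @ vs)) = leaves (Node us) + leaves (Node vs) \<and>
        internal (Node (us @ vs)) = internal (Node us) + internal (Node vs) - 1 \<and>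
        sub (Node (us @ vs)) = sub (Node us) + sub (Node vs) \<and>
        rpath (Node (us @ vs)) = rpath (Node vs)"
    using assms(1)
  proof (induction us rule: induct_list012)
    case (3 x y zs)
    have "internal (Node (y # zs)) \<ge> 1" by (rule internal_pos) simp
    with 3 show ?case by simp
  qed (simp_all add: vs)
  then show "leaves (Node (us @ vs)) = leaves (Node us) + leaves (Node vs)"
    and "internal (Node (us @ vs)) = internal (Node us) + internal (Node vs) - 1"
    and "sub (Node (us @ vs)) = sub (Node us) + sub (Node vs)"
    and "rpath (Node (us @ vs)) = rpath (Node vs)"
    by blast+
qed

definition canonical_stats_equal ::
    "(tree \<Rightarrow> 'b) \<Rightarrow> ('b \<Rightarrow> nat) \<Rightarrow> ('b \<Rightarrow> nat) \<Rightarrow> ('b \<Rightarrow> nat) \<Rightarrow> ('b \<Rightarrow> nat) \<Rightarrow> bool" where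
  "canonical_stats_equal \<phi> s r l i \<longleftrightarrow>
     (\<forall>n. \<forall>t \<in> graded plane_trees n.
        sub t = s (\<phi> t) \<and> rpath t = r (\<phi> t) \<and>
        (n \<ge> 1 \<longrightarrow> leaves t = l (\<phi> t) \<and> internal t = i (\<phi> t)))"


section \<open>Dyck paths\<close>

datatype step = U | D

definition height :: "step list \<Rightarrow> int" where
  "height w = int (count_list w U) - int (count_list w D)"

definition dyck_paths :: "step list catalan" where
  "dyck_paths = \<lparr>
     graded = (\<lambda>n. {w. length w = 2 * n \<and> height w = 0 \<and>
                      (\<forall>k \<le> length w. height (take k w) \<ge> 0)}),
     neutral = [],
     lam = (\<lambda>w. [U] @ w @ [D]),
     oplus = (@) \<rparr>"

definition dyck_comp :: "step list \<Rightarrow> nat" where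
  "dyck_comp w = card {k \<in> {1..length w}. height (take k w) = 0}"

definition dyck_rcomp :: "step list \<Rightarrow> nat" where
  "dyck_rcomp w = length (takeWhile (\<lambda>x. x = D) (rev w))"

definition peak :: "step list \<Rightarrow> nat" where
  "peak w = card {i \<in> {..<length w}. i + 1 < length w \<and> w ! i = U \<and> w ! (i + 1) = D}"

definition nonpeak :: "step list \<Rightarrow> nat" where
  "nonpeak w = 1 + card {i \<in> {..<length w}. i + 1 < length w \<and> w ! i = U \<and> w ! (i + 1) = U}"


section \<open>Triangulations\<close>

text \<open>
  A triangulation is a pair of its size \<open>n\<close> and its edge set (boundary edges included), an edge
  being a two-element set of labels in \<open>{1..n+2}\<close>. Since no boundary edge crosses any chord,
  maximality forces all boundary edges to be present. For \<open>n = 0\<close> the only triangulation is the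
  single edge \<open>{1, 2}\<close>.
\<close>

definition chords :: "nat \<Rightarrow> nat set set" where
  "chords n = {{a, b} | a b. 1 \<le> a \<and> a < b \<and> b \<le> n + 2}"

definition crossing :: "nat set \<Rightarrow> nat set \<Rightarrow> bool" where
  "crossing x y \<longleftrightarrow>
     (\<exists>a b c d. a < b \<and> b < c \<and> c < d \<and> (x = {a, c} \<and> y = {b, d} \<or> y = {a, c} \<and> x = {b, d}))"

definition noncrossing_chords :: "nat \<Rightarrow> nat set set \<Rightarrow> bool" where
  "noncrossing_chords n E \<longleftrightarrow> E \<subseteq> chords n \<and> (\<forall>x \<in> E. \<forall>y \<in> E. \<not> crossing x y)"

definition triangulation :: "nat \<Rightarrow> nat set set \<Rightarrow> bool" where
  "triangulation n E \<longleftrightarrow>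
     noncrossing_chords n E \<and> (\<forall>F. noncrossing_chords n F \<and> E \<subseteq> F \<longrightarrow> F = E)"

definition tri_lam :: "nat \<times> nat set set \<Rightarrow> nat \<times> nat set set" where
  "tri_lam = (\<lambda>(n, E). (n + 1, (`) Suc ` E \<union> {{1, 2}, {1, n + 3}}))"

definition tri_oplus :: "nat \<times> nat set set \<Rightarrow> nat \<times> nat set set \<Rightarrow> nat \<times> nat set set" where
  "tri_oplus = (\<lambda>(n1, E1) (n2, E2).
     (n1 + n2, E1 \<union> (`) (\<lambda>j. if j = 1 then 1 else n1 + j) ` E2))"

definition triangulations :: "(nat \<times> nat set set) catalan" where
  "triangulations = \<lparr>
     graded = (\<lambda>n. {(n, E) | E. triangulation n E}),
     neutral = (0, {{1, 2}}),
     lam = tri_lam,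
     oplus = tri_oplus \<rparr>"

definition tri_comp :: "nat \<times> nat set set \<Rightarrow> nat" where
  "tri_comp = (\<lambda>(n, E). card {x \<in> E. 1 \<in> x} - 1)"

definition tri_rcomp :: "nat \<times> nat set set \<Rightarrow> nat" where
  "tri_rcomp = (\<lambda>(n, E). card {x \<in> E. n + 2 \<in> x} - 1)"

definition tr :: "nat \<times> nat set set \<Rightarrow> nat" where
  "tr = (\<lambda>(n, E). card {i \<in> {2..n + 1}. \<exists>j < i. {j, i} \<in> E \<and> {j, i + 1} \<in> E})"

definition nontr :: "nat \<times> nat set set \<Rightarrow> nat" where
  "nontr T = fst T + 1 - tr T"


section \<open>Pattern-avoiding permutations\<close>

text \<open>
  A permutation of \<open>{1..n}\<close> is the list of its values; list positions are counted from \<open>0\<close>.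
\<close>

definition is_perm :: "nat list \<Rightarrow> bool" where
  "is_perm p \<longleftrightarrow> distinct p \<and> set p = {1..length p}"

definition avoids_231 :: "nat list \<Rightarrow> bool" where
  "avoids_231 p \<longleftrightarrow>
     \<not> (\<exists>i j k. i < j \<and> j < k \<and> k < length p \<and> p ! k < p ! i \<and> p ! i < p ! j)"

definition avoids_321 :: "nat list \<Rightarrow> bool" where
  "avoids_321 p \<longleftrightarrow>
     \<not> (\<exists>i j k. i < j \<and> j < k \<and> k < length p \<and> p ! k < p ! j \<and> p ! j < p ! i)"

definition direct_sum :: "nat list \<Rightarrow> nat list \<Rightarrow> nat list" where
  "direct_sum p q = p @ map (\<lambda>x. x + length p) q"

definition sum_indecomposable :: "nat list \<Rightarrow> bool" where
  "sum_indecomposable p \<longleftrightarrow> is_perm p \<and> p \<noteq> [] \<and>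
     \<not> (\<exists>q r. is_perm q \<and> is_perm r \<and> q \<noteq> [] \<and> r \<noteq> [] \<and> p = direct_sum q r)"

definition direct_sum_components :: "nat list \<Rightarrow> nat list list" where
  "direct_sum_components p =
     (THE qs. (\<forall>q \<in> set qs. sum_indecomposable q) \<and> p = foldr direct_sum qs [])"

definition perm_comp :: "nat list \<Rightarrow> nat" where
  "perm_comp p = length (direct_sum_components p)"

definition lr_max :: "nat list \<Rightarrow> nat set" where
  "lr_max p = {i \<in> {..<length p}. \<forall>j < i. p ! j < p ! i}"

definition rl_max :: "nat list \<Rightarrow> nat set" where
  "rl_max p = {i \<in> {..<length p}. \<forall>j \<in> {i<..<length p}. p ! j < p ! i}"

definition rl_min :: "nat list \<Rightarrow> nat set" where
  "rl_min p = {i \<in> {..<length p}. \<forall>j \<in> {i<..<length p}. p ! i < p ! j}"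

definition rmax :: "nat list \<Rightarrow> nat" where
  "rmax p = card (rl_max p)"

definition rmin :: "nat list \<Rightarrow> nat" where
  "rmin p = card (rl_min p)"

definition nonrmin :: "nat list \<Rightarrow> nat" where
  "nonrmin p = 1 + card ({..<length p} - rl_min p)"

definition perms_231 :: "nat list catalan" where
  "perms_231 = \<lparr>
     graded = (\<lambda>n. {p. is_perm p \<and> length p = n \<and> avoids_231 p}),
     neutral = [],
     lam = (\<lambda>p. (length p + 1) # p),
     oplus = direct_sum \<rparr>"

definition next_cyclic :: "nat set \<Rightarrow> nat \<Rightarrow> nat" where
  "next_cyclic B j = (if \<exists>k \<in> B. j < k then Min {k \<in> B. j < k} else Min B)"

definition lam_321 :: "nat list \<Rightarrow> nat list" where
  "lam_321 p =
     (if p = [] then [1] else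
      (let n = length p;
           i = (THE i. i < n \<and> p ! i = 1);
           boxes = {j \<in> lr_max p - rl_min p. i < j};
           q = take i p @ [n + 1] @ drop i p;
           B = insert i (Suc ` boxes)
       in map (\<lambda>j. if j \<in> B then q ! next_cyclic B j else q ! j) [0..<n + 1]))"

definition perms_321 :: "nat list catalan" where
  "perms_321 = \<lparr>
     graded = (\<lambda>n. {p. is_perm p \<and> length p = n \<and> avoids_321 p}),
     neutral = [],
     lam = lam_321,
     oplus = direct_sum \<rparr>"

definition rcomp_321 :: "nat list \<Rightarrow> nat" where
  "rcomp_321 p = (if p = [] then 0 else length p - last p + 1)"


section \<open>Binary trees\<close>

datatype btree = Empty | Bin btree btree

fun nodes :: "btree \<Rightarrow> nat" where
  "nodes Empty = 0"
| "nodes (Bin l r) = nodes l + nodes r + 1"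

fun bt_oplus :: "btree \<Rightarrow> btree \<Rightarrow> btree" where
  "bt_oplus Empty b = b"
| "bt_oplus (Bin t b1) b2 = Bin t (bt_oplus b1 b2)"

definition binary_trees :: "btree catalan" where
  "binary_trees = \<lparr>
     graded = (\<lambda>n. {t. nodes t = n}),
     neutral = Empty,
     lam = (\<lambda>t. Bin t Empty),
     oplus = bt_oplus \<rparr>"

text \<open>A node is represented by the subtree rooted at it.\<close>

fun right_spine :: "btree \<Rightarrow> btree list" where
  "right_spine Empty = []"
| "right_spine (Bin l r) = Bin l r # right_spine r"

fun left_subtree :: "btree \<Rightarrow> btree" where
  "left_subtree Empty = Empty"
| "left_subtree (Bin l r) = l"

definition bt_comp :: "btree \<Rightarrow> nat" where
  "bt_comp t = length (right_spine t)"

definition bt_rcomp :: "btree \<Rightarrow> nat" where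
  "bt_rcomp t = (LEAST k. ((\<lambda>s. left_subtree (last (right_spine s))) ^^ k) t = Empty)"

fun right_edges :: "btree \<Rightarrow> nat" where
  "right_edges Empty = 0"
| "right_edges (Bin l r) = right_edges l + right_edges r + (if r = Empty then 0 else 1)"

definition redge :: "btree \<Rightarrow> nat" where
  "redge t = 1 + right_edges t"

definition ledge :: "btree \<Rightarrow> nat" where
  "ledge t = nodes t + 1 - redge t"


section \<open>Two-row standard Young tableaux\<close>

text \<open>A tableau is the pair of its top row and its bottom row.\<close>

definition syt :: "nat \<Rightarrow> nat list \<times> nat list \<Rightarrow> bool" where
  "syt n = (\<lambda>(upper, lower).
     length upper = n \<and> length lower = n \<and> set upper \<union> set lower = {1..2 * n} \<and>
     sorted_wrt (<) upper \<and> sorted_wrt (<) lower \<and> (\<forall>i < n. upper ! i < lower ! i))"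

definition syt_lam :: "nat list \<times> nat list \<Rightarrow> nat list \<times> nat list" where
  "syt_lam = (\<lambda>(upper, lower). (1 # map Suc upper, map Suc lower @ [2 * length upper + 2]))"

definition syt_oplus ::
    "nat list \<times> nat list \<Rightarrow> nat list \<times> nat list \<Rightarrow> nat list \<times> nat list" where
  "syt_oplus = (\<lambda>(upper1, lower1) (upper2, lower2).
     (upper1 @ map (\<lambda>x. x + 2 * length upper1) upper2,
      lower1 @ map (\<lambda>x. x + 2 * length upper1) lower2))"

definition tableaux :: "(nat list \<times> nat list) catalan" where
  "tableaux = \<lparr>
     graded = (\<lambda>n. {T. syt n T}),
     neutral = ([], []),
     lam = syt_lam,
     oplus = syt_oplus \<rparr>"

definition syt_comp :: "nat list \<times> nat list \<Rightarrow> nat" where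
  "syt_comp = (\<lambda>(upper, lower).
     card {k \<in> {1..length upper}. set (take k upper) \<union> set (take k lower) = {1..2 * k}})"

definition syt_rcomp :: "nat list \<times> nat list \<Rightarrow> nat" where
  "syt_rcomp = (\<lambda>(upper, lower).
     GREATEST k. k \<le> length lower \<and> (\<forall>j < k. rev lower ! j = 2 * length lower - j))"

definition cons :: "nat list \<times> nat list \<Rightarrow> nat" where
  "cons = (\<lambda>(upper, lower). 1 + card {i \<in> set upper. i + 1 \<in> set upper})"

definition noncons :: "nat list \<times> nat list \<Rightarrow> nat" where
  "noncons = (\<lambda>(upper, lower). card {i \<in> set upper. i + 1 \<in> set lower})"


section \<open>Non-crossing partitions\<close>

text \<open>The size of a partition \<open>P\<close> of \<open>{1..n}\<close> is recovered as \<open>card (\<Union>P) = n\<close>.\<close>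

definition noncrossing :: "nat set set \<Rightarrow> bool" where
  "noncrossing P \<longleftrightarrow>
     \<not> (\<exists>X \<in> P. \<exists>Y \<in> P. X \<noteq> Y \<and>
          (\<exists>a b c d. a < b \<and> b < c \<and> c < d \<and> a \<in> X \<and> c \<in> X \<and> b \<in> Y \<and> d \<in> Y))"

definition ncp_lam :: "nat set set \<Rightarrow> nat set set" where
  "ncp_lam P =
     (if P = {} then {{1}}
      else (\<lambda>X. if 1 \<in> X then insert (card (\<Union>P) + 1) X else X) ` P)"

definition ncp_oplus :: "nat set set \<Rightarrow> nat set set \<Rightarrow> nat set set" where
  "ncp_oplus P Q = P \<union> (`) (\<lambda>x. x + card (\<Union>P)) ` Q"

definition noncrossing_partitions :: "nat set set catalan" where
  "noncrossing_partitions = \<lparr>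
     graded = (\<lambda>n. {P. partition_on {1..n} P \<and> noncrossing P}),
     neutral = {},
     lam = ncp_lam,
     oplus = ncp_oplus \<rparr>"

definition ncp_comp :: "nat set set \<Rightarrow> nat" where
  "ncp_comp P = card {k \<in> {1..card (\<Union>P)}. \<exists>Q \<subseteq> P. \<Union>Q = {1..k}}"

definition flattened :: "nat set set \<Rightarrow> nat list" where
  "flattened P =
     concat (map (\<lambda>X. rev (sorted_list_of_set X)) (sorted_key_list_of_set Min P))"

definition ncp_rcomp :: "nat set set \<Rightarrow> nat" where
  "ncp_rcomp P = rmax (flattened P)"

definition blocks :: "nat set set \<Rightarrow> nat" where
  "blocks P = card P"

definition nonmin :: "nat set set \<Rightarrow> nat" where
  "nonmin P = card (\<Union>P) + 1 - blocks P"

end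

theory Submission
  imports Defs
begin

text \<open>
  Plane trees are freely generated by \<open>e\<close>, \<open>\<lambda>\<close> and \<open>\<oplus>\<close>, so the canonical map into any structure
  whose operations are graded, associative and unital is determined by structural recursion;
  unique decomposition in the target plays no role for its existence. It thus suffices that each
  family is closed under its operations and that its native statistics obey the defining recursion
  of \<open>sub\<close>, \<open>rpath\<close> and \<open>leaves\<close>. The recursion for \<open>internal\<close> follows from
  \<open>leaves + internal = n + 1\<close>.
\<close>

section \<open>The canonical map out of plane trees\<close>

text \<open>\<open>leaves\<close> of the single node is 1, while most of its native partners give 0
  on their empty object (the empty path has no peak). The recursion for the third statistic is
  therefore anchored at lambda(e), where both sides are 1, and lambda has to preserve it only from
  size 1 on; this is also where the restriction n >= 1 comes from. Statistics that count positions
  split at the boundary between two summands, which is what \<open>card_interval_add\<close> is for.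
  The hard family is 321-avoidance: the cyclic shift of boxed values shows no recursive structure
  until its result is seen as an interleaving of two increasing words. For non-crossing partitions,
  flattening turns lambda and oplus into prepending a new maximum and shifted concatenation, so that
  the second statistic reduces to the lemmas on \<open>rmax\<close> made for 231-avoidance.\<close>

lemma card_interval_add:
  "card {k \<in> {1..m + n}. P k} = card {k \<in> {1..m}. P k} + card {k \<in> {1..n::nat}. P (m + k)}"
proof -
  have "{k \<in> {1..m + n}. P k} = {k \<in> {1..m}. P k} \<union> (+) m ` {k \<in> {1..n}. P (m + k)}" (is "?L = ?R")
  proof (intro equalityI subsetI)
    fix k assume k: "k \<in> ?L"
    then show "k \<in> ?R"
      by (cases "k \<le> m") (auto intro!: image_eqI[where x = "k - m"])
  qed auto
  then show ?thesis
    by (subst card_image[of "(+) m", symmetric]) (auto intro!: card_Un_disjoint)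
qed

text \<open>Lets the test for an exactly filled initial segment pass to the second summand, for
  tableaux and for partitions. That 0 is not in \<open>A\<close> matters: for m > 0 it would be
  shifted to m, which the segment already contains, and \<open>A\<close> could not be read off from
  the union.\<close>

lemma atLeastAtMost_Un_shift_eq_iff:
  fixes A :: "nat set"
  assumes "0 \<notin> A"
  shows "{1..m} \<union> (\<lambda>x. x + m) ` A = {1..m + j} \<longleftrightarrow> A = {1..j}"
proof
  assume eq: "{1..m} \<union> (\<lambda>x. x + m) ` A = {1..m + j}"
  have "x \<in> A \<longleftrightarrow> x \<in> {1..j}" for x
  proof (cases "x = 0")
    case False
    then have "x \<in> A \<longleftrightarrow> x + m \<in> {1..m} \<union> (\<lambda>x. x + m) ` A" by auto
    also have "\<dots> \<longleftrightarrow> x \<in> {1..j}" unfolding eq using False by auto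
    finally show ?thesis .
  qed (use assms in auto)
  then show "A = {1..j}" by blast
next
  assume A: "A = {1..j}"
  have "x \<in> (\<lambda>x. x + m) ` {1..j} \<longleftrightarrow> m < x \<and> x \<le> m + j" for x
  proof
    assume "m < x \<and> x \<le> m + j"
    then show "x \<in> (\<lambda>x. x + m) ` {1..j}" by (intro image_eqI[where x = "x - m"]) auto
  qed auto
  then show "{1..m} \<union> (\<lambda>x. x + m) ` A = {1..m + j}" unfolding A by force
qed

locale catalan_algebra =
  fixes S :: "'a catalan"
  assumes neutral_graded: "neutral S \<in> graded S 0"
    and lam_graded: "x \<in> graded S n \<Longrightarrow> lam S x \<in> graded S (Suc n)"
    and oplus_graded: "x \<in> graded S m \<Longrightarrow> y \<in> graded S n \<Longrightarrow> oplus S x y \<in> graded S (m + n)"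
    and oplus_assoc: "x \<in> graded S l \<Longrightarrow> y \<in> graded S m \<Longrightarrow> z \<in> graded S n \<Longrightarrow>
      oplus S (oplus S x y) z = oplus S x (oplus S y z)"
    and oplus_neutral_left: "x \<in> graded S n \<Longrightarrow> oplus S (neutral S) x = x"
    and oplus_neutral_right: "x \<in> graded S n \<Longrightarrow> oplus S x (neutral S) = x"
begin

text \<open>A nonempty child list is lambda of its head followed by the rest. Even an only child is
  thus composed with a final neutral element, which \<open>eval_tree_singleton\<close>
  removes.\<close>

fun eval_tree :: "tree \<Rightarrow> 'a" where
  "eval_tree (Node []) = neutral S"
| "eval_tree (Node (t # ts)) = oplus S (lam S (eval_tree t)) (eval_tree (Node ts))"

lemma eval_tree_graded: "eval_tree t \<in> graded S (edges t)"
proof (induction t rule: eval_tree.induct)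
  case (2 t ts)
  from oplus_graded[OF lam_graded[OF 2(1)] 2(2)] show ?case by simp
qed (simp add: neutral_graded)

lemma eval_tree_singleton: "eval_tree (Node [t]) = lam S (eval_tree t)"
  using oplus_neutral_right[OF lam_graded[OF eval_tree_graded]] by simp

lemma eval_tree_append:
  "eval_tree (Node (us @ vs)) = oplus S (eval_tree (Node us)) (eval_tree (Node vs))"
proof (induction us)
  case Nil
  show ?case using oplus_neutral_left[OF eval_tree_graded] by simp
next
  case (Cons u us)
  then show ?case
    using oplus_assoc[OF lam_graded[OF eval_tree_graded] eval_tree_graded eval_tree_graded]
    by simp
qed

lemma carrier_plane_trees: "carrier plane_trees = UNIV"
  by (auto simp: carrier_def plane_trees_def)

text \<open>Every tree lies in the carrier, so extensionality leaves no value open, and the three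
  equations fix the value at each tree along the recursion of \<open>eval_tree\<close>.\<close>

lemma canonical_bijection_plane_trees: "canonical_bijection plane_trees S = eval_tree"
  unfolding canonical_bijection_def
proof (rule the_equality)
  have "eval_tree t \<in> carrier S" for t
    using eval_tree_graded by (auto simp: carrier_def)
  moreover have "eval_tree (Node (children u @ children v)) = oplus S (eval_tree u) (eval_tree v)"
    for u v by (simp add: eval_tree_append)
  ultimately show "eval_tree \<in> carrier plane_trees \<rightarrow>\<^sub>E carrier S \<and>
      eval_tree (neutral plane_trees) = neutral S \<and>
      (\<forall>t\<in>carrier plane_trees. eval_tree (lam plane_trees t) = lam S (eval_tree t)) \<and>
      (\<forall>u\<in>carrier plane_trees. \<forall>v\<in>carrier plane_trees.
         eval_tree (oplus plane_trees u v) = oplus S (eval_tree u) (eval_tree v))"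
    unfolding carrier_plane_trees
    by (auto simp: plane_trees_def eval_tree_singleton simp del: eval_tree.simps(2))
next
  fix \<phi>
  assume "\<phi> \<in> carrier plane_trees \<rightarrow>\<^sub>E carrier S \<and>
      \<phi> (neutral plane_trees) = neutral S \<and>
      (\<forall>t\<in>carrier plane_trees. \<phi> (lam plane_trees t) = lam S (\<phi> t)) \<and>
      (\<forall>u\<in>carrier plane_trees. \<forall>v\<in>carrier plane_trees.
         \<phi> (oplus plane_trees u v) = oplus S (\<phi> u) (\<phi> v))"
  then have \<phi>: "\<phi> (Node []) = neutral S" "\<phi> (Node [t]) = lam S (\<phi> t)"
    "\<phi> (Node (children u @ children v)) = oplus S (\<phi> u) (\<phi> v)" for t u v
    by (auto simp: carrier_plane_trees, auto simp: plane_trees_def)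
  have "\<phi> t = eval_tree t" for t
  proof (induction t rule: eval_tree.induct)
    case (2 t ts)
    with \<phi>(3)[of "Node [t]" "Node ts"] \<phi>(2) show ?case by simp
  qed (simp add: \<phi>)
  then show "\<phi> = eval_tree" by blast
qed

section \<open>Transport criterion for the four statistics\<close>

text \<open>A tree with n edges has n + 1 nodes, each a leaf or internal. Gluing merges two internal
  roots into one, whence the \<open>- 1\<close>; \<open>internal_pos\<close> keeps that subtraction
  from being truncated.\<close>

lemma leaves_plus_internal: "ts \<noteq> [] \<Longrightarrow> leaves (Node ts) + internal (Node ts) = edges (Node ts) + 1"
proof (induction "Node ts" arbitrary: ts rule: leaves.induct)
  case (2 t)
  then show ?case by (cases t; cases "children t") auto
next
  case (3 t s ts)
  have "internal (Node (s # ts)) \<ge> 1" by (rule internal_pos) simp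
  with 3 show ?case by simp
qed simp

text \<open>In the applications, \<open>goal_cases\<close> numbers the hypotheses in this order: 1-3
  concern \<open>s\<close>, 4-6 concern \<open>r\<close>, 7-9 concern \<open>l\<close>, and 10 is
  the complement rule. \<open>Suc\<close> in a size encodes that the operand differs from e.\<close>

lemma canonical_stats_equalI:
  assumes s_neutral: "s (neutral S) = 0"
    and s_lam: "\<And>x n. x \<in> graded S n \<Longrightarrow> s (lam S x) = 1"
    and s_oplus: "\<And>x y m n. x \<in> graded S (Suc m) \<Longrightarrow> y \<in> graded S (Suc n) \<Longrightarrow>
      s (oplus S x y) = s x + s y"
    and r_neutral: "r (neutral S) = 0"
    and r_lam: "\<And>x n. x \<in> graded S n \<Longrightarrow> r (lam S x) = Suc (r x)"
    and r_oplus: "\<And>x y m n. x \<in> graded S (Suc m) \<Longrightarrow> y \<in> graded S (Suc n) \<Longrightarrow>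
      r (oplus S x y) = r y"
    and l_lam_neutral: "l (lam S (neutral S)) = 1"
    and l_lam: "\<And>x n. x \<in> graded S (Suc n) \<Longrightarrow> l (lam S x) = l x"
    and l_oplus: "\<And>x y m n. x \<in> graded S (Suc m) \<Longrightarrow> y \<in> graded S (Suc n) \<Longrightarrow>
      l (oplus S x y) = l x + l y"
    and l_i: "\<And>x n. x \<in> graded S (Suc n) \<Longrightarrow> l x + i x = n + 2"
  shows "canonical_stats_equal (canonical_bijection plane_trees S) s r l i"
proof -
  have graded_cons: "eval_tree (Node (u # us)) \<in> graded S (Suc (edges u + edges (Node us)))" for u us
    using eval_tree_graded[of "Node (u # us)"] by simp
  have eval_cons: "eval_tree (Node (t # u # us)) = oplus S (eval_tree (Node [t])) (eval_tree (Node (u # us)))"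
    for t u us using eval_tree_append[of "[t]" "u # us"] by (simp del: eval_tree.simps(2))
  have "sub t = s (eval_tree t) \<and> rpath t = r (eval_tree t) \<and>
      (edges t \<ge> 1 \<longrightarrow> leaves t = l (eval_tree t))" for t
  proof (induction t rule: leaves.induct)
    case 1
    show ?case by (simp add: s_neutral r_neutral)
  next
    case (2 t)
    have "leaves t = l (lam S (eval_tree t))"
    proof (cases "edges t")
      case 0
      then have "t = Node []" by (cases t; cases "children t") auto
      then show ?thesis by (simp add: l_lam_neutral)
    next
      case (Suc n)
      with l_lam eval_tree_graded[of t] 2 show ?thesis by simp
    qed
    with 2 show ?case
      using s_lam[OF eval_tree_graded] r_lam[OF eval_tree_graded]
      by (simp add: eval_tree_singleton del: eval_tree.simps(2))
  next
    case (3 t u us)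
    then show ?case
      using s_oplus[OF graded_cons graded_cons] r_oplus[OF graded_cons graded_cons]
        l_oplus[OF graded_cons graded_cons]
      by (simp add: eval_cons del: eval_tree.simps(2))
  qed
  moreover have "internal t = i (eval_tree t)" if nonempty: "edges t \<ge> 1" and leaves: "leaves t = l (eval_tree t)" for t
  proof -
    obtain u us where t: "t = Node (u # us)" using nonempty by (cases t rule: eval_tree.cases) auto
    show ?thesis
      using l_i[OF graded_cons, of u us] leaves_plus_internal[of "u # us"] leaves by (simp add: t)
  qed
  ultimately show ?thesis
    unfolding canonical_stats_equal_def canonical_bijection_plane_trees
    by (auto simp: plane_trees_def)
qed

end

section \<open>Dyck paths\<close>

lemma height_simps [simp]:
  "height [] = 0" "height (U # w) = height w + 1" "height (D # w) = height w - 1"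
  "height (u @ v) = height u + height v"
  by (auto simp: height_def)

text \<open>No bound on \<open>k\<close>: beyond the length, \<open>take k w\<close> is
  \<open>w\<close> itself, of height 0. Concatenation can then be checked prefix by prefix without
  side conditions.\<close>

definition dyck_path :: "step list \<Rightarrow> bool" where
  "dyck_path w \<longleftrightarrow> height w = 0 \<and> (\<forall>k. height (take k w) \<ge> 0)"

lemma graded_dyck_paths: "graded dyck_paths n = {w. length w = 2 * n \<and> dyck_path w}"
  unfolding dyck_paths_def dyck_path_def by (auto, metis nle_le take_all)

lemma dyck_path_append: "dyck_path u \<Longrightarrow> dyck_path v \<Longrightarrow> dyck_path (u @ v)"
  by (auto simp: dyck_path_def)

lemma dyck_path_lift: "dyck_path w \<Longrightarrow> dyck_path (U # w @ [D])"
proof -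
  assume w: "dyck_path w"
  then have "height (take k w) \<ge> 0" for k by (auto simp: dyck_path_def)
  then have "height (take k (U # w @ [D])) \<ge> 0" for k
    \<comment> \<open>The second split asks whether the prefix reaches the final \<open>D\<close>. A
      nonempty prefix that does not is one higher than a prefix of \<open>w\<close>; the whole word
      has height 0.\<close>
    using w by (cases k; cases "k - length w - 1") (auto simp: dyck_path_def)
  with w show ?thesis by (auto simp: dyck_path_def)
qed

lemma hd_dyck_path:
  assumes "dyck_path w" "w \<noteq> []"
  shows "hd w = U"
proof -
  have "height (take 1 w) \<ge> 0" using assms unfolding dyck_path_def by blast
  with assms(2) show ?thesis by (cases w; cases "hd w") auto
qed

text \<open>The height is nonnegative before the last step and 0 after it.\<close>

lemma last_dyck_path:
  assumes "dyck_path w" "w \<noteq> []"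
  shows "last w = D"
proof -
  have w: "w = butlast w @ [last w]" using assms(2) by simp
  have "height (butlast w) \<ge> 0" using assms(1) unfolding dyck_path_def butlast_conv_take by blast
  moreover have "height (butlast w) + height [last w] = 0"
    using assms(1) w height_simps(4) by (metis dyck_path_def)
  ultimately show ?thesis by (cases "last w") auto
qed

lemma count_U_dyck_path:
  assumes "dyck_path w"
  shows "2 * count_list w U = length w"
proof -
  have "count_list w U + count_list w D = length w"
  proof (induction w)
    case (Cons a w)
    then show ?case by (cases a) auto
  qed simp
  with assms show ?thesis by (auto simp: dyck_path_def height_def)
qed

section \<open>Two-letter factors and components of Dyck paths\<close>

definition factors :: "'a \<Rightarrow> 'a \<Rightarrow> 'a list \<Rightarrow> nat" where
  "factors a b w = card {i. i + 1 < length w \<and> w ! i = a \<and> w ! (i + 1) = b}"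

lemma factors_short [simp]: "factors a b [] = 0" "factors a b [x] = 0"
  by (auto simp: factors_def)

lemma factors_Cons [simp]:
  "factors a b (x # y # w) = of_bool (x = a \<and> y = b) + factors a b (y # w)"
proof -
  have *: "{i. i + 1 < length (x # y # w) \<and> (x # y # w) ! i = a \<and> (x # y # w) ! (i + 1) = b} =
      {i. i = 0 \<and> x = a \<and> y = b} \<union>
      Suc ` {i. i + 1 < length (y # w) \<and> (y # w) ! i = a \<and> (y # w) ! (i + 1) = b}"
    (is "?L = ?R")
  proof (intro equalityI subsetI)
    fix i assume "i \<in> ?L"
    then show "i \<in> ?R" by (cases i) auto
  qed auto
  show ?thesis
    unfolding factors_def * by (subst card_Un_disjoint) (auto simp: card_image)
qed

lemma factors_append:
  "u \<noteq> [] \<Longrightarrow> v \<noteq> [] \<Longrightarrow>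
    factors a b (u @ v) = factors a b u + factors a b v + of_bool (last u = a \<and> hd v = b)"
proof (induction u rule: induct_list012)
  case (2 x)
  then show ?case by (cases v) auto
qed auto

text \<open>Every \<open>U\<close> is followed by \<open>D\<close>, followed by \<open>U\<close>, or
  ends the word. The last cannot happen in a Dyck path, which gives the complement rule for
  \<open>peak\<close> and \<open>nonpeak\<close>.\<close>

lemma factors_U:
  "w \<noteq> [] \<Longrightarrow> factors U D w + factors U U w + of_bool (last w = U) = count_list w U"
proof (induction w rule: induct_list012)
  case (3 x y w)
  then show ?case by (cases x; cases y) auto
qed auto

lemma peak_factors: "peak w = factors U D w"
  by (auto simp: peak_def factors_def intro: arg_cong[where f = card])

lemma nonpeak_factors: "nonpeak w = 1 + factors U U w"
  by (auto simp: nonpeak_def factors_def intro: arg_cong[where f = card])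

lemma dyck_comp_append:
  assumes "dyck_path u"
  shows "dyck_comp (u @ v) = dyck_comp u + dyck_comp v"
proof -
  have "{k \<in> {1..length u}. height (take k (u @ v)) = 0} = {k \<in> {1..length u}. height (take k u) = 0}"
    by auto
  moreover have "height (take (length u + k) (u @ v)) = height (take k v)" for k
    using assms by (simp add: dyck_path_def)
  ultimately show ?thesis
    unfolding dyck_comp_def length_append card_interval_add by simp
qed

text \<open>Between the outer letters each height is one more than a nonnegative height of
  \<open>w\<close>, so the only return is at the end.\<close>

lemma dyck_comp_lift:
  assumes "dyck_path w"
  shows "dyck_comp (U # w @ [D]) = 1"
proof -
  have *: "height (take k w) \<ge> 0" for k using assms by (auto simp: dyck_path_def)
  have "{k \<in> {1..length (U # w @ [D])}. height (take k (U # w @ [D])) = 0} = {length w + 2}"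
    (is "?L = ?R")
  proof (intro equalityI subsetI)
    fix k assume k: "k \<in> ?L"
    then obtain j where j: "k = Suc j" by (cases k) auto
    show "k \<in> ?R"
    proof (cases "j \<le> length w")
      case True
      with k j *[of j] show ?thesis by auto
    qed (use k j in auto)
  qed (use assms in \<open>auto simp: dyck_path_def\<close>)
  then show ?thesis unfolding dyck_comp_def by simp
qed

interpretation dyck_paths: catalan_algebra dyck_paths
proof unfold_locales
  fix x n assume "x \<in> graded dyck_paths n"
  then show "lam dyck_paths x \<in> graded dyck_paths (Suc n)"
    using dyck_path_lift by (auto simp: graded_dyck_paths) (auto simp: dyck_paths_def)
next
  fix x y m n assume "x \<in> graded dyck_paths m" "y \<in> graded dyck_paths n"
  then show "oplus dyck_paths x y \<in> graded dyck_paths (m + n)"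
    using dyck_path_append by (auto simp: graded_dyck_paths) (auto simp: dyck_paths_def)
qed (auto simp: dyck_paths_def)

lemma canonical_stats_dyck_paths:
  "canonical_stats_equal (canonical_bijection plane_trees dyck_paths)
     dyck_comp dyck_rcomp peak nonpeak"
proof -
  have ops: "neutral dyck_paths = []" "lam dyck_paths x = U # x @ [D]" "oplus dyck_paths = (@)" for x
    by (simp_all add: dyck_paths_def)
  show ?thesis
  proof (rule dyck_paths.canonical_stats_equalI, goal_cases)
    case (6 x y m n)
    \<comment> \<open>The final run of \<open>D\<close> stops at a \<open>U\<close> inside
      \<open>y\<close>, so putting \<open>x\<close> in front does not change it.\<close>
    then have "count_list y U \<noteq> 0" using count_U_dyck_path[of y] by (auto simp: graded_dyck_paths)
    then have "U \<in> set (rev y)" by (auto simp: count_list_0_iff)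
    from takeWhile_append1[OF this] show ?case by (simp add: dyck_rcomp_def ops)
  next
    case (8 x n)
    then have "x \<noteq> []" "dyck_path x" by (auto simp: graded_dyck_paths)
    \<comment> \<open>The seams of \<open>U # x @ [D]\<close> read \<open>UU\<close> and
      \<open>DD\<close>, so no peak is added.\<close>
    then have "x \<noteq> []" "hd x = U" "last x = D" by (simp_all add: hd_dyck_path last_dyck_path)
    then show ?case
      by (cases x) (auto simp: ops peak_factors factors_append[of "_ # _"] simp flip: append_Cons)
  next
    case (9 x y m n)
    then have "x \<noteq> []" "y \<noteq> []" "dyck_path x" by (auto simp: graded_dyck_paths)
    then have "x \<noteq> []" "y \<noteq> []" "last x = D" by (simp_all add: last_dyck_path)
    then show ?case by (simp add: ops peak_factors factors_append)
  next
    case (10 x n)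
    then have "x \<noteq> []" "dyck_path x" "length x = 2 * Suc n" by (auto simp: graded_dyck_paths)
    then have "x \<noteq> []" "last x = D" "2 * count_list x U = 2 * Suc n"
      by (simp_all add: last_dyck_path count_U_dyck_path)
    then show ?case using factors_U[of x] by (simp add: peak_factors nonpeak_factors)
  qed (auto simp: ops graded_dyck_paths dyck_comp_lift dyck_comp_append peak_factors
      dyck_rcomp_def takeWhile_tail, auto simp: dyck_comp_def)
qed

section \<open>Triangulations\<close>

lemma crossing_iff:
  assumes "a < b" "c < d"
  shows "crossing {a, b} {c, d} \<longleftrightarrow> a < c \<and> c < b \<and> b < d \<or> c < a \<and> a < d \<and> d < b"
    (is "?L \<longleftrightarrow> ?R")
proof
  assume ?L
  then obtain p q r s where *: "p < q" "q < r" "r < s"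
    "{a, b} = {p, r} \<and> {c, d} = {q, s} \<or> {a, b} = {q, s} \<and> {c, d} = {p, r}"
    unfolding crossing_def by blast
  with assms show ?R unfolding doubleton_eq_iff by linarith
next
  assume ?R
  then show ?L unfolding crossing_def by blast
qed

lemma chord_iff: "a < b \<Longrightarrow> {a, b} \<in> chords n \<longleftrightarrow> 1 \<le> a \<and> b \<le> n + 2"
  unfolding chords_def by (auto simp: doubleton_eq_iff)

lemma chordE:
  assumes "x \<in> chords n"
  obtains a b where "x = {a, b}" "1 \<le> a" "a < b" "b \<le> n + 2"
  using assms unfolding chords_def by blast

text \<open>A proper non-crossing superset of \<open>E\<close> contains a chord outside
  \<open>E\<close> that crosses nothing in \<open>E\<close>, and adding one such chord keeps
  \<open>E\<close> non-crossing; so maximality may be tested on single chords. The inequalities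
  force c < d by themselves, which is why the quantifiers over \<open>c\<close> and \<open>d\<close>
  carry no order.\<close>

lemma triangulation_iff:
  "triangulation n E \<longleftrightarrow>
     E \<subseteq> chords n \<and>
     (\<forall>a b c d. a < b \<and> b < c \<and> c < d \<longrightarrow> {a, c} \<in> E \<longrightarrow> {b, d} \<notin> E) \<and>
     (\<forall>a b. 1 \<le> a \<and> a < b \<and> b \<le> n + 2 \<longrightarrow>
        (\<forall>c d. {c, d} \<in> E \<longrightarrow> \<not> (a < c \<and> c < b \<and> b < d) \<and> \<not> (c < a \<and> a < d \<and> d < b)) \<longrightarrow>
        {a, b} \<in> E)" (is "_ \<longleftrightarrow> ?subset \<and> ?noncrossing \<and> ?maximal")
proof -
  have nc: "noncrossing_chords n E \<longleftrightarrow> ?subset \<and> ?noncrossing"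
    unfolding noncrossing_chords_def crossing_def by blast
  have not_self: "\<not> crossing x x" for x
    unfolding crossing_def by (auto simp: doubleton_eq_iff)
  have sym: "crossing x y \<Longrightarrow> crossing y x" for x y
    unfolding crossing_def by blast
  have "(\<forall>F. noncrossing_chords n F \<and> E \<subseteq> F \<longrightarrow> F = E) \<longleftrightarrow>
      (\<forall>e \<in> chords n. (\<forall>x \<in> E. \<not> crossing e x) \<longrightarrow> e \<in> E)" if "noncrossing_chords n E"
  proof safe
    fix e assume max: "\<forall>F. noncrossing_chords n F \<and> E \<subseteq> F \<longrightarrow> F = E"
      and e: "e \<in> chords n" "\<forall>x \<in> E. \<not> crossing e x"
    have "noncrossing_chords n (insert e E)"
      using that e not_self sym unfolding noncrossing_chords_def by blast
    with max have "insert e E = E" by blast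
    then show "e \<in> E" by blast
  next
    fix F x assume "\<forall>e \<in> chords n. (\<forall>x \<in> E. \<not> crossing e x) \<longrightarrow> e \<in> E"
      and "noncrossing_chords n F" "E \<subseteq> F" "x \<in> F"
    then show "x \<in> E" unfolding noncrossing_chords_def by blast
  qed
  moreover have "(\<forall>e \<in> chords n. (\<forall>x \<in> E. \<not> crossing e x) \<longrightarrow> e \<in> E) \<longleftrightarrow>
      ?maximal" (is "?L \<longleftrightarrow> ?R") if "noncrossing_chords n E"
  proof -
    have "(\<forall>x \<in> E. \<not> crossing {a, b} x) \<longleftrightarrow>
        (\<forall>c d. {c, d} \<in> E \<longrightarrow> \<not> (a < c \<and> c < b \<and> b < d) \<and> \<not> (c < a \<and> a < d \<and> d < b))"
      (is "?A \<longleftrightarrow> ?B") if ab: "a < b" for a b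
    proof
      assume A: ?A
      show ?B
      proof (intro allI impI)
        fix c d assume cd: "{c, d} \<in> E"
        show "\<not> (a < c \<and> c < b \<and> b < d) \<and> \<not> (c < a \<and> a < d \<and> d < b)"
        proof (rule ccontr)
          assume neg: "\<not> ?thesis"
          then have "c < d" by auto
          with neg A cd ab show False using crossing_iff[of a b c d] by blast
        qed
      qed
    next
      assume B: ?B
      show ?A
      proof
        fix x assume x: "x \<in> E"
        with \<open>noncrossing_chords n E\<close> have "x \<in> chords n" by (auto simp: noncrossing_chords_def)
        then obtain c d where "x = {c, d}" "c < d" by (rule chordE)
        with B x ab show "\<not> crossing {a, b} x" using crossing_iff[of a b c d] by blast
      qed
    qed
    note * = this
    show ?thesis
    proof
      assume L: ?L
      then show ?R by (auto simp: * chord_iff)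
    next
      assume R: ?R
      show ?L
      proof (intro ballI impI)
        fix e assume "e \<in> chords n" and e: "\<forall>x \<in> E. \<not> crossing e x"
        then obtain a b where "e = {a, b}" "1 \<le> a" "a < b" "b \<le> n + 2" by (elim chordE)
        with R e *[of a b] show "e \<in> E" by blast
      qed
    qed
  qed
  ultimately show ?thesis using nc unfolding triangulation_def by argo
qed

lemma triangulation_edge:
  assumes "triangulation n E" "{a, b} \<in> E" "a < b"
  shows "1 \<le> a" "b \<le> n + 2"
  using assms chord_iff[of a b n] by (auto simp: triangulation_iff)

lemma triangulation_noncrossing:
  "triangulation n E \<Longrightarrow> {a, c} \<in> E \<Longrightarrow> {b, d} \<in> E \<Longrightarrow> a < b \<Longrightarrow> b < c \<Longrightarrow> c < d \<Longrightarrow> False"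
  unfolding triangulation_iff by blast

lemma triangulation_maximal:
  assumes "triangulation n E" "1 \<le> a" "a < b" "b \<le> n + 2"
    and "\<And>c d. {c, d} \<in> E \<Longrightarrow> a < c \<Longrightarrow> c < b \<Longrightarrow> b < d \<Longrightarrow> False"
    and "\<And>c d. {c, d} \<in> E \<Longrightarrow> c < a \<Longrightarrow> a < d \<Longrightarrow> d < b \<Longrightarrow> False"
  shows "{a, b} \<in> E"
proof -
  have "\<forall>a b. 1 \<le> a \<and> a < b \<and> b \<le> n + 2 \<longrightarrow>
      (\<forall>c d. {c, d} \<in> E \<longrightarrow> \<not> (a < c \<and> c < b \<and> b < d) \<and> \<not> (c < a \<and> a < d \<and> d < b)) \<longrightarrow>
      {a, b} \<in> E"
    using assms(1) unfolding triangulation_iff by (elim conjE)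
  from this[THEN spec, THEN spec, THEN mp, THEN mp] show ?thesis
    using assms(2-6) by blast
qed

lemma triangulation_base_edges:
  assumes "triangulation n E"
  shows "{1, n + 2} \<in> E" "{1, 2} \<in> E"
proof -
  show "{1, n + 2} \<in> E"
  proof (rule triangulation_maximal[OF assms])
    fix c d assume "{c, d} \<in> E" "1 < c" "c < n + 2" "n + 2 < d"
    then show False using triangulation_edge[OF assms, of c d] by simp
  next
    fix c d assume "{c, d} \<in> E" "c < 1" "1 < d" "d < n + 2"
    then show False using triangulation_edge[OF assms, of c d] by simp
  qed auto
  show "{1, 2} \<in> E"
  proof (rule triangulation_maximal[OF assms])
    fix c d assume "{c, d} \<in> E" "c < 1" "1 < d" "d < 2"
    then show False by simp
  qed auto
qed

section \<open>Closure of triangulations under lambda and oplus\<close>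

definition lam_edges :: "nat \<Rightarrow> nat set set \<Rightarrow> nat set set" where
  "lam_edges n E = (`) Suc ` E \<union> {{1, 2}, {1, n + 3}}"

definition oplus_edges :: "nat \<Rightarrow> nat set set \<Rightarrow> nat set set \<Rightarrow> nat set set" where
  "oplus_edges n1 E1 E2 = E1 \<union> (`) (\<lambda>j. if j = 1 then 1 else n1 + j) ` E2"

lemma tri_lam_eq: "tri_lam (n, E) = (n + 1, lam_edges n E)"
  by (simp add: tri_lam_def lam_edges_def)

lemma tri_oplus_eq: "tri_oplus (m, E) (n, F) = (m + n, oplus_edges m E F)"
  by (simp add: tri_oplus_def oplus_edges_def)

lemma lam_edges_iff:
  assumes "triangulation n E" "a < b"
  shows "{a, b} \<in> lam_edges n E \<longleftrightarrow> a = 1 \<and> (b = 2 \<or> b = n + 3) \<or> 2 \<le> a \<and> {a - 1, b - 1} \<in> E"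
    (is "?L \<longleftrightarrow> ?R")
proof
  assume ?L
  then consider x where "x \<in> E" "{a, b} = Suc ` x" | "{a, b} = {1, 2} \<or> {a, b} = {1, n + 3}"
    unfolding lam_edges_def by blast
  then show ?R
  proof cases
    case 1
    with assms(1) have "x \<in> chords n" by (auto simp: triangulation_iff)
    then obtain c d where "x = {c, d}" "1 \<le> c" "c < d" by (rule chordE)
    with 1 assms(2) show ?thesis by (auto simp: doubleton_eq_iff)
  qed (use assms(2) in \<open>auto simp: doubleton_eq_iff\<close>)
next
  assume R: ?R
  show ?L
  proof (cases "a = 1")
    case False
    with R have "2 \<le> a" "{a - 1, b - 1} \<in> E" by auto
    moreover have "Suc ` {a - 1, b - 1} = {a, b}" using \<open>2 \<le> a\<close> assms(2) by auto
    ultimately show ?thesis unfolding lam_edges_def by (metis UnI1 image_eqI)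
  qed (use R in \<open>auto simp: lam_edges_def\<close>)
qed

text \<open>The disjuncts are an edge of the first piece, an edge of the second at the common vertex
  1, and an edge of the second away from 1. The glued edge \<open>{1, m + 2}\<close> satisfies the
  first two, being \<open>{1, 2}\<close> in the second piece.\<close>

lemma oplus_edges_iff:
  assumes "triangulation m E" "triangulation n F" "a < b"
  shows "{a, b} \<in> oplus_edges m E F \<longleftrightarrow>
    {a, b} \<in> E \<or> a = 1 \<and> m + 2 \<le> b \<and> {1, b - m} \<in> F \<or> m + 2 \<le> a \<and> {a - m, b - m} \<in> F"
    (is "?L \<longleftrightarrow> ?R")
proof
  let ?f = "\<lambda>j. if j = 1 then 1 else m + j"
  assume ?L
  then consider "{a, b} \<in> E" | x where "x \<in> F" "{a, b} = ?f ` x"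
    unfolding oplus_edges_def by blast
  then show ?R
  proof cases
    case 2
    with assms(2) have "x \<in> chords n" by (auto simp: triangulation_iff)
    then obtain c d where "x = {c, d}" "1 \<le> c" "c < d" by (rule chordE)
    with 2 have "{a, b} = {if c = 1 then 1 else m + c, m + d}" by auto
    with assms(3) \<open>c < d\<close> have "a = (if c = 1 then 1 else m + c)" "b = m + d"
      by (auto simp: doubleton_eq_iff split: if_splits)
    with 2 \<open>x = {c, d}\<close> \<open>1 \<le> c\<close> \<open>c < d\<close> show ?thesis by auto
  qed simp
next
  let ?f = "\<lambda>j. if j = 1 then 1 else m + j"
  assume R: ?R
  have "?f ` {1, b - m} = {1, b}" if "m + 2 \<le> b" using that by auto
  moreover have "?f ` {a - m, b - m} = {a, b}" if "m + 2 \<le> a" using that assms(3) by auto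
  ultimately show ?L using R unfolding oplus_edges_def by (metis (no_types, lifting) UnI1 UnI2 image_eqI)
qed

text \<open>The shifted base edge \<open>{2, n + 3}\<close> crosses every \<open>{1, b}\<close> with
  2 < b < n + 3, so vertex 1 can carry only its two edges. Chords that avoid 1 are tested in the old
  polygon.\<close>

lemma triangulation_lam_edges:
  assumes T: "triangulation n E"
  shows "triangulation (n + 1) (lam_edges n E)"
  unfolding triangulation_iff[of "n + 1"]
proof (intro conjI allI impI)
  show "lam_edges n E \<subseteq> chords (n + 1)"
  proof
    fix x assume "x \<in> lam_edges n E"
    then consider y where "y \<in> E" "x = Suc ` y" | "x = {1, 2} \<or> x = {1, n + 3}"
      unfolding lam_edges_def by blast
    then show "x \<in> chords (n + 1)"
    proof cases
      case 1
      with T have "y \<in> chords n" by (auto simp: triangulation_iff)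
      then obtain c d where "y = {c, d}" "1 \<le> c" "c < d" "d \<le> n + 2" by (rule chordE)
      with 1 show ?thesis by (auto simp: chord_iff)
    qed (auto simp: chord_iff)
  qed
next
  fix a b c d :: nat
  assume o: "a < b \<and> b < c \<and> c < d" and ac: "{a, c} \<in> lam_edges n E"
  show "{b, d} \<notin> lam_edges n E"
  proof
    assume bd: "{b, d} \<in> lam_edges n E"
    have "a = 1 \<and> c = n + 3 \<or> 2 \<le> a \<and> {a - 1, c - 1} \<in> E"
      using ac o lam_edges_iff[OF T, of a c] by auto
    moreover have "2 \<le> b \<and> {b - 1, d - 1} \<in> E"
      using bd ac o lam_edges_iff[OF T, of b d] lam_edges_iff[OF T, of a c] by auto
    moreover have "b - 1 < d - 1" "c - 1 < d - 1" "b - 1 < c - 1" using o by linarith+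
    moreover have "a - 1 < b - 1" if "2 \<le> a" using that o by linarith
    ultimately show False
      using triangulation_noncrossing[OF T, of "a - 1" "c - 1" "b - 1" "d - 1"]
        triangulation_edge(2)[OF T, of "b - 1" "d - 1"]
      by auto
  qed
next
  fix a b assume ab: "1 \<le> a \<and> a < b \<and> b \<le> n + 1 + 2"
  assume nc: "\<forall>c d. {c, d} \<in> lam_edges n E \<longrightarrow>
      \<not> (a < c \<and> c < b \<and> b < d) \<and> \<not> (c < a \<and> a < d \<and> d < b)"
  show "{a, b} \<in> lam_edges n E"
  proof (cases "a = 1")
    case True
    have "{2, n + 3} \<in> lam_edges n E"
      using triangulation_base_edges(1)[OF T] lam_edges_iff[OF T, of 2 "n + 3"] by simp
    with nc True have "\<not> (2 < b \<and> b < n + 3)" by auto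
    with ab True show ?thesis using lam_edges_iff[OF T, of a b] by auto
  next
    case False
    have "{a - 1, b - 1} \<in> E"
    proof (rule triangulation_maximal[OF T])
      fix c d assume cd: "{c, d} \<in> E" "a - 1 < c" "c < b - 1" "b - 1 < d"
      then have "{c + 1, d + 1} \<in> lam_edges n E"
        using lam_edges_iff[OF T, of "c + 1" "d + 1"] by auto
      with nc have "\<not> (a < c + 1 \<and> c + 1 < b \<and> b < d + 1)" by blast
      with cd show False by auto
    next
      fix c d assume cd: "{c, d} \<in> E" "c < a - 1" "a - 1 < d" "d < b - 1"
      then have "1 \<le> c" using triangulation_edge[OF T, of c d] by auto
      with cd have "{c + 1, d + 1} \<in> lam_edges n E"
        using lam_edges_iff[OF T, of "c + 1" "d + 1"] by auto
      with nc have "\<not> (c + 1 < a \<and> a < d + 1 \<and> d + 1 < b)" by blast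
      with cd show False by auto
    qed (use ab False in auto)
    with ab False show ?thesis using lam_edges_iff[OF T, of a b] by auto
  qed
qed

text \<open>A chord that does not cross the glued edge \<open>{1, m + 2}\<close> lies on one side of
  it, and there the maximality of the respective piece applies.\<close>

lemma triangulation_oplus_edges:
  assumes T: "triangulation m E" and U: "triangulation n F"
  shows "triangulation (m + n) (oplus_edges m E F)"
  unfolding triangulation_iff[of "m + n"]
proof (intro conjI allI impI)
  show "oplus_edges m E F \<subseteq> chords (m + n)"
  proof
    fix x assume "x \<in> oplus_edges m E F"
    then consider "x \<in> E" | y where "y \<in> F" "x = (\<lambda>j. if j = 1 then 1 else m + j) ` y"
      unfolding oplus_edges_def by blast
    then show "x \<in> chords (m + n)"
    proof cases
      case 1
      with T have "x \<in> chords m" by (auto simp: triangulation_iff)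
      then obtain c d where "x = {c, d}" "1 \<le> c" "c < d" "d \<le> m + 2" by (rule chordE)
      then show ?thesis by (auto simp: chord_iff)
    next
      case 2
      with U have "y \<in> chords n" by (auto simp: triangulation_iff)
      then obtain c d where y: "y = {c, d}" "1 \<le> c" "c < d" "d \<le> n + 2" by (rule chordE)
      with 2 have "x = {if c = 1 then 1 else m + c, m + d}" by auto
      with y show ?thesis by (simp add: chord_iff)
    qed
  qed
next
  fix a b c d :: nat
  assume o: "a < b \<and> b < c \<and> c < d" and ac: "{a, c} \<in> oplus_edges m E F"
  show "{b, d} \<notin> oplus_edges m E F"
  proof
    assume bd: "{b, d} \<in> oplus_edges m E F"
    consider "{a, c} \<in> E" "1 \<le> a" "c \<le> m + 2" | "a = 1" "m + 2 \<le> c" "{1, c - m} \<in> F"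
      | "m + 2 \<le> a" "{a - m, c - m} \<in> F"
      using ac o oplus_edges_iff[OF T U, of a c] triangulation_edge[OF T, of a c] by auto
    note A = this
    consider "{b, d} \<in> E" "1 \<le> b" "d \<le> m + 2" | "b = 1" | "m + 2 \<le> b" "{b - m, d - m} \<in> F"
      using bd o oplus_edges_iff[OF T U, of b d] triangulation_edge[OF T, of b d] by auto
    then show False
    proof cases
      case 1
      with A o triangulation_noncrossing[OF T, of a c b d] show ?thesis by cases auto
    next
      case 2
      with A o show ?thesis by cases auto
    next
      case 3
      then have "b - m < c - m" "c - m < d - m" using o by linarith+
      moreover have "a - m < b - m" if "m + 2 \<le> a" using that o by linarith
      moreover have "1 < b - m" using 3 by linarith
      ultimately show ?thesis
        using A 3 triangulation_noncrossing[OF U, of "a - m" "c - m" "b - m" "d - m"]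
          triangulation_noncrossing[OF U, of 1 "c - m" "b - m" "d - m"]
        by cases auto
    qed
  qed
next
  fix a b assume ab: "1 \<le> a \<and> a < b \<and> b \<le> m + n + 2"
  assume nc: "\<forall>c d. {c, d} \<in> oplus_edges m E F \<longrightarrow>
      \<not> (a < c \<and> c < b \<and> b < d) \<and> \<not> (c < a \<and> a < d \<and> d < b)"
  have E: "{c, d} \<in> oplus_edges m E F" if "{c, d} \<in> E" for c d
    using that unfolding oplus_edges_def by blast
  have "{1, m + 2} \<in> oplus_edges m E F"
    using E triangulation_base_edges(1)[OF T] by blast
  with nc ab have "\<not> (1 < a \<and> a < m + 2 \<and> m + 2 < b)" by blast
  then consider "b \<le> m + 2" | "a = 1" "m + 2 \<le> b" | "m + 2 \<le> a" using ab by linarith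
  then show "{a, b} \<in> oplus_edges m E F"
  proof cases
    case 1
    then show ?thesis using nc ab E by (intro E triangulation_maximal[OF T]) blast+
  next
    case 2
    have "{1, b - m} \<in> F"
    proof (rule triangulation_maximal[OF U])
      fix c d assume cd: "{c, d} \<in> F" "1 < c" "c < b - m" "b - m < d"
      then have "{m + c, m + d} \<in> oplus_edges m E F"
        using oplus_edges_iff[OF T U, of "m + c" "m + d"] by auto
      with nc have "\<not> (a < m + c \<and> m + c < b \<and> b < m + d)" by blast
      with cd 2 show False by auto
    next
      fix c d assume "{c, d} \<in> F" "c < 1" "1 < d"
      then show False using triangulation_edge[OF U, of c d] by auto
    qed (use ab 2 in auto)
    with ab 2 show ?thesis using oplus_edges_iff[OF T U, of a b] by auto
  next
    case 3
    have "{a - m, b - m} \<in> F"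
    proof (rule triangulation_maximal[OF U])
      fix c d assume cd: "{c, d} \<in> F" "a - m < c" "c < b - m" "b - m < d"
      then have "{m + c, m + d} \<in> oplus_edges m E F"
        using 3 oplus_edges_iff[OF T U, of "m + c" "m + d"] by auto
      with nc have "\<not> (a < m + c \<and> m + c < b \<and> b < m + d)" by blast
      with cd show False by auto
    next
      fix c d assume cd: "{c, d} \<in> F" "c < a - m" "a - m < d" "d < b - m"
      then have "1 \<le> c" using triangulation_edge[OF U, of c d] by auto
      show False
      \<comment> \<open>Vertex 1 of the second piece stays 1 instead of moving by \<open>m\<close>,
        so a blocking edge at it is transported differently.\<close>
      proof (cases "c = 1")
        case True
        with cd 3 have "{1, m + d} \<in> oplus_edges m E F"
          using oplus_edges_iff[OF T U, of 1 "m + d"] by auto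
        with nc have "\<not> (1 < a \<and> a < m + d \<and> m + d < b)" by blast
        with cd 3 show False by auto
      next
        case False
        with cd \<open>1 \<le> c\<close> have "{m + c, m + d} \<in> oplus_edges m E F"
          using oplus_edges_iff[OF T U, of "m + c" "m + d"] by auto
        with nc have "\<not> (m + c < a \<and> a < m + d \<and> m + d < b)" by blast
        with cd show False by auto
      qed
    qed (use ab 3 in auto)
    with ab 3 show ?thesis using oplus_edges_iff[OF T U, of a b] by auto
  qed
qed

section \<open>Statistics of triangulations\<close>

lemma tri_comp_eq:
  assumes "triangulation n E"
  shows "tri_comp (n, E) = card {b. 1 < b \<and> {1, b} \<in> E} - 1"
proof -
  have "{x \<in> E. 1 \<in> x} = (\<lambda>b. {1, b}) ` {b. 1 < b \<and> {1, b} \<in> E}" (is "?L = ?R")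
  proof (intro equalityI subsetI)
    fix x assume x: "x \<in> ?L"
    with assms have "x \<in> chords n" by (auto simp: triangulation_iff)
    then obtain c d where "x = {c, d}" "1 \<le> c" "c < d" by (rule chordE)
    with x show "x \<in> ?R" by auto
  qed auto
  then show ?thesis
    by (simp add: tri_comp_def, subst card_image) (auto simp: inj_on_def doubleton_eq_iff)
qed

lemma tri_rcomp_eq:
  assumes "triangulation n E"
  shows "tri_rcomp (n, E) = card {a. a < n + 2 \<and> {a, n + 2} \<in> E} - 1"
proof -
  have "{x \<in> E. n + 2 \<in> x} = (\<lambda>a. {a, n + 2}) ` {a. a < n + 2 \<and> {a, n + 2} \<in> E}" (is "?L = ?R")
  proof (intro equalityI subsetI)
    fix x assume x: "x \<in> ?L"
    with assms have "x \<in> chords n" by (auto simp: triangulation_iff)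
    then obtain c d where "x = {c, d}" "1 \<le> c" "c < d" "d \<le> n + 2" by (rule chordE)
    with x show "x \<in> ?R" by auto
  qed auto
  then show ?thesis
    by (simp add: tri_rcomp_def, subst card_image) (auto simp: inj_on_def doubleton_eq_iff)
qed

lemma tri_comp_lam: "triangulation n E \<Longrightarrow> tri_comp (n + 1, lam_edges n E) = 1"
proof -
  assume T: "triangulation n E"
  have "{b. 1 < b \<and> {1, b} \<in> lam_edges n E} = {2, n + 3}"
    using lam_edges_iff[OF T, of 1] by auto
  then show ?thesis using tri_comp_eq[OF triangulation_lam_edges[OF T]] by simp
qed

text \<open>The neighbours of 1 in the two pieces overlap in \<open>m + 2\<close> alone. This loss
  of one balances the \<open>- 1\<close> in \<open>tri_comp\<close>, provided neither subtraction is
  truncated.\<close>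

lemma tri_comp_oplus:
  assumes T: "triangulation m E" and U: "triangulation n F"
  shows "tri_comp (m + n, oplus_edges m E F) = tri_comp (m, E) + tri_comp (n, F)"
proof -
  define A where "A = {b. 1 < b \<and> {1, b} \<in> E}"
  define B where "B = {b. 1 < b \<and> {1, b} \<in> F}"
  have A: "A \<subseteq> {2..m + 2}" "m + 2 \<in> A"
    using triangulation_edge[OF T, of 1] triangulation_base_edges[OF T] by (force simp: A_def)+
  have B: "B \<subseteq> {2..n + 2}" "2 \<in> B"
    using triangulation_edge[OF U, of 1] triangulation_base_edges[OF U] by (force simp: B_def)+
  have eq: "{b. 1 < b \<and> {1, b} \<in> oplus_edges m E F} = A \<union> (+) m ` B" (is "?L = ?R")
  proof (intro equalityI subsetI)
    fix b assume "b \<in> ?L"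
    then show "b \<in> ?R"
      using oplus_edges_iff[OF T U, of 1 b]
      by (auto simp: A_def B_def intro!: image_eqI[where x = "b - m"])
  next
    fix b assume "b \<in> ?R"
    then show "b \<in> ?L"
      using oplus_edges_iff[OF T U, of 1 b] B(1) by (auto simp: A_def B_def)
  qed
  have "A \<inter> (+) m ` B = {m + 2}" using A B by force
  moreover have fin: "finite A" "finite B" using A(1) B(1) by (auto intro: finite_subset)
  ultimately have "card (A \<union> (+) m ` B) + 1 = card A + card B"
    using card_Un_Int[of A "(+) m ` B"] by (simp add: card_image)
  moreover have "card A > 0" "card B > 0" using A B fin by (auto simp: card_gt_0_iff)
  ultimately show ?thesis
    unfolding tri_comp_eq[OF T] tri_comp_eq[OF U]
      tri_comp_eq[OF triangulation_oplus_edges[OF T U]] eq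
      A_def[symmetric] B_def[symmetric]
    by linarith
qed

text \<open>The last vertex keeps its old neighbours, shifted, and gains the new vertex 1.\<close>

lemma tri_rcomp_lam:
  assumes T: "triangulation n E"
  shows "tri_rcomp (n + 1, lam_edges n E) = Suc (tri_rcomp (n, E))"
proof -
  let ?A = "{a. a < n + 2 \<and> {a, n + 2} \<in> E}"
  have eq: "{a. a < n + 1 + 2 \<and> {a, n + 1 + 2} \<in> lam_edges n E} = insert 1 (Suc ` ?A)" (is "?L = ?R")
  proof (intro equalityI subsetI)
    fix a assume "a \<in> ?L"
    then show "a \<in> ?R"
      using lam_edges_iff[OF T, of a "n + 3"]
      by (auto intro!: image_eqI[where x = "a - 1"] simp: numeral_3_eq_3)
  next
    fix a assume "a \<in> ?R"
    then show "a \<in> ?L"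
      using lam_edges_iff[OF T, of a "n + 3"] triangulation_edge(1)[OF T, of "a - 1" "n + 2"]
      by (auto simp: numeral_3_eq_3)
  qed
  have "1 \<notin> Suc ` ?A" using triangulation_edge(1)[OF T, of 0 "n + 2"] by auto
  moreover have "1 \<in> ?A" using triangulation_base_edges[OF T] by simp
  then have "card ?A > 0" by (auto simp: card_gt_0_iff)
  ultimately show ?thesis
    unfolding tri_rcomp_eq[OF T] tri_rcomp_eq[OF triangulation_lam_edges[OF T]] eq
    by (simp add: card_image)
qed

text \<open>For n >= 1 the last vertex lies beyond \<open>m + 2\<close>, so all its edges come from
  \<open>F\<close>. The relabelling is injective on its neighbours because these are
  positive.\<close>

lemma tri_rcomp_oplus:
  assumes T: "triangulation m E" and U: "triangulation n F" and n: "1 \<le> n"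
  shows "tri_rcomp (m + n, oplus_edges m E F) = tri_rcomp (n, F)"
proof -
  let ?A = "{a. a < n + 2 \<and> {a, n + 2} \<in> F}"
  let ?f = "\<lambda>j. if j = 1 then 1 else m + j"
  have "{a. a < m + n + 2 \<and> {a, m + n + 2} \<in> oplus_edges m E F} = ?f ` ?A"
    (is "?L = ?R")
  proof (intro equalityI subsetI)
    fix a assume a: "a \<in> ?L"
    then have "{a, m + n + 2} \<notin> E" using triangulation_edge(2)[OF T, of a "m + n + 2"] n by auto
    with a have "a = 1 \<and> {1, n + 2} \<in> F \<or> m + 2 \<le> a \<and> {a - m, n + 2} \<in> F"
      using oplus_edges_iff[OF T U, of a "m + n + 2"] by auto
    then show "a \<in> ?R"
    proof (elim disjE conjE)
      assume "a = 1" "{1, n + 2} \<in> F"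
      then show "a \<in> ?R" by (intro image_eqI[where x = 1]) auto
    next
      assume "m + 2 \<le> a" "{a - m, n + 2} \<in> F"
      with a show "a \<in> ?R" by (intro image_eqI[where x = "a - m"]) auto
    qed
  next
    fix a assume "a \<in> ?R"
    then obtain c where c: "a = ?f c" "c < n + 2" "{c, n + 2} \<in> F" by blast
    then have "1 \<le> c" using triangulation_edge(1)[OF U, of c "n + 2"] by auto
    with c show "a \<in> ?L"
      using oplus_edges_iff[OF T U, of a "m + n + 2"] by (auto split: if_splits)
  qed
  moreover have "inj_on ?f ?A"
    using triangulation_edge(1)[OF U, of _ "n + 2"] by (force simp: inj_on_def)
  ultimately show ?thesis
    unfolding tri_rcomp_eq[OF U] tri_rcomp_eq[OF triangulation_oplus_edges[OF T U]]
    by (simp only: card_image)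
qed

text \<open>With the index moved down to \<open>{1..n}\<close>, \<open>card_interval_add\<close>
  applies to lambda (split after 1) and to oplus (split after m).\<close>

lemma tr_eq: "tr (n, E) = card {i \<in> {1..n}. \<exists>j \<le> i. {j, i + 1} \<in> E \<and> {j, i + 2} \<in> E}"
proof -
  have "{i \<in> {2..n + 1}. \<exists>j < i. {j, i} \<in> E \<and> {j, i + 1} \<in> E} =
      Suc ` {i \<in> {1..n}. \<exists>j \<le> i. {j, i + 1} \<in> E \<and> {j, i + 2} \<in> E}" (is "?L = ?R")
  proof (intro equalityI subsetI)
    fix i assume "i \<in> ?L"
    then show "i \<in> ?R" by (cases i) (auto simp: less_Suc_eq_le)
  qed (auto simp: less_Suc_eq_le)
  then show ?thesis by (simp add: tr_def card_image)
qed

text \<open>The new first index contributes nothing: its witness would have to be vertex 1, which is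
  adjacent only to 2 and to the last vertex, and in size at least 2 the last vertex is not 3. For
  the same reason 1 is no witness later on. Over the single edge, 1 is adjacent to 2 and 3, and that
  triangle has \<open>tr\<close> equal to 1.\<close>

lemma tr_lam:
  assumes T: "triangulation (Suc n) E"
  shows "tr (Suc n + 1, lam_edges (Suc n) E) = tr (Suc n, E)"
proof -
  have *: "(\<exists>j \<le> 1 + i. {j, 1 + i + 1} \<in> lam_edges (Suc n) E \<and> {j, 1 + i + 2} \<in> lam_edges (Suc n) E)
      \<longleftrightarrow> (\<exists>j \<le> i. {j, i + 1} \<in> E \<and> {j, i + 2} \<in> E)" (is "?L \<longleftrightarrow> ?R") if "1 \<le> i" for i
  proof
    assume ?L
    then obtain j where "j \<le> 1 + i" "{j, i + 2} \<in> lam_edges (Suc n) E" "{j, i + 3} \<in> lam_edges (Suc n) E"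
      by (auto simp: numeral_2_eq_2 numeral_3_eq_3)
    with that show ?R
      using lam_edges_iff[OF T, of j "i + 2"] lam_edges_iff[OF T, of j "i + 3"]
      by (intro exI[of _ "j - 1"]) (auto simp: numeral_2_eq_2 numeral_3_eq_3)
  next
    assume ?R
    then obtain j where j: "j \<le> i" "{j, i + 1} \<in> E" "{j, i + 2} \<in> E" by blast
    then have "1 \<le> j" using triangulation_edge(1)[OF T, of j "i + 1"] by auto
    with j show ?L
      using lam_edges_iff[OF T, of "j + 1" "i + 2"] lam_edges_iff[OF T, of "j + 1" "i + 3"]
      by (intro exI[of _ "j + 1"]) (auto simp: numeral_2_eq_2 numeral_3_eq_3)
  qed
  have first: "\<not> (\<exists>j \<le> 1. {j, 1 + 1} \<in> lam_edges (Suc n) E \<and> {j, 1 + 2} \<in> lam_edges (Suc n) E)"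
  proof
    assume "\<exists>j \<le> 1. {j, 1 + 1} \<in> lam_edges (Suc n) E \<and> {j, 1 + 2} \<in> lam_edges (Suc n) E"
    then obtain j where "j \<le> 1" "{j, 3} \<in> lam_edges (Suc n) E" by (auto simp: numeral_3_eq_3)
    then show False using lam_edges_iff[OF T, of j 3] by auto
  qed
  have "{k \<in> {1..1}. \<exists>j \<le> k. {j, k + 1} \<in> lam_edges (Suc n) E \<and> {j, k + 2} \<in> lam_edges (Suc n) E} = {}"
    using first by force
  moreover have "{k \<in> {1..Suc n}. \<exists>j \<le> 1 + k. {j, 1 + k + 1} \<in> lam_edges (Suc n) E \<and> {j, 1 + k + 2} \<in> lam_edges (Suc n) E}
     = {k \<in> {1..Suc n}. \<exists>j \<le> k. {j, k + 1} \<in> E \<and> {j, k + 2} \<in> E}"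
    using * by (intro Collect_cong conj_cong refl) auto
  ultimately show ?thesis
    unfolding tr_eq add.commute[of "Suc n"] card_interval_add by simp
qed

lemma tr_oplus:
  assumes T: "triangulation m E" and U: "triangulation n F"
  shows "tr (m + n, oplus_edges m E F) = tr (m, E) + tr (n, F)"
proof -
  let ?G = "oplus_edges m E F"
  note iff = oplus_edges_iff[OF T U]
  have "(\<exists>j \<le> i. {j, i + 1} \<in> ?G \<and> {j, i + 2} \<in> ?G) \<longleftrightarrow> (\<exists>j \<le> i. {j, i + 1} \<in> E \<and> {j, i + 2} \<in> E)"
    if "1 \<le> i" "i \<le> m" for i
  proof -
    have "{j, i + 1} \<in> ?G \<and> {j, i + 2} \<in> ?G \<longleftrightarrow> {j, i + 1} \<in> E \<and> {j, i + 2} \<in> E" if j: "j \<le> i" for j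
    proof -
      have "{j, i + 1} \<in> ?G \<longleftrightarrow> {j, i + 1} \<in> E"
        using iff[of j "i + 1"] j \<open>i \<le> m\<close> by auto
      \<comment> \<open>Only i = m needs care: there the second piece contributes
        \<open>{1, m + 2}\<close>, which is the base edge of the first piece anyway.\<close>
      moreover have "{j, i + 2} \<in> ?G \<longleftrightarrow> {j, i + 2} \<in> E"
        using iff[of j "i + 2"] j \<open>i \<le> m\<close> triangulation_base_edges[OF T] by (cases "i = m") auto
      ultimately show ?thesis by blast
    qed
    then show ?thesis by blast
  qed
  moreover have "(\<exists>j \<le> m + i. {j, m + i + 1} \<in> ?G \<and> {j, m + i + 2} \<in> ?G) \<longleftrightarrow>
      (\<exists>j \<le> i. {j, i + 1} \<in> F \<and> {j, i + 2} \<in> F)" (is "?L \<longleftrightarrow> ?R") if i: "1 \<le> i" "i \<le> n" for i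
  proof
    assume ?L
    then obtain j where j: "j \<le> m + i" "{j, m + i + 1} \<in> ?G" "{j, m + i + 2} \<in> ?G" by blast
    have "{j, m + i + 2} \<notin> E" using triangulation_edge(2)[OF T, of j "m + i + 2"] j i by auto
    then consider "j = 1" "{1, i + 2} \<in> F" | "m + 2 \<le> j" "{j - m, i + 2} \<in> F"
      using iff[of j "m + i + 2"] j by auto
    then show ?R
    proof cases
      case 1
      have "{1, i + 1} \<in> F"
      \<comment> \<open>For i = 1 the vertex \<open>m + i + 1\<close> is the shared one, so the edge
        may come from \<open>E\<close>; but \<open>{1, 2}\<close> lies in every
        triangulation.\<close>
      proof (cases "i = 1")
        case True
        then show ?thesis using triangulation_base_edges(2)[OF U] by (simp add: numeral_2_eq_2)
      next
        case False
        then have "{j, m + i + 1} \<notin> E" using triangulation_edge(2)[OF T, of j "m + i + 1"] j i by auto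
        then show ?thesis using iff[of j "m + i + 1"] j i 1 by auto
      qed
      with 1 i show ?thesis by blast
    next
      case 2
      then have "{j, m + i + 1} \<notin> E" using triangulation_edge(2)[OF T, of j "m + i + 1"] j by auto
      then have "{j - m, i + 1} \<in> F" using iff[of j "m + i + 1"] j 2 by auto
      with 2 j show ?thesis by (intro exI[of _ "j - m"]) auto
    qed
  next
    assume ?R
    then obtain j where j: "j \<le> i" "{j, i + 1} \<in> F" "{j, i + 2} \<in> F" by blast
    then have "1 \<le> j" using triangulation_edge(1)[OF U, of j "i + 1"] by auto
    with j i show ?L
      using iff[of "if j = 1 then 1 else m + j" "m + i + 1"] iff[of "if j = 1 then 1 else m + j" "m + i + 2"]
      by (intro exI[of _ "if j = 1 then 1 else m + j"]) (auto split: if_splits)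
  qed
  ultimately have
    "{i \<in> {1..m}. \<exists>j \<le> i. {j, i + 1} \<in> ?G \<and> {j, i + 2} \<in> ?G} = {i \<in> {1..m}. \<exists>j \<le> i. {j, i + 1} \<in> E \<and> {j, i + 2} \<in> E}"
    "{i \<in> {1..n}. \<exists>j \<le> m + i. {j, m + i + 1} \<in> ?G \<and> {j, m + i + 2} \<in> ?G} =
      {i \<in> {1..n}. \<exists>j \<le> i. {j, i + 1} \<in> F \<and> {j, i + 2} \<in> F}"
    by (intro Collect_cong conj_cong refl, simp)+
  then show ?thesis unfolding tr_eq card_interval_add by simp
qed

lemma triangulation_0: "triangulation 0 E \<longleftrightarrow> E = {{1, 2}}"
proof
  assume T: "triangulation 0 E"
  have "E \<subseteq> {{1, 2}}"
  proof
    fix x assume "x \<in> E"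
    with T have "x \<in> chords 0" by (auto simp: triangulation_iff)
    then obtain a b where "x = {a, b}" "1 \<le> a" "a < b" "b \<le> 0 + 2" by (rule chordE)
    moreover from this have "a = 1" "b = 2" by auto
    ultimately show "x \<in> {{1, 2}}" by simp
  qed
  with triangulation_base_edges(2)[OF T] show "E = {{1, 2}}" by blast
next
  have "a = 1 \<and> b = 2" if "1 \<le> a" "a < b" "b \<le> 0 + 2" for a b :: nat using that by auto
  then show "E = {{1, 2}} \<Longrightarrow> triangulation 0 E"
    unfolding triangulation_iff by (auto simp: chord_iff doubleton_eq_iff)
qed

text \<open>The relabellings compose correctly on labels from 1 on: with m = 1, the label 0 would
  become 1 and then be mistaken for the common vertex. Hence the appeal to
  \<open>chordE\<close>.\<close>

lemma oplus_edges_assoc: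
  assumes "triangulation l E" "triangulation m F" "triangulation n G"
  shows "oplus_edges (l + m) (oplus_edges l E F) G = oplus_edges l E (oplus_edges m F G)"
proof -
  have "(\<lambda>j. if j = 1 then 1 else l + m + j) ` x =
      (\<lambda>j. if j = 1 then 1 else l + j) ` (\<lambda>j. if j = 1 then 1 else m + j) ` x" if "x \<in> G" for x
  proof -
    from that assms(3) have "x \<in> chords n" by (auto simp: triangulation_iff)
    then obtain c d where "x = {c, d}" "1 \<le> c" "c < d" by (rule chordE)
    then show ?thesis by auto
  qed
  then show ?thesis
    unfolding oplus_edges_def image_Un image_image Un_assoc by (simp cong: image_cong)
qed

interpretation triangulations: catalan_algebra triangulations
proof unfold_locales
  show "neutral triangulations \<in> graded triangulations 0"
    by (simp add: triangulations_def triangulation_0)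
next
  fix x n assume "x \<in> graded triangulations n"
  then show "lam triangulations x \<in> graded triangulations (Suc n)"
    using triangulation_lam_edges by (fastforce simp: triangulations_def tri_lam_eq)
next
  fix x y m n assume "x \<in> graded triangulations m" "y \<in> graded triangulations n"
  then show "oplus triangulations x y \<in> graded triangulations (m + n)"
    using triangulation_oplus_edges by (fastforce simp: triangulations_def tri_oplus_eq)
next
  fix x y z l m n
  assume "x \<in> graded triangulations l" "y \<in> graded triangulations m" "z \<in> graded triangulations n"
  then show "oplus triangulations (oplus triangulations x y) z =
      oplus triangulations x (oplus triangulations y z)"
    using oplus_edges_assoc by (fastforce simp: triangulations_def tri_oplus_eq)
next
  fix x n assume "x \<in> graded triangulations n"
  then obtain E where x: "x = (n, E)" and T: "triangulation n E" by (auto simp: triangulations_def)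
  have "(`) (\<lambda>j. if j = 1 then 1 else 0 + j) ` E = E" by (simp cong: if_cong)
  with triangulation_base_edges(2)[OF T]
  show "oplus triangulations (neutral triangulations) x = x"
    by (auto simp: triangulations_def tri_oplus_eq x oplus_edges_def)
  from triangulation_base_edges(1)[OF T]
  show "oplus triangulations x (neutral triangulations) = x"
    by (auto simp: triangulations_def tri_oplus_eq x oplus_edges_def insert_commute)
qed

lemma canonical_stats_triangulations:
  "canonical_stats_equal (canonical_bijection plane_trees triangulations)
     tri_comp tri_rcomp tr nontr"
proof -
  have ops: "neutral triangulations = (0, {{1, 2}})" "lam triangulations = tri_lam"
    "oplus triangulations = tri_oplus"
    "graded triangulations n = {(n, E) | E. triangulation n E}" for n
    by (simp_all add: triangulations_def)
  show ?thesis
  proof (rule triangulations.canonical_stats_equalI, goal_cases)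
    case 1
    have "{x \<in> {{1, 2}}. 1 \<in> x} = {{1, 2::nat}}" by auto
    then show ?case by (simp add: ops tri_comp_def)
  next
    case (2 x n)
    then show ?case using tri_comp_lam by (auto simp: ops tri_lam_eq)
  next
    case (3 x y m n)
    then obtain E F where "x = (Suc m, E)" "y = (Suc n, F)" "triangulation (Suc m) E" "triangulation (Suc n) F"
      by (auto simp: ops)
    then show ?case by (simp only: ops tri_oplus_eq tri_comp_oplus)
  next
    case 4
    have "{x \<in> {{1, 2}}. 0 + 2 \<in> x} = {{1, 2::nat}}" by auto
    then have "card {x \<in> {{1, 2::nat}}. 0 + 2 \<in> x} = card {{1, 2::nat}}" by (rule arg_cong)
    then show ?case by (simp only: ops tri_rcomp_def prod.case) simp
  next
    case (5 x n)
    then show ?case using tri_rcomp_lam by (auto simp: ops tri_lam_eq)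
  next
    case (6 x y m n)
    then obtain E F where "x = (Suc m, E)" "y = (Suc n, F)" "triangulation (Suc m) E" "triangulation (Suc n) F"
      by (auto simp: ops)
    then show ?case by (simp add: ops tri_oplus_eq tri_rcomp_oplus del: add_Suc add_Suc_right)
  next
    case 7
    have "tr (1, lam_edges 0 {{1, 2}}) = card {i::nat. i = 1}"
      unfolding tr_eq lam_edges_def
      by (intro arg_cong[where f = card]) (auto intro!: exI[of _ 1] simp: numeral_2_eq_2 numeral_3_eq_3)
    then show ?case by (simp add: ops tri_lam_eq)
  next
    case (8 x n)
    then obtain E where "x = (Suc n, E)" "triangulation (Suc n) E" by (auto simp: ops)
    then show ?case by (simp only: ops tri_lam_eq tr_lam)
  next
    case (9 x y m n)
    then obtain E F where "x = (Suc m, E)" "y = (Suc n, F)" "triangulation (Suc m) E" "triangulation (Suc n) F"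
      by (auto simp: ops)
    then show ?case by (simp only: ops tri_oplus_eq tr_oplus)
  next
    case (10 x n)
    then obtain E where x: "x = (Suc n, E)" by (auto simp: ops)
    have "tr (Suc n, E) \<le> card {1..Suc n}" unfolding tr_eq by (rule card_mono) auto
    then show ?case by (simp add: x nontr_def)
  qed
qed

section \<open>Direct sums and 231-avoiding permutations\<close>

lemma length_direct_sum [simp]: "length (direct_sum p q) = length p + length q"
  by (simp add: direct_sum_def)

lemma nth_direct_sum:
  "i < length p + length q \<Longrightarrow>
    direct_sum p q ! i = (if i < length p then p ! i else q ! (i - length p) + length p)"
  by (simp add: direct_sum_def nth_append)

lemma direct_sum_Nil [simp]: "direct_sum [] p = p" "direct_sum p [] = p"
  by (simp_all add: direct_sum_def)

lemma direct_sum_eq_Nil_iff [simp]: "direct_sum p q = [] \<longleftrightarrow> p = [] \<and> q = []"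
  by (simp add: direct_sum_def)

lemma direct_sum_assoc: "direct_sum (direct_sum p q) r = direct_sum p (direct_sum q r)"
  by (simp add: direct_sum_def add_ac)

lemma direct_sum_cancel_left: "direct_sum p q = direct_sum p r \<Longrightarrow> q = r"
  unfolding direct_sum_def by (auto intro: map_injective simp: inj_def)

lemma is_perm_Nil [simp]: "is_perm []"
  by (simp add: is_perm_def)

lemma is_perm_nth: "is_perm p \<Longrightarrow> i < length p \<Longrightarrow> 1 \<le> p ! i \<and> p ! i \<le> length p"
  using nth_mem[of i p] by (auto simp: is_perm_def)

lemma is_perm_nth_eq_iff:
  "is_perm p \<Longrightarrow> i < length p \<Longrightarrow> j < length p \<Longrightarrow> p ! i = p ! j \<longleftrightarrow> i = j"
  by (simp add: is_perm_def nth_eq_iff_index_eq)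

lemma is_permI: "distinct p \<Longrightarrow> set p \<subseteq> {1..length p} \<Longrightarrow> is_perm p"
  unfolding is_perm_def by (auto simp: card_subset_eq distinct_card)

lemma is_perm_direct_sum:
  assumes "is_perm p" "is_perm q"
  shows "is_perm (direct_sum p q)"
  using assms by (intro is_permI) (auto simp: direct_sum_def is_perm_def distinct_map)

text \<open>The values of \<open>p\<close> use up \<open>1..length p\<close>, so distinctness keeps
  the shifted values of \<open>q\<close> above \<open>length p\<close>.\<close>

lemma is_perm_direct_sum_right:
  assumes "is_perm p" "is_perm (direct_sum p q)"
  shows "is_perm q"
proof (rule is_permI)
  show "distinct q" using assms(2) by (simp add: is_perm_def direct_sum_def distinct_map)
  show "set q \<subseteq> {1..length q}"
  proof
    fix x assume x: "x \<in> set q"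
    then have "x + length p \<in> set (direct_sum p q)" by (simp add: direct_sum_def)
    moreover have "x + length p \<notin> set p"
      using assms(2) x unfolding is_perm_def direct_sum_def by auto
    ultimately have "x + length p \<in> {1..length p + length q}" "x + length p \<notin> {1..length p}"
      using assms by (simp_all add: is_perm_def)
    then show "x \<in> {1..length q}" by auto
  qed
qed

section \<open>Unique factorisation into sum-indecomposable permutations\<close>

lemma sum_indecomposable_imp: "sum_indecomposable p \<Longrightarrow> is_perm p \<and> p \<noteq> []"
  by (simp only: sum_indecomposable_def) blast

text \<open>What \<open>r\<close> has beyond \<open>q\<close> is itself a shifted permutation
  \<open>s\<close>, so r is the direct sum of \<open>q\<close> and \<open>s\<close>, and
  indecomposability leaves only the empty \<open>s\<close>.\<close>

lemma sum_indecomposable_prefix: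
  assumes r: "sum_indecomposable r" and q: "is_perm q" "q \<noteq> []"
    and eq: "direct_sum q Q = direct_sum r R" and le: "length q \<le> length r"
  shows "q = r"
proof -
  define s where "s = take (length r - length q) Q"
  have "r = take (length r) (direct_sum q Q)" by (simp add: eq) (simp add: direct_sum_def)
  also have "\<dots> = direct_sum q s" using le by (simp add: direct_sum_def s_def take_map)
  finally have rs: "r = direct_sum q s" .
  moreover have "is_perm s"
    using is_perm_direct_sum_right[OF q(1), of s] sum_indecomposable_imp[OF r] rs by metis
  ultimately have "s = []" using r q unfolding sum_indecomposable_def by blast
  with rs show ?thesis by simp
qed

text \<open>Makes the \<open>THE\<close> in \<open>direct_sum_components\<close> well defined. The
  first factors are prefixes of one word, hence comparable, and indecomposability of the longer
  makes them equal.\<close>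

lemma foldr_direct_sum_inject:
  assumes "\<forall>q \<in> set qs. sum_indecomposable q" "\<forall>q \<in> set rs. sum_indecomposable q"
    and "foldr direct_sum qs [] = foldr direct_sum rs []"
  shows "qs = rs"
  using assms
proof (induction qs arbitrary: rs)
  case Nil
  show ?case
  proof (cases rs)
    case (Cons r rs')
    then have "direct_sum r (foldr direct_sum rs' []) = []" using Nil.prems(3) by simp
    then have "r = []" by simp
    then show ?thesis using sum_indecomposable_imp[of r] Nil.prems(2) Cons by simp
  qed simp
next
  case (Cons q qs)
  have "rs \<noteq> []" using Cons.prems(1,3) sum_indecomposable_imp[of q] by auto
  then obtain r rs' where rs: "rs = r # rs'" by (cases rs) auto
  let ?Q = "foldr direct_sum qs []" and ?R = "foldr direct_sum rs' []"
  have ind: "sum_indecomposable q" "sum_indecomposable r" using Cons.prems rs by auto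
  have eq: "direct_sum q ?Q = direct_sum r ?R" using Cons.prems rs by simp
  have "q = r"
  proof (cases "length q \<le> length r")
    case True
    with ind eq show ?thesis
      by (intro sum_indecomposable_prefix[of r q ?Q ?R]) (simp_all add: sum_indecomposable_imp)
  next
    case False
    with ind eq have "r = q"
      by (intro sum_indecomposable_prefix[of q r ?R ?Q]) (simp_all add: sum_indecomposable_imp)
    then show ?thesis by simp
  qed
  with eq have "?Q = ?R" by (auto intro: direct_sum_cancel_left)
  with Cons.IH[of rs'] Cons.prems rs \<open>q = r\<close> show ?case by simp
qed

lemma perm_comp_foldr_direct_sum:
  assumes "\<forall>q \<in> set qs. sum_indecomposable q"
  shows "perm_comp (foldr direct_sum qs []) = length qs"
proof -
  have "direct_sum_components (foldr direct_sum qs []) = qs"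
    unfolding direct_sum_components_def
  proof (rule the_equality)
    fix rs assume "(\<forall>q \<in> set rs. sum_indecomposable q) \<and> foldr direct_sum qs [] = foldr direct_sum rs []"
    then show "rs = qs" using assms foldr_direct_sum_inject[of rs qs] by metis
  qed (use assms in simp)
  then show ?thesis by (simp add: perm_comp_def)
qed

lemma foldr_direct_sum_append:
  "foldr direct_sum (ps @ qs) [] = direct_sum (foldr direct_sum ps []) (foldr direct_sum qs [])"
  by (induction ps) (simp_all add: direct_sum_assoc)

lemma ex_direct_sum_components:
  assumes "is_perm p"
  shows "\<exists>qs. (\<forall>q \<in> set qs. sum_indecomposable q) \<and> p = foldr direct_sum qs []"
  using assms
proof (induction "length p" arbitrary: p rule: less_induct)
  case less
  consider "p = []" | "sum_indecomposable p" |
    q r where "is_perm q" "is_perm r" "q \<noteq> []" "r \<noteq> []" "p = direct_sum q r"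
    using less.prems unfolding sum_indecomposable_def by blast
  then show ?case
  proof cases
    case 1
    then show ?thesis by (intro exI[of _ "[]"]) simp
  next
    case 2
    then show ?thesis by (intro exI[of _ "[p]"]) simp
  next
    case 3
    then obtain qs rs where "\<forall>q \<in> set qs. sum_indecomposable q" "q = foldr direct_sum qs []"
      "\<forall>q \<in> set rs. sum_indecomposable q" "r = foldr direct_sum rs []"
      using less.hyps[of q] less.hyps[of r] by auto
    with 3 show ?thesis by (intro exI[of _ "qs @ rs"]) (auto simp: foldr_direct_sum_append simp del: foldr_append)
  qed
qed

text \<open>The concatenated component lists of the summands form a component list of the sum, and
  by uniqueness it is the only one.\<close>

lemma perm_comp_direct_sum:
  assumes "is_perm p" "is_perm q"
  shows "perm_comp (direct_sum p q) = perm_comp p + perm_comp q"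
proof -
  obtain ps qs where *: "\<forall>q \<in> set ps. sum_indecomposable q" "p = foldr direct_sum ps []"
    "\<forall>q \<in> set qs. sum_indecomposable q" "q = foldr direct_sum qs []"
    using ex_direct_sum_components assms by metis
  then have "perm_comp (foldr direct_sum (ps @ qs) []) = length (ps @ qs)"
    by (intro perm_comp_foldr_direct_sum) auto
  with * show ?thesis
    by (simp add: foldr_direct_sum_append perm_comp_foldr_direct_sum del: foldr_append)
qed

lemma perm_comp_Nil: "perm_comp [] = 0"
  using perm_comp_foldr_direct_sum[of "[]"] by simp

lemma perm_comp_sum_indecomposable: "sum_indecomposable p \<Longrightarrow> perm_comp p = 1"
  using perm_comp_foldr_direct_sum[of "[p]"] by simp

section \<open>Right-to-left maxima and minima\<close>

text \<open>The first entry of \<open>q\<close> exceeds all of \<open>p\<close>, so no position of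
  \<open>p\<close> survives.\<close>

lemma rl_max_append:
  assumes "q \<noteq> []" "\<And>x y. x \<in> set p \<Longrightarrow> y \<in> set q \<Longrightarrow> x < y"
  shows "rl_max (p @ q) = (+) (length p) ` rl_max q" (is "?L = ?R")
proof (intro equalityI subsetI)
  fix i assume "i \<in> ?L"
  then have i: "i < length p + length q"
    "\<And>j. i < j \<Longrightarrow> j < length p + length q \<Longrightarrow> (p @ q) ! j < (p @ q) ! i"
    by (auto simp: rl_max_def)
  have "length p \<le> i"
  proof (rule ccontr)
    assume "\<not> length p \<le> i"
    with i(2)[of "length p"] assms show False by (auto simp: nth_append dest: less_asym)
  qed
  then obtain k where k: "i = length p + k" by (metis le_Suc_ex)
  have "q ! j < q ! k" if "k < j" "j < length q" for j
    using i(2)[of "length p + j"] that k by (simp add: nth_append)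
  with i(1) k show "i \<in> ?R" by (auto simp: rl_max_def)
next
  fix i assume "i \<in> ?R"
  then obtain k where k: "i = length p + k" "k \<in> rl_max q" by blast
  have "(p @ q) ! j < (p @ q) ! i" if "i < j" "j < length p + length q" for j
  proof -
    have "j - length p \<in> {k<..<length q}" using that k by auto
    with k that show ?thesis unfolding rl_max_def by (auto simp: nth_append)
  qed
  with k show "i \<in> ?L" by (auto simp: rl_max_def)
qed

lemma rl_min_append:
  assumes "\<And>x y. x \<in> set p \<Longrightarrow> y \<in> set q \<Longrightarrow> x < y"
  shows "rl_min (p @ q) = rl_min p \<union> (+) (length p) ` rl_min q" (is "?L = ?R")
proof (intro equalityI subsetI)
  fix i assume "i \<in> ?L"
  then have i: "i < length p + length q"
    "\<And>j. i < j \<Longrightarrow> j < length p + length q \<Longrightarrow> (p @ q) ! i < (p @ q) ! j"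
    by (auto simp: rl_min_def)
  show "i \<in> ?R"
  proof (cases "i < length p")
    case True
    have "p ! i < p ! j" if "i < j" "j < length p" for j
      using i(2)[of j] that by (simp add: nth_append)
    with True show ?thesis by (auto simp: rl_min_def)
  next
    case False
    then obtain k where k: "i = length p + k" by (metis le_Suc_ex not_less)
    have "q ! k < q ! j" if "k < j" "j < length q" for j
      using i(2)[of "length p + j"] that k by (simp add: nth_append)
    with i(1) k show "i \<in> ?R" by (auto simp: rl_min_def)
  qed
next
  fix i assume "i \<in> ?R"
  then consider "i \<in> rl_min p" | k where "i = length p + k" "k \<in> rl_min q" by blast
  then show "i \<in> ?L"
  proof cases
    case 1
    have "(p @ q) ! i < (p @ q) ! j" if "i < j" "j < length p + length q" for j
    proof (cases "j < length p")
      case False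
      then have "p ! i \<in> set p" "q ! (j - length p) \<in> set q" using that 1 by (auto simp: rl_min_def)
      from assms[OF this] False 1 show ?thesis by (auto simp: rl_min_def nth_append)
    qed (use that 1 in \<open>auto simp: rl_min_def nth_append\<close>)
    with 1 show ?thesis by (auto simp: rl_min_def)
  next
    case 2
    have "(p @ q) ! i < (p @ q) ! j" if "i < j" "j < length p + length q" for j
    proof -
      have "j - length p \<in> {k<..<length q}" using that 2 by auto
      with 2 that show ?thesis unfolding rl_min_def by (auto simp: nth_append)
    qed
    with 2 show ?thesis by (auto simp: rl_min_def)
  qed
qed

lemma rl_max_map_add: "rl_max (map (\<lambda>x. x + k) p) = rl_max p"
  by (auto simp: rl_max_def)

lemma rl_min_map_add: "rl_min (map (\<lambda>x. x + k) p) = rl_min p"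
  by (auto simp: rl_min_def)

lemma finite_rl_min: "finite (rl_min p)" "rl_min p \<subseteq> {..<length p}"
  by (auto simp: rl_min_def)

text \<open>Stated for words with a bound \<open>k\<close> in place of \<open>length p\<close>, so
  that it also serves the flattened words of partitions, of which only the set of letters is
  computed.\<close>

lemma rmax_append_shift:
  assumes "q \<noteq> []" "\<And>x. x \<in> set p \<Longrightarrow> x \<le> k" "0 \<notin> set q"
  shows "rmax (p @ map (\<lambda>x. x + k) q) = rmax q"
proof -
  have "x < y" if "x \<in> set p" "y \<in> set (map (\<lambda>x. x + k) q)" for x y
    using that assms by (cases "y - k") fastforce+
  with rl_max_append[of "map (\<lambda>x. x + k) q" p] assms(1) show ?thesis
    by (simp add: rmax_def rl_max_map_add card_image)
qed

lemma rmax_direct_sum: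
  "is_perm p \<Longrightarrow> is_perm q \<Longrightarrow> q \<noteq> [] \<Longrightarrow> rmax (direct_sum p q) = rmax q"
  unfolding direct_sum_def by (rule rmax_append_shift) (auto simp: is_perm_def)

lemma rmin_direct_sum:
  assumes "is_perm p" "is_perm q"
  shows "rmin (direct_sum p q) = rmin p + rmin q"
proof -
  have "x < y" if "x \<in> set p" "y \<in> set (map (\<lambda>x. x + length p) q)" for x y
    using that assms by (auto simp: is_perm_def)
  then have "rl_min (direct_sum p q) = rl_min p \<union> (+) (length p) ` rl_min q"
    unfolding direct_sum_def by (subst rl_min_append) (auto simp: rl_min_map_add)
  moreover have "rl_min p \<inter> (+) (length p) ` rl_min q = {}" using finite_rl_min(2)[of p] by auto
  ultimately show ?thesis by (simp add: rmin_def card_Un_disjoint finite_rl_min card_image)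
qed

lemma rmin_plus_nonrmin: "rmin p + nonrmin p = length p + 1"
  using card_mono[OF _ finite_rl_min(2)[of p]]
  by (simp add: rmin_def nonrmin_def card_Diff_subset finite_rl_min)

lemma rmax_Cons:
  assumes "\<And>x. x \<in> set p \<Longrightarrow> x < m"
  shows "rmax (m # p) = Suc (rmax p)"
proof -
  have "rl_max (m # p) = insert 0 (Suc ` rl_max p)" (is "?L = ?R")
  proof (intro equalityI subsetI)
    fix i assume i: "i \<in> ?L"
    then show "i \<in> ?R" by (cases i) (force simp: rl_max_def)+
  next
    fix i assume i: "i \<in> ?R"
    then show "i \<in> ?L" using assms by (auto simp: rl_max_def nth_Cons' Suc_less_eq2)
  qed
  moreover have "finite (rl_max p)" by (simp add: rl_max_def)
  ultimately show ?thesis by (simp add: rmax_def card_image)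
qed

text \<open>The prepended maximum is followed by something smaller; over the empty word it would
  itself be a right-to-left minimum.\<close>

lemma rmin_Cons:
  assumes "p \<noteq> []" "\<And>x. x \<in> set p \<Longrightarrow> x < m"
  shows "rmin (m # p) = rmin p"
proof -
  have "rl_min (m # p) = Suc ` rl_min p" (is "?L = ?R")
  proof (intro equalityI subsetI)
    fix i assume i: "i \<in> ?L"
    show "i \<in> ?R"
    proof (cases i)
      case 0
      have "1 \<in> {i<..<length (m # p)}" using 0 assms(1) by simp
      with i have "(m # p) ! i < (m # p) ! 1" unfolding rl_min_def by blast
      with 0 assms(1) assms(2)[of "p ! 0"] show ?thesis by simp
    next
      case (Suc j)
      with i show ?thesis by (force simp: rl_min_def)
    qed
  next
    fix i assume i: "i \<in> ?R"
    then show "i \<in> ?L" by (auto simp: rl_min_def nth_Cons' Suc_less_eq2)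
  qed
  then show ?thesis by (simp add: rmin_def card_image)
qed

section \<open>Closure of 231-avoiding permutations\<close>

text \<open>The last entry of a 231 is below its first, so an occurrence cannot start in the lower
  summand and end in the upper one.\<close>

lemma avoids_231_direct_sum:
  assumes "is_perm p" "is_perm q" "avoids_231 p" "avoids_231 q"
  shows "avoids_231 (direct_sum p q)"
  unfolding avoids_231_def
proof (intro notI, elim exE conjE)
  fix i j k
  assume *: "i < j" "j < k" "k < length (direct_sum p q)"
    "direct_sum p q ! k < direct_sum p q ! i" "direct_sum p q ! i < direct_sum p q ! j"
  consider "k < length p" | "i < length p" "length p \<le> k" | "length p \<le> i" by linarith
  then show False
  proof cases
    case 1
    with * have "p ! k < p ! i" "p ! i < p ! j" by (simp_all add: nth_direct_sum)
    with * 1 assms(3) show False unfolding avoids_231_def by blast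
  next
    case 2
    with * is_perm_nth[OF assms(1), of i] show False by (simp add: nth_direct_sum)
  next
    case 3
    with * have "q ! (k - length p) < q ! (i - length p)" "q ! (i - length p) < q ! (j - length p)"
      "i - length p < j - length p" "j - length p < k - length p" "k - length p < length q"
      by (simp_all add: nth_direct_sum diff_less_mono)
    with assms(4) show False unfolding avoids_231_def by blast
  qed
qed

lemma avoids_231_Cons:
  assumes "avoids_231 p" "\<And>x. x \<in> set p \<Longrightarrow> x < m"
  shows "avoids_231 (m # p)"
  unfolding avoids_231_def
proof (intro notI, elim exE conjE)
  fix i j k
  assume *: "i < j" "j < k" "k < length (m # p)" "(m # p) ! k < (m # p) ! i" "(m # p) ! i < (m # p) ! j"
  show False
  proof (cases i)
    case 0
    with * assms(2)[of "p ! (j - 1)"] show False by (cases j) auto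
  next
    case (Suc i')
    moreover obtain j' k' where "j = Suc j'" "k = Suc k'" using * by (metis less_imp_Suc_add)
    ultimately show False using * assms(1) unfolding avoids_231_def by auto
  qed
qed

lemma is_perm_Cons_max: "is_perm p \<Longrightarrow> is_perm ((length p + 1) # p)"
  by (intro is_permI) (auto simp: is_perm_def)

text \<open>The maximum stands first, hence in the first summand, whose values are at most its own
  length.\<close>

lemma sum_indecomposable_Cons_max:
  assumes "is_perm p"
  shows "sum_indecomposable ((length p + 1) # p)"
  unfolding sum_indecomposable_def
proof (intro conjI notI)
  assume "\<exists>q r. is_perm q \<and> is_perm r \<and> q \<noteq> [] \<and> r \<noteq> [] \<and> (length p + 1) # p = direct_sum q r"
  then obtain q r where *: "is_perm q" "q \<noteq> []" "r \<noteq> []" "(length p + 1) # p = direct_sum q r"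
    by blast
  then have "length p + 1 = q ! 0" using nth_direct_sum[of 0 q r] by (metis length_greater_0_conv nth_Cons_0 trans_less_add1)
  moreover have "q ! 0 \<le> length q" using * is_perm_nth[of q 0] by simp
  moreover have "length p + 1 = length q + length r" using arg_cong[OF *(4), of length] by simp
  ultimately show False using \<open>r \<noteq> []\<close> by (cases r) auto
qed (use assms in \<open>simp_all add: is_perm_Cons_max[simplified]\<close>)

interpretation perms_231: catalan_algebra perms_231
proof unfold_locales
  fix x n assume "x \<in> graded perms_231 n"
  then show "lam perms_231 x \<in> graded perms_231 (Suc n)"
    using is_perm_Cons_max[of x] avoids_231_Cons[of x "length x + 1"]
    by (auto simp: perms_231_def is_perm_def)
next
  fix x y m n assume "x \<in> graded perms_231 m" "y \<in> graded perms_231 n"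
  then show "oplus perms_231 x y \<in> graded perms_231 (m + n)"
    by (simp add: perms_231_def is_perm_direct_sum avoids_231_direct_sum)
qed (simp_all add: perms_231_def direct_sum_assoc avoids_231_def)

lemma canonical_stats_perms_231:
  "canonical_stats_equal (canonical_bijection plane_trees perms_231) perm_comp rmax rmin nonrmin"
proof -
  have ops: "neutral perms_231 = []" "lam perms_231 x = (length x + 1) # x"
    "oplus perms_231 = direct_sum" "x \<in> graded perms_231 n \<Longrightarrow> is_perm x \<and> length x = n" for x n
    by (simp_all add: perms_231_def)
  have less: "y < length x + 1" if "x \<in> graded perms_231 n" "y \<in> set x" for x y n
    using ops(4)[OF that(1)] that(2) by (auto simp: is_perm_def)
  show ?thesis
  proof (rule perms_231.canonical_stats_equalI, goal_cases)
    case (2 x n)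
    then show ?case unfolding ops using ops(4) perm_comp_sum_indecomposable sum_indecomposable_Cons_max by blast
  next
    case (3 x y m n)
    then show ?case by (simp add: ops perm_comp_direct_sum)
  next
    case (5 x n)
    then show ?case unfolding ops using less by (intro rmax_Cons)
  next
    case (6 x y m n)
    then show ?case using ops(4)[OF 6(1)] ops(4)[OF 6(2)] by (auto simp: ops(3) intro!: rmax_direct_sum)
  next
    case (8 x n)
    then have "x \<noteq> []" using ops(4) by fastforce
    with 8 show ?case unfolding ops using less by (intro rmin_Cons)
  next
    case (9 x y m n)
    then show ?case using ops(4) by (simp add: ops(3) rmin_direct_sum)
  next
    case (10 x n)
    then show ?case using ops(4)[of x] rmin_plus_nonrmin[of x] by simp
  qed (simp_all add: ops perm_comp_Nil, simp_all add: rmax_def rl_max_def rmin_def rl_min_def)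
qed

section \<open>321-avoiding permutations\<close>

lemma avoids_321_direct_sum:
  assumes "is_perm p" "is_perm q" "avoids_321 p" "avoids_321 q"
  shows "avoids_321 (direct_sum p q)"
  unfolding avoids_321_def
proof (intro notI, elim exE conjE)
  fix i j k
  assume *: "i < j" "j < k" "k < length (direct_sum p q)"
    "direct_sum p q ! k < direct_sum p q ! j" "direct_sum p q ! j < direct_sum p q ! i"
  consider "k < length p" | "i < length p" "length p \<le> k" | "length p \<le> i" by linarith
  then show False
  proof cases
    case 1
    with * have "p ! k < p ! j" "p ! j < p ! i" by (simp_all add: nth_direct_sum)
    with * 1 assms(3) show False unfolding avoids_321_def by blast
  next
    case 2
    with * is_perm_nth[OF assms(1), of i] less_trans[OF *(4,5)] show False by (simp add: nth_direct_sum)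
  next
    case 3
    with * have "q ! (k - length p) < q ! (j - length p)" "q ! (j - length p) < q ! (i - length p)"
      "i - length p < j - length p" "j - length p < k - length p" "k - length p < length q"
      by (simp_all add: nth_direct_sum diff_less_mono)
    with assms(4) show False unfolding avoids_321_def by blast
  qed
qed

lemma rl_minD: "j \<in> rl_min p \<Longrightarrow> j < k \<Longrightarrow> k < length p \<Longrightarrow> p ! j < p ! k"
  by (simp add: rl_min_def)

text \<open>The position of the smallest later entry is itself a right-to-left minimum, so a failure
  at \<open>j\<close> is always witnessed by one.\<close>

lemma not_rl_min_witness:
  assumes p: "is_perm p" and j: "j < length p" "j \<notin> rl_min p"
  obtains k where "j < k" "k \<in> rl_min p" "p ! k < p ! j"
proof -
  let ?K = "{j<..<length p}"
  obtain k' where k': "k' \<in> ?K" "\<not> p ! j < p ! k'" using j by (auto simp: rl_min_def)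
  then obtain k where k: "k \<in> ?K" "\<forall>m \<in> ?K. p ! k \<le> p ! m"
    using finite_greaterThanLessThan[of j "length p"]
    by (metis (no_types, lifting) arg_min_least arg_min_if_finite(1) empty_iff)
  have "p ! k < p ! m" if "m \<in> {k<..<length p}" for m
    using k that is_perm_nth_eq_iff[OF p, of k m] by (auto simp: le_less)
  with k have "k \<in> rl_min p" by (auto simp: rl_min_def)
  moreover have "p ! k \<le> p ! k'" "p ! k' \<le> p ! j" using k k' by auto
  then have "p ! k < p ! j"
    using k(1) is_perm_nth_eq_iff[OF p, of k j] by (auto simp: le_less)
  ultimately show ?thesis using that k by auto
qed

text \<open>Otherwise a larger entry before \<open>j\<close> and a smaller one after it complete a
  321. Entries off the right-to-left minima are therefore increasing.\<close>

lemma avoids_321_lr_max: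
  assumes "is_perm p" "avoids_321 p" "j < length p" "j \<notin> rl_min p"
  shows "j \<in> lr_max p"
proof (rule ccontr)
  assume "j \<notin> lr_max p"
  then obtain i where i: "i < j" "\<not> p ! i < p ! j" using assms(3) by (auto simp: lr_max_def)
  then have "p ! j < p ! i" using is_perm_nth_eq_iff[OF assms(1), of i j] assms(3) by auto
  moreover obtain k where "j < k" "k \<in> rl_min p" "p ! k < p ! j"
    using not_rl_min_witness assms by blast
  ultimately show False
    using assms(2) i finite_rl_min(2)[of p] unfolding avoids_321_def by blast
qed

lemma length_lam_321: "length (lam_321 p) = length p + 1"
  by (simp add: lam_321_def Let_def)

text \<open>
  The box construction in closed form: \<open>\<lambda>\<close> moves every right-to-left minimum one place to the right,
  and the remaining places receive the other entries followed by \<open>n + 1\<close>, in increasing order.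
\<close>

lemma lam_321_nth:
  fixes p :: "nat list"
  defines "N \<equiv> {..<length p} - rl_min p"
  assumes p: "is_perm p" "avoids_321 p" "p \<noteq> []"
  shows "j \<in> rl_min p \<Longrightarrow> lam_321 p ! Suc j = p ! j"
    and "c = 0 \<or> c - 1 \<in> N \<Longrightarrow>
      lam_321 p ! c = (if \<exists>b \<in> N. c \<le> b then p ! Min {b \<in> N. c \<le> b} else length p + 1)"
proof -
  define n where "n = length p"
  define i where "i = (THE i. i < n \<and> p ! i = 1)"
  have "1 \<in> set p" using p by (cases p) (auto simp: is_perm_def)
  then obtain i' where i': "i' < n" "p ! i' = 1" by (auto simp: in_set_conv_nth n_def)
  then have i: "i < n" "p ! i = 1"
    unfolding i_def using is_perm_nth_eq_iff[OF p(1)]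
    by (metis (mono_tags, lifting) n_def theI)+
  \<comment> \<open>The entry 1 at \<open>i\<close> undercuts everything before it, so all earlier
    places belong to \<open>N\<close>.\<close>
  have rl_min_ge: "i \<le> j" if "j \<in> rl_min p" for j
  proof (rule ccontr)
    assume "\<not> i \<le> j"
    with that i have "p ! j < 1" using rl_minD[of j p i] by (simp add: n_def)
    moreover have "1 \<le> p ! j" using that is_perm_nth[OF p(1), of j] by (auto simp: rl_min_def)
    ultimately show False by simp
  qed
  have i_rl_min: "i \<in> rl_min p"
  proof -
    have "p ! i < p ! j" if "i < j" "j < n" for j
      using i that is_perm_nth[OF p(1), of j] is_perm_nth_eq_iff[OF p(1), of i j]
      by (auto simp: n_def le_less)
    with i show ?thesis by (auto simp: rl_min_def n_def)
  qed
  define boxes where "boxes = {j \<in> lr_max p - rl_min p. i < j}"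
  \<comment> \<open>By \<open>avoids_321_lr_max\<close>, the maximum condition on a box follows from
    the other one.\<close>
  have boxes: "boxes = {j \<in> N. i < j}"
    unfolding boxes_def N_def using avoids_321_lr_max[OF p(1,2)] by (auto simp: lr_max_def)
  have N_less: "j \<in> N" if "j < i" for j
    using that i rl_min_ge[of j] by (auto simp: N_def n_def)
  define q where "q = take i p @ [n + 1] @ drop i p"
  define B where "B = insert i (Suc ` boxes)"
  have lam: "lam_321 p = map (\<lambda>j. if j \<in> B then q ! next_cyclic B j else q ! j) [0..<n + 1]"
    unfolding lam_321_def Let_def n_def[symmetric] i_def[symmetric] boxes_def[symmetric]
      q_def[symmetric] B_def[symmetric] using p(3) by simp
  have nth: "lam_321 p ! j = (if j \<in> B then q ! next_cyclic B j else q ! j)" if "j \<le> n" for j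
    unfolding lam using that by (simp del: upt_Suc)
  have q: "q ! j = (if j < i then p ! j else if j = i then n + 1 else p ! (j - 1))" if "j \<le> n" for j
    using that i by (auto simp: q_def nth_append nth_Cons' n_def)
  have N_bound: "j < n" if "j \<in> N" for j using that by (simp add: N_def n_def)
  have fin: "finite N" by (simp add: N_def)
  show "lam_321 p ! Suc j = p ! j" if j: "j \<in> rl_min p"
  proof -
    have "j < n" "i \<le> j" using j rl_min_ge finite_rl_min(2) by (auto simp: n_def)
    moreover have "Suc j \<notin> B" using j \<open>i \<le> j\<close> by (auto simp: B_def boxes N_def)
    ultimately show ?thesis using nth[of "Suc j"] q[of "Suc j"] by simp
  qed
  show "lam_321 p ! c = (if \<exists>b \<in> N. c \<le> b then p ! Min {b \<in> N. c \<le> b} else length p + 1)"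
    if c: "c = 0 \<or> c - 1 \<in> N"
  proof -
    have cn: "c \<le> n" using c N_bound[of "c - 1"] by auto
    show ?thesis
    proof (cases "c < i")
      \<comment> \<open>Left of \<open>i\<close> nothing is boxed or shifted, and \<open>c\<close>
        is itself in \<open>N\<close>, so it attains the minimum.\<close>
      case True
      then have "Min {b \<in> N. c \<le> b} = c" using N_less fin by (intro Min_eqI) auto
      moreover have "c \<notin> B" using True by (auto simp: B_def boxes)
      ultimately show ?thesis using True N_less[OF True] nth[of c] q[of c] cn by auto
    next
      case False
      have cB: "c \<in> B"
      proof (cases "c = i")
        case False
        with c \<open>\<not> c < i\<close> have "c - 1 \<in> N" "i \<le> c - 1" by auto
        moreover have "c - 1 \<noteq> i" using \<open>c - 1 \<in> N\<close> i_rl_min by (auto simp: N_def)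
        ultimately show ?thesis using \<open>i \<le> c - 1\<close>
          unfolding B_def boxes by (intro insertI2 image_eqI[of _ _ "c - 1"]) (use False \<open>\<not> c < i\<close> in auto)
      qed (simp add: B_def)
      \<comment> \<open>Before the rotation, the box \<open>Suc b\<close> holds
        \<open>p ! b\<close>. The next box after \<open>c\<close> thus delivers the first entry of
        \<open>N\<close> from \<open>c\<close> on.\<close>
      have *: "{k \<in> B. c < k} = Suc ` {b \<in> N. c \<le> b}"
      proof (intro equalityI subsetI)
        fix k assume "k \<in> Suc ` {b \<in> N. c \<le> b}"
        then obtain b where b: "k = Suc b" "b \<in> N" "c \<le> b" by blast
        moreover have "b \<noteq> i" using b i_rl_min by (auto simp: N_def)
        ultimately show "k \<in> {k \<in> B. c < k}" using False by (auto simp: B_def boxes)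
      qed (use False in \<open>auto simp: B_def boxes\<close>)
      show ?thesis
      proof (cases "\<exists>b \<in> N. c \<le> b")
        case True
        then have ne: "{b \<in> N. c \<le> b} \<noteq> {}" by blast
        then have "{k \<in> B. c < k} \<noteq> {}" unfolding * by simp
        then have "next_cyclic B c = Min {k \<in> B. c < k}" by (auto simp: next_cyclic_def)
        also have "\<dots> = Suc (Min {b \<in> N. c \<le> b})"
          unfolding * using mono_Min_commute[of Suc "{b \<in> N. c \<le> b}"] ne fin by (simp add: mono_def)
        finally have nx: "next_cyclic B c = Suc (Min {b \<in> N. c \<le> b})" .
        have "Min {b \<in> N. c \<le> b} \<in> {b \<in> N. c \<le> b}" using ne fin by (intro Min_in) auto
        then have "i \<le> Min {b \<in> N. c \<le> b}" "Min {b \<in> N. c \<le> b} < n"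
          using False N_bound by auto
        then show ?thesis using True nth[OF cn] cB nx q by simp
      next
        \<comment> \<open>No box follows, so the rotation wraps to the first box \<open>i\<close>,
          which holds \<open>n + 1\<close>.\<close>
        case none: False
        then have "\<not> (\<exists>k \<in> B. c < k)" using * by blast
        then have "next_cyclic B c = Min B" by (simp add: next_cyclic_def)
        also have "\<dots> = i" using fin by (intro Min_eqI) (auto simp: B_def boxes)
        finally show ?thesis using none nth[OF cn] cB q[of i] i by (simp add: n_def)
      qed
    qed
  qed
qed

section \<open>The image of a nonempty 321-avoiding permutation under lambda\<close>

locale perm_321 =
  fixes p :: "nat list"
  assumes is_perm: "is_perm p" and avoids: "avoids_321 p" and nonempty: "p \<noteq> []"
begin

abbreviation "n \<equiv> length p"
abbreviation "r \<equiv> lam_321 p"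
definition "N = {..<n} - rl_min p"
text \<open>The places of \<open>r\<close> not taken by a shifted right-to-left minimum. On
  \<open>C\<close> and on its complement in \<open>{0..n}\<close> the word \<open>r\<close> is
  increasing.\<close>

definition "C = insert 0 (Suc ` N)"

lemma N_less: "b \<in> N \<Longrightarrow> b < n" and finite_N: "finite N"
  by (simp_all add: N_def)

lemma position_cases:
  assumes "k \<le> n"
  obtains "k \<in> C" | j where "j \<in> rl_min p" "k = Suc j"
proof (cases k)
  case (Suc j)
  then show ?thesis using that assms by (cases "j \<in> rl_min p") (auto simp: C_def N_def)
qed (use that in \<open>simp add: C_def\<close>)

lemma r_rl_min: "j \<in> rl_min p \<Longrightarrow> r ! Suc j = p ! j"
  using lam_321_nth(1) is_perm avoids nonempty by blast

lemma r_C: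
  assumes "c \<in> C"
  obtains b where "b \<in> N" "c \<le> b" "\<And>b'. b' \<in> N \<Longrightarrow> c \<le> b' \<Longrightarrow> b \<le> b'" "r ! c = p ! b"
  | "\<And>b. b \<in> N \<Longrightarrow> b < c" "r ! c = n + 1"
proof (cases "\<exists>b \<in> N. c \<le> b")
  case True
  let ?M = "{b \<in> N. c \<le> b}"
  have "?M \<noteq> {}" "finite ?M" using True finite_N by auto
  then have "Min ?M \<in> ?M" "\<And>b. b \<in> ?M \<Longrightarrow> Min ?M \<le> b" using Min_in Min_le by blast+
  moreover have "r ! c = p ! Min ?M"
    using lam_321_nth(2)[OF is_perm avoids nonempty, of c] assms True by (auto simp: C_def N_def)
  ultimately show ?thesis using that(1) by blast
next
  case False
  then have "r ! c = n + 1"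
    using lam_321_nth(2)[OF is_perm avoids nonempty, of c] assms by (auto simp: C_def N_def)
  with False that(2) show ?thesis by force
qed

lemma p_mono_N: "a < b \<Longrightarrow> b \<in> N \<Longrightarrow> p ! a < p ! b"
  using avoids_321_lr_max[OF is_perm avoids, of b] by (auto simp: N_def lr_max_def)

lemma p_le: "j < n \<Longrightarrow> p ! j \<le> n"
  using is_perm_nth[OF is_perm] by blast

text \<open>Writing d as \<open>Suc d'\<close> with \<open>d'\<close> in \<open>N\<close> gives c <=
  d', so place \<open>c\<close> takes its entry from an index of at most \<open>d'\<close> and place
  \<open>d\<close> from one of at least \<open>d\<close>. Entries of \<open>p\<close> increase along
  \<open>N\<close>, and \<open>n + 1\<close> exceeds them all.\<close>

lemma r_mono_C:
  assumes "c \<in> C" "d \<in> C" "c < d"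
  shows "r ! c < r ! d"
proof -
  from assms obtain d' where d': "d = Suc d'" "d' \<in> N" by (auto simp: C_def)
  show ?thesis
    using assms(1)
  proof (cases rule: r_C)
    case (1 b)
    then have "b < d" using d' assms(3) by fastforce
    show ?thesis
      using assms(2)
    proof (cases rule: r_C)
      case (1 e)
      with \<open>b < d\<close> p_mono_N[of b e] \<open>r ! c = p ! b\<close> show ?thesis by simp
    next
      case 2
      with 1 p_le[OF N_less] show ?thesis by (simp add: le_imp_less_Suc)
    qed
  next
    case 2
    with d' assms(3) show ?thesis by fastforce
  qed
qed

lemma r_mono_rl_min: "j \<in> rl_min p \<Longrightarrow> k \<in> rl_min p \<Longrightarrow> j < k \<Longrightarrow> r ! Suc j < r ! Suc k"
  by (auto simp: r_rl_min, auto simp: rl_min_def)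

lemma r_bounds: "k \<le> n \<Longrightarrow> 1 \<le> r ! k \<and> r ! k \<le> n + 1"
proof (erule position_cases)
  assume "k \<in> C"
  then show ?thesis
  proof (cases rule: r_C)
    case (1 b)
    then show ?thesis using is_perm_nth[OF is_perm N_less[of b]] by simp
  qed simp
next
  fix j assume "j \<in> rl_min p" "k = Suc j"
  moreover from this have "j < n" using finite_rl_min(2) by blast
  ultimately show ?thesis using is_perm_nth[OF is_perm, of j] by (simp add: r_rl_min)
qed

lemma r_neq:
  assumes "c \<in> C" "j \<in> rl_min p"
  shows "r ! c \<noteq> r ! Suc j"
proof -
  have j: "j < n" using assms(2) finite_rl_min(2) by blast
  show ?thesis
    using assms(1)
  proof (cases rule: r_C)
    case (1 b)
    moreover have "b \<noteq> j" using 1 assms(2) by (auto simp: N_def)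
    ultimately show ?thesis
      using is_perm_nth_eq_iff[OF is_perm j N_less[of b]] assms(2) by (auto simp: r_rl_min)
  next
    case 2
    then show ?thesis using p_le[OF j] assms(2) by (simp add: r_rl_min)
  qed
qed

lemma is_perm_r: "is_perm r"
proof (rule is_permI)
  have "r ! k \<noteq> r ! l" if "k < l" "l \<le> n" for k l
  proof -
    have "k \<le> n" using that by simp
    then show ?thesis
    proof (cases rule: position_cases)
      case 1
      from that(2) show ?thesis
        by (cases rule: position_cases) (use 1 that r_mono_C r_neq in force)+
    next
      case (2 j)
      from that(2) show ?thesis
        by (cases rule: position_cases) (use 2 that r_mono_rl_min r_neq in force)+
    qed
  qed
  then have "r ! k \<noteq> r ! l" if "k < length r" "l < length r" "k \<noteq> l" for k l
    using that by (metis Suc_eq_plus1 length_lam_321 less_Suc_eq_le linorder_neqE_nat)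
  then show "distinct r" by (simp add: distinct_conv_nth)
  show "set r \<subseteq> {1..length r}"
    using r_bounds by (force simp: in_set_conv_nth length_lam_321)
qed

text \<open>Of any three places two lie in the same class, where \<open>r\<close> increases, whereas
  every pair in a 321 descends.\<close>

lemma avoids_r: "avoids_321 r"
  unfolding avoids_321_def
proof (intro notI, elim exE conjE)
  fix i j k assume *: "i < j" "j < k" "k < length r" "r ! k < r ! j" "r ! j < r ! i"
  have le: "i \<le> n" "j \<le> n" "k \<le> n" using * by (simp_all add: length_lam_321)
  have D: "\<exists>l \<in> rl_min p. m = Suc l" if "m \<le> n" "m \<notin> C" for m
    using that by (cases rule: position_cases) auto
  have mono_D: "r ! l < r ! m" if "l \<le> n" "l \<notin> C" "m \<le> n" "m \<notin> C" "l < m" for l m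
    using D[OF that(1,2)] D[OF that(3,4)] that(5) r_mono_rl_min by auto
  have "r ! l < r ! m" if "l \<le> n" "m \<le> n" "l < m" "l \<in> C \<longleftrightarrow> m \<in> C" for l m
    using that mono_D[of l m] r_mono_C[of l m] by blast
  then show False using * le by (metis less_trans not_less_iff_gr_or_eq)
qed

lemma last_rl_min: "n - 1 \<in> rl_min p"
  using nonempty by (auto simp: rl_min_def)

text \<open>The last entry is a right-to-left minimum and moves to the new last place. The length
  grows while the last value stays, which is the increment of \<open>rcomp_321\<close>.\<close>

lemma last_r: "last r = last p"
proof -
  have "r \<noteq> []" using length_lam_321[of p] by auto
  then have "last r = r ! n" by (simp add: last_conv_nth length_lam_321)
  also have "\<dots> = last p" using r_rl_min[OF last_rl_min] nonempty by (simp add: last_conv_nth)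
  finally show ?thesis .
qed

text \<open>An entry \<open>p ! b\<close> at a place of \<open>C\<close> has a smaller right-to-left
  minimum of \<open>p\<close> after \<open>b\<close>, which is still to its right once shifted;
  \<open>n + 1\<close> is never last. Conversely, after \<open>Suc j\<close> come only entries of
  \<open>p\<close> from indices beyond \<open>j\<close>, or \<open>n + 1\<close>.\<close>

lemma rl_min_r: "rl_min r = Suc ` rl_min p"
proof (intro equalityI subsetI)
  fix c assume c: "c \<in> rl_min r"
  then have "c \<le> n" using finite_rl_min(2)[of r] by (auto simp: length_lam_321)
  then show "c \<in> Suc ` rl_min p"
  proof (cases rule: position_cases)
    case 1
    have "\<exists>k > c. k \<le> n \<and> r ! k < r ! c"
      using 1
    proof (cases rule: r_C)
      case (1 b)
      then obtain k where k: "b < k" "k \<in> rl_min p" "p ! k < p ! b"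
        using not_rl_min_witness[OF is_perm, of b] by (auto simp: N_def)
      then have "k < n" using finite_rl_min(2) by blast
      with k 1 show ?thesis by (intro exI[of _ "Suc k"]) (simp add: r_rl_min)
    next
      case 2
      have "c \<noteq> n" using 1 last_rl_min nonempty by (auto simp: C_def N_def)
      with \<open>c \<le> n\<close> have "c < n" by simp
      moreover have "r ! n \<le> n" using r_rl_min[OF last_rl_min] nonempty p_le[of "n - 1"] by simp
      ultimately show ?thesis using 2 by (intro exI[of _ n]) simp
    qed
    then obtain k where "c < k" "k < length r" "r ! k < r ! c" by (auto simp: length_lam_321)
    with rl_minD[OF c] show ?thesis by (meson less_asym)
  qed auto
next
  fix c assume "c \<in> Suc ` rl_min p"
  then obtain j where j: "c = Suc j" "j \<in> rl_min p" by blast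
  have "r ! c < r ! k" if "c < k" "k \<le> n" for k
    using that(2)
  proof (cases rule: position_cases)
    case 1
    then show ?thesis
    proof (cases rule: r_C)
      case (1 b)
      with j that N_less[of b] show ?thesis by (simp add: r_rl_min) (simp add: rl_min_def)
    next
      case 2
      have "j < n" using j that by simp
      then show ?thesis using j 2 p_le[of j] by (simp add: r_rl_min)
    qed
  next
    case (2 m)
    with j that show ?thesis by (auto intro: r_mono_rl_min)
  qed
  with j show "c \<in> rl_min r" by (auto simp: rl_min_def length_lam_321)
qed

text \<open>Suppose the first \<open>k\<close> places hold exactly the values up to
  \<open>k\<close>, and take the last place of \<open>C\<close> among them. Its entry is
  \<open>n + 1\<close>, which is too large, or some \<open>p ! b\<close>; in the latter case a
  smaller right-to-left minimum after \<open>b\<close> lands at a place beyond the first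
  \<open>k\<close>, although its value is below \<open>k\<close>.\<close>

lemma sum_indecomposable_r: "sum_indecomposable r"
  unfolding sum_indecomposable_def
proof (intro conjI notI)
  assume "\<exists>s t. is_perm s \<and> is_perm t \<and> s \<noteq> [] \<and> t \<noteq> [] \<and> r = direct_sum s t"
  then obtain s t where s: "is_perm s" "is_perm t" "s \<noteq> []" "t \<noteq> []" "r = direct_sum s t"
    by blast
  define k where "k = length s"
  have len: "n + 1 = k + length t" using arg_cong[OF s(5), of length] by (simp add: k_def length_lam_321)
  have low: "r ! m \<le> k" if "m < k" for m
    using that is_perm_nth[OF s(1), of m] nth_direct_sum[of m s t] by (simp flip: s(5) k_def)
  have high: "k < r ! m" if "k \<le> m" "m \<le> n" for m
  proof -
    have "m - k < length t" using that len s(4) by (cases t) auto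
    moreover have "r ! m = t ! (m - k) + k"
      using that len nth_direct_sum[of m s t] by (simp flip: s(5) k_def)
    ultimately show ?thesis using is_perm_nth[OF s(2), of "m - k"] by simp
  qed
  let ?M = "{c \<in> C. c < k}"
  have "0 \<in> ?M" using s(3) by (simp add: C_def k_def)
  then have "finite ?M" "?M \<noteq> {}" by auto
  then have c: "Max ?M \<in> ?M" "\<And>d. d \<in> ?M \<Longrightarrow> d \<le> Max ?M" using Max_in Max_ge by blast+
  then have "Max ?M \<in> C" by simp
  then show False
  proof (cases rule: r_C)
    case (1 b)
    then have "Suc b \<in> C" by (simp add: C_def)
    \<comment> \<open>\<open>Suc b\<close> is in \<open>C\<close> and lies beyond the chosen last
      place, so it is not among the first \<open>k\<close>.\<close>
    have kb: "k \<le> Suc b"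
    proof (rule ccontr)
      assume "\<not> k \<le> Suc b"
      with \<open>Suc b \<in> C\<close> have "Suc b \<in> ?M" by simp
      with c(2) 1(2) show False by (meson not_less_eq_eq)
    qed
    obtain m where m: "b < m" "m \<in> rl_min p" "p ! m < p ! b"
      using not_rl_min_witness[OF is_perm, of b] 1 by (auto simp: N_def)
    then have "m < n" using finite_rl_min(2) by blast
    with m kb have "k < p ! m" using high[of "Suc m"] by (simp add: r_rl_min)
    with m 1 low[of "Max ?M"] c(1) show False by simp
  next
    case 2
    with low[of "Max ?M"] c(1) have "n + 1 \<le> k" by simp
    with len s(4) show False by simp
  qed
next
  show "is_perm r" by (rule is_perm_r)
  show "r = [] \<Longrightarrow> False" using length_lam_321[of p] by simp
qed

end

lemma is_perm_singleton: "is_perm [1]"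
  by (auto simp: is_perm_def)

lemma sum_indecomposable_singleton: "sum_indecomposable [1]"
  using sum_indecomposable_Cons_max[of "[]"] by simp

interpretation perms_321: catalan_algebra perms_321
proof unfold_locales
  fix x n assume x: "x \<in> graded perms_321 n"
  show "lam perms_321 x \<in> graded perms_321 (Suc n)"
  proof (cases "x = []")
    case True
    with x show ?thesis using is_perm_singleton by (simp add: perms_321_def lam_321_def avoids_321_def)
  next
    case False
    with x interpret perm_321 x by unfold_locales (simp_all add: perms_321_def)
    from x is_perm_r avoids_r show ?thesis by (simp add: perms_321_def length_lam_321)
  qed
next
  fix x y m n assume "x \<in> graded perms_321 m" "y \<in> graded perms_321 n"
  then show "oplus perms_321 x y \<in> graded perms_321 (m + n)"
    by (simp add: perms_321_def is_perm_direct_sum avoids_321_direct_sum)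
qed (simp_all add: perms_321_def direct_sum_assoc avoids_321_def)

lemma canonical_stats_perms_321:
  "canonical_stats_equal (canonical_bijection plane_trees perms_321) perm_comp rcomp_321 rmin nonrmin"
proof -
  have ops: "neutral perms_321 = []" "lam perms_321 = lam_321"
    "oplus perms_321 = direct_sum"
    "x \<in> graded perms_321 n \<longleftrightarrow> is_perm x \<and> length x = n \<and> avoids_321 x" for x n
    by (auto simp: perms_321_def)
  have perm_321: "perm_321 x" if "x \<in> graded perms_321 n" "x \<noteq> []" for x n
    using that by unfold_locales (simp_all add: ops)
  have lam_Nil: "lam_321 [] = [1]" by (simp add: lam_321_def)
  show ?thesis
  proof (rule perms_321.canonical_stats_equalI, goal_cases)
    case (2 x n)
    then have "sum_indecomposable (lam_321 x)"
      using perm_321.sum_indecomposable_r[OF perm_321] sum_indecomposable_singleton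
      by (cases "x = []") (auto simp: lam_Nil)
    then show ?case by (simp add: ops perm_comp_sum_indecomposable)
  next
    case (3 x y m n)
    then show ?case by (simp add: ops perm_comp_direct_sum)
  next
    case (5 x n)
    show ?case
    proof (cases "x = []")
      case False
      \<comment> \<open>The bound keeps the subtraction in \<open>rcomp_321\<close> exact.\<close>
      then have "last x \<le> length x" using 5 last_in_set[of x] by (auto simp: ops is_perm_def)
      moreover have "lam_321 x \<noteq> []" using length_lam_321[of x] by auto
      ultimately show ?thesis
        using False perm_321.last_r[OF perm_321[OF 5]] by (simp add: ops rcomp_321_def length_lam_321)
    qed (simp add: ops lam_Nil rcomp_321_def)
  next
    case (6 x y m n)
    then have "y \<noteq> []" by (auto simp: ops)
    then show ?case by (auto simp: ops rcomp_321_def direct_sum_def last_map)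
  next
    case (8 x n)
    then have "perm_321 x" using perm_321 by (fastforce simp: ops)
    then show ?case using perm_321.rl_min_r by (simp add: ops rmin_def card_image)
  next
    case (9 x y m n)
    then show ?case by (simp add: ops rmin_direct_sum)
  next
    case (10 x n)
    then show ?case using rmin_plus_nonrmin[of x] by (simp add: ops)
  qed (simp_all add: ops perm_comp_Nil lam_Nil rcomp_321_def rmin_def rl_min_def)
qed

section \<open>Binary trees\<close>

lemma bt_oplus_assoc: "bt_oplus (bt_oplus x y) z = bt_oplus x (bt_oplus y z)"
  by (induction x) auto

lemma bt_oplus_Empty: "bt_oplus x Empty = x"
  by (induction x) auto

lemma nodes_bt_oplus: "nodes (bt_oplus x y) = nodes x + nodes y"
  by (induction x) auto

text \<open>\<open>bt_oplus\<close> hangs \<open>y\<close> below the end of the right spine of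
  \<open>x\<close>. The iteration in \<open>bt_rcomp\<close> therefore takes the same first step
  from the sum as from \<open>y\<close>.\<close>

lemma right_spine_bt_oplus:
  "y \<noteq> Empty \<Longrightarrow> last (right_spine (bt_oplus x y)) = last (right_spine y)"
proof (induction x)
  case (Bin l r)
  have "right_spine (bt_oplus r y) \<noteq> []" using Bin(3) by (cases r; cases y) auto
  with Bin show ?case by simp
qed simp

lemma bt_comp_bt_oplus: "bt_comp (bt_oplus x y) = bt_comp x + bt_comp y"
  unfolding bt_comp_def by (induction x) auto

text \<open>The extra edge joins the two spines; with the \<open>1 +\<close> in \<open>redge\<close>
  it makes \<open>redge\<close> additive.\<close>

lemma right_edges_bt_oplus:
  "x \<noteq> Empty \<Longrightarrow> y \<noteq> Empty \<Longrightarrow> right_edges (bt_oplus x y) = right_edges x + right_edges y + 1"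
proof (induction x)
  case (Bin l r)
  have "bt_oplus r y \<noteq> Empty" using Bin(4) by (cases r; cases y) auto
  with Bin show ?case by (cases "r = Empty") auto
qed simp

lemma right_edges_le: "right_edges x \<le> nodes x - 1"
proof (induction x)
  case (Bin l r)
  then show ?case by (cases r) auto
qed simp

lemma nodes_left_subtree_last: "x \<noteq> Empty \<Longrightarrow> nodes (left_subtree (last (right_spine x))) < nodes x"
proof (induction x)
  case (Bin l r)
  then show ?case by (cases r) auto
qed simp

text \<open>Peeling one step off the \<open>LEAST\<close> requires that some iterate is
  \<open>Empty\<close>; node counts drop strictly until this happens.\<close>

lemma bt_rcomp_rec:
  assumes "x \<noteq> Empty"
  shows "bt_rcomp x = Suc (bt_rcomp (left_subtree (last (right_spine x))))"
proof -
  let ?f = "\<lambda>s. left_subtree (last (right_spine s))"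
  have ex: "\<exists>k. (?f ^^ k) y = Empty" for y
  proof (induction "nodes y" arbitrary: y rule: less_induct)
    case less
    show ?case
    proof (cases "y = Empty")
      case True
      then show ?thesis by (intro exI[of _ 0]) simp
    next
      case False
      with less nodes_left_subtree_last obtain k where "(?f ^^ k) (?f y) = Empty" by blast
      then show ?thesis by (intro exI[of _ "Suc k"]) (simp add: funpow_Suc_right del: funpow.simps)
    qed
  qed
  then obtain k where k: "(?f ^^ k) x = Empty" by blast
  have "bt_rcomp x = Suc (LEAST m. (?f ^^ Suc m) x = Empty)"
    unfolding bt_rcomp_def by (rule Least_Suc[where P = "\<lambda>k. (?f ^^ k) x = Empty", OF k]) (simp add: assms)
  then show ?thesis
    by (simp add: bt_rcomp_def funpow_Suc_right del: funpow.simps)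
qed

lemma bt_rcomp_Empty: "bt_rcomp Empty = 0"
  unfolding bt_rcomp_def by (rule Least_eq_0) simp

interpretation binary_trees: catalan_algebra binary_trees
  by unfold_locales
    (auto simp: binary_trees_def nodes_bt_oplus bt_oplus_assoc bt_oplus_Empty)

lemma canonical_stats_binary_trees:
  "canonical_stats_equal (canonical_bijection plane_trees binary_trees)
     bt_comp bt_rcomp redge ledge"
proof (rule binary_trees.canonical_stats_equalI, goal_cases)
  case (6 x y m n)
  then have *: "y \<noteq> Empty" "bt_oplus x y \<noteq> Empty"
    by (auto simp: binary_trees_def, cases x, auto)
  show ?case
    using bt_rcomp_rec[OF *(1)] bt_rcomp_rec[OF *(2)] right_spine_bt_oplus[OF *(1), of x]
    by (simp add: binary_trees_def)
next
  case (9 x y m n)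
  then have "x \<noteq> Empty" "y \<noteq> Empty" by (auto simp: binary_trees_def)
  then show ?case by (simp add: binary_trees_def redge_def right_edges_bt_oplus)
next
  case (10 x n)
  then show ?case using right_edges_le[of x] by (simp add: redge_def ledge_def binary_trees_def)
qed (simp_all add: binary_trees_def bt_comp_bt_oplus bt_rcomp_rec bt_rcomp_Empty redge_def, simp_all add: bt_comp_def)

section \<open>Two-row standard Young tableaux\<close>

lemma sytD:
  assumes "syt n (u, l)"
  shows "length u = n" "length l = n" "set u \<union> set l = {1..2 * n}"
    "sorted_wrt (<) u" "sorted_wrt (<) l" "\<And>i. i < n \<Longrightarrow> u ! i < l ! i"
  using assms by (auto simp: syt_def)

text \<open>Only the union of the rows is prescribed, but two rows of n distinct entries that fill
  2n values cannot overlap.\<close>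

lemma syt_disjoint:
  assumes "syt n (u, l)"
  shows "set u \<inter> set l = {}"
proof -
  have "card (set u) = n" "card (set l) = n"
    using sytD[OF assms] by (auto simp: distinct_card strict_sorted_iff)
  moreover have "card (set u \<union> set l) = 2 * n" using sytD(3)[OF assms] by simp
  ultimately have "card (set u \<inter> set l) = 0" using card_Un_Int[of "set u" "set l"] by simp
  then show ?thesis by simp
qed

lemma syt_nth_bounds:
  assumes T: "syt n (u, l)" and i: "i < n"
  shows "1 \<le> u ! i" "u ! i < l ! i" "l ! i \<le> 2 * n"
proof -
  note D = sytD[OF T]
  have "u ! i \<in> {1..2 * n}" "l ! i \<in> {1..2 * n}"
    using i D(1,2) unfolding D(3)[symmetric] by simp_all
  then show "1 \<le> u ! i" "u ! i < l ! i" "l ! i \<le> 2 * n" using D(6)[OF i] by simp_all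
qed

lemma syt_upper_nth: "syt n (u, l) \<Longrightarrow> i < n \<Longrightarrow> 1 \<le> u ! i \<and> u ! i < 2 * n"
  using syt_nth_bounds[of n u l i] by simp

lemma syt_lower_nth: "syt n (u, l) \<Longrightarrow> i < n \<Longrightarrow> 1 < l ! i \<and> l ! i \<le> 2 * n"
  using syt_nth_bounds[of n u l i] by simp

lemma syt_upper: "syt n (u, l) \<Longrightarrow> x \<in> set u \<Longrightarrow> 1 \<le> x \<and> x < 2 * n"
  using syt_upper_nth sytD(1) by (metis in_set_conv_nth)

lemma syt_lower: "syt n (u, l) \<Longrightarrow> x \<in> set l \<Longrightarrow> 1 < x \<and> x \<le> 2 * n"
  using syt_lower_nth sytD(2) by (metis in_set_conv_nth)

lemma syt_lam_eq: "syt n (u, l) \<Longrightarrow> syt_lam (u, l) = (1 # map Suc u, map Suc l @ [2 * n + 2])"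
  by (simp add: syt_lam_def sytD)

lemma syt_oplus_eq:
  "syt m (u1, l1) \<Longrightarrow> syt_oplus (u1, l1) (u2, l2) =
    (u1 @ map (\<lambda>x. x + 2 * m) u2, l1 @ map (\<lambda>x. x + 2 * m) l2)"
  by (simp add: syt_oplus_def sytD)

lemma syt_syt_lam:
  assumes T: "syt n (u, l)"
  shows "syt (Suc n) (1 # map Suc u, map Suc l @ [2 * n + 2])"
proof -
  note D = sytD[OF T]
  have "set (1 # map Suc u) \<union> set (map Suc l @ [2 * n + 2]) =
      {1} \<union> Suc ` (set u \<union> set l) \<union> {2 * n + 2}" by auto
  also have "\<dots> = {1..2 * Suc n}" unfolding D(3) by (auto simp: image_Suc_atLeastAtMost)
  finally have "set (1 # map Suc u) \<union> set (map Suc l @ [2 * n + 2]) = {1..2 * Suc n}" .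
  moreover have "sorted_wrt (<) (1 # map Suc u)"
    using D(4) syt_upper[OF T] by (fastforce simp: sorted_wrt_map)
  moreover have "sorted_wrt (<) (map Suc l @ [2 * n + 2])"
    using D(5) syt_lower[OF T] by (fastforce simp: sorted_wrt_append sorted_wrt_map)
  moreover have "(1 # map Suc u) ! i < (map Suc l @ [2 * n + 2]) ! i" if i: "i < Suc n" for i
  proof (cases i)
    case 0
    then show ?thesis using D(2) syt_lower_nth[OF T, of 0] by (cases "n = 0") (simp_all add: nth_append)
  next
    \<comment> \<open>The new column pairs the old upper entry of column \<open>j\<close> with the
      old lower entry of the next column, or with the appended maximum.\<close>
    case (Suc j)
    have "u ! j < l ! i" if "i < n"
    proof -
      have "u ! j < l ! j" using D(6)[of j] that Suc by simp
      also have "l ! j < l ! i" using D(2) that Suc by (intro sorted_wrt_nth_less[OF D(5)]) auto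
      finally show ?thesis .
    qed
    moreover have "u ! j < 2 * n" using syt_upper_nth[OF T, of j] Suc i by simp
    ultimately show ?thesis using Suc i D by (auto simp: nth_append)
  qed
  ultimately show ?thesis using D(1,2) unfolding syt_def by (simp add: insert_commute)
qed

lemma syt_syt_oplus:
  assumes T: "syt m (u1, l1)" and U: "syt n (u2, l2)"
  shows "syt (m + n) (u1 @ map (\<lambda>x. x + 2 * m) u2, l1 @ map (\<lambda>x. x + 2 * m) l2)"
proof -
  note D = sytD[OF T] and E = sytD[OF U]
  have "set (u1 @ map (\<lambda>x. x + 2 * m) u2) \<union> set (l1 @ map (\<lambda>x. x + 2 * m) l2) =
      (set u1 \<union> set l1) \<union> (\<lambda>x. x + 2 * m) ` (set u2 \<union> set l2)" by auto
  also have "\<dots> = {1..2 * (m + n)}"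
    unfolding D(3) E(3) using atLeastAtMost_Un_shift_eq_iff[of "{1..2 * n}" "2 * m" "2 * n"] by simp
  finally have "set (u1 @ map (\<lambda>x. x + 2 * m) u2) \<union> set (l1 @ map (\<lambda>x. x + 2 * m) l2) =
      {1..2 * (m + n)}" .
  moreover have "sorted_wrt (<) (u1 @ map (\<lambda>x. x + 2 * m) u2)"
    using D(4) E(4) syt_upper[OF T] syt_upper[OF U]
    by (fastforce simp: sorted_wrt_append sorted_wrt_map)
  moreover have "sorted_wrt (<) (l1 @ map (\<lambda>x. x + 2 * m) l2)"
    using D(5) E(5) syt_lower[OF T] syt_lower[OF U]
    by (fastforce simp: sorted_wrt_append sorted_wrt_map)
  moreover have "(u1 @ map (\<lambda>x. x + 2 * m) u2) ! i < (l1 @ map (\<lambda>x. x + 2 * m) l2) ! i"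
    if "i < m + n" for i
    using that D E by (auto simp: nth_append)
  ultimately show ?thesis using D(1,2) E(1,2) unfolding syt_def by simp
qed

interpretation tableaux: catalan_algebra tableaux
proof unfold_locales
  fix x n assume "x \<in> graded tableaux n"
  then show "lam tableaux x \<in> graded tableaux (Suc n)"
    using syt_syt_lam by (cases x) (simp add: tableaux_def syt_lam_eq)
next
  fix x y m n assume "x \<in> graded tableaux m" "y \<in> graded tableaux n"
  then show "oplus tableaux x y \<in> graded tableaux (m + n)"
    using syt_syt_oplus by (cases x; cases y) (simp add: tableaux_def syt_oplus_eq)
qed (auto simp: tableaux_def syt_def syt_oplus_def add_ac comp_def)

section \<open>Statistics of tableaux\<close>

text \<open>Lambda moves the upper row one column to the right. If the first \<open>Suc j\<close>
  columns were exactly filled with j < n, they would contain \<open>Suc (l ! j)\<close> and hence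
  the smaller \<open>Suc (u ! j)\<close>, which stands in the next column.\<close>

lemma syt_comp_lam:
  assumes T: "syt n (u, l)"
  shows "syt_comp (1 # map Suc u, map Suc l @ [2 * n + 2]) = 1"
proof -
  note D = sytD[OF T]
  let ?u = "1 # map Suc u" and ?l = "map Suc l @ [2 * n + 2]"
  have "{k \<in> {1..length ?u}. set (take k ?u) \<union> set (take k ?l) = {1..2 * k}} = {Suc n}"
    (is "?L = ?R")
  proof (intro equalityI subsetI)
    fix k assume k: "k \<in> ?L"
    show "k \<in> ?R"
    proof (rule ccontr)
      assume "k \<notin> ?R"
      then obtain j where j: "k = Suc j" "j < n" using k D(1) by (cases k) auto
      have eq: "insert 1 (Suc ` set (take j u)) \<union> Suc ` set (take k l) = {1..2 * k}"
        using k j D by (simp add: take_map)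
      have "l ! j \<in> set (take k l)" using j D(2) by (auto simp: in_set_conv_nth)
      then have "Suc (l ! j) \<le> 2 * k" using eq by force
      then have "Suc (u ! j) \<in> {1..2 * k}" using D(6)[OF j(2)] by simp
      moreover have "u ! j \<in> set u" using j D(1) by simp
      then have "u ! j \<notin> set (take k l)" "1 \<le> u ! j"
        using syt_disjoint[OF T] set_take_subset[of k l] syt_upper[OF T] by auto
      moreover have "u ! j \<notin> set (take j u)"
        using D(1,4) j by (auto simp: in_set_conv_nth strict_sorted_iff nth_eq_iff_index_eq)
      ultimately show False unfolding eq[symmetric] by auto
    qed
  next
    fix k assume "k \<in> ?R"
    then show "k \<in> ?L" using sytD(3)[OF syt_syt_lam[OF T]] D by simp
  qed
  then show ?thesis unfolding syt_comp_def by simp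
qed

lemma syt_comp_oplus:
  assumes T: "syt m (u1, l1)" and U: "syt n (u2, l2)"
  shows "syt_comp (u1 @ map (\<lambda>x. x + 2 * m) u2, l1 @ map (\<lambda>x. x + 2 * m) l2) =
    syt_comp (u1, l1) + syt_comp (u2, l2)"
proof -
  note D = sytD[OF T] and E = sytD[OF U]
  let ?u = "u1 @ map (\<lambda>x. x + 2 * m) u2" and ?l = "l1 @ map (\<lambda>x. x + 2 * m) l2"
  have "{k \<in> {1..m}. set (take k ?u) \<union> set (take k ?l) = {1..2 * k}} =
      {k \<in> {1..m}. set (take k u1) \<union> set (take k l1) = {1..2 * k}}" using D by auto
  moreover have "set (take (m + k) ?u) \<union> set (take (m + k) ?l) = {1..2 * (m + k)} \<longleftrightarrow>
      set (take k u2) \<union> set (take k l2) = {1..2 * k}" for k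
  proof -
    have "set (take (m + k) ?u) \<union> set (take (m + k) ?l) =
        (set u1 \<union> set l1) \<union> (\<lambda>x. x + 2 * m) ` (set (take k u2) \<union> set (take k l2))"
      using D by (auto simp: take_map)
    moreover have "0 \<notin> set (take k u2) \<union> set (take k l2)"
      using syt_upper[OF U, of 0] syt_lower[OF U, of 0] by (auto dest: in_set_takeD)
    ultimately show ?thesis
      using atLeastAtMost_Un_shift_eq_iff[of "set (take k u2) \<union> set (take k l2)" "2 * m" "2 * k"] D(3)
      by (simp add: algebra_simps)
  qed
  ultimately show ?thesis
    using D(1) E(1) by (simp only: syt_comp_def prod.case length_append length_map card_interval_add)
qed

text \<open>The predicate under the \<open>GREATEST\<close> in \<open>syt_rcomp\<close>. It holds at
  0 and is bounded by the length, so the maximum exists.\<close>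

definition terminal_run :: "nat list \<Rightarrow> nat \<Rightarrow> bool" where
  "terminal_run l k \<longleftrightarrow> k \<le> length l \<and> (\<forall>j < k. rev l ! j = 2 * length l - j)"

lemma syt_rcomp_eq: "syt_rcomp (u, l) = (GREATEST k. terminal_run l k)"
  by (simp add: syt_rcomp_def terminal_run_def)

lemma terminal_run_GREATEST:
  "terminal_run l (GREATEST k. terminal_run l k)"
  "terminal_run l k \<Longrightarrow> k \<le> (GREATEST k. terminal_run l k)"
proof -
  have b: "\<And>k. terminal_run l k \<Longrightarrow> k \<le> length l" by (simp add: terminal_run_def)
  have "terminal_run l 0" by (simp add: terminal_run_def)
  then show "terminal_run l (GREATEST k. terminal_run l k)" using b by (rule GreatestI_nat)
  show "k \<le> (GREATEST k. terminal_run l k)" if "terminal_run l k"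
    using that b by (rule Greatest_le_nat)
qed

text \<open>The appended entry starts the run. For the others the increment and the index shift
  cancel: x + 1 = 2(n + 1) - (j + 1) iff x = 2n - j.\<close>

lemma terminal_run_lam:
  "terminal_run (map Suc l @ [2 * length l + 2]) (Suc k) \<longleftrightarrow> terminal_run l k"
proof -
  have "(\<forall>j < Suc k. rev (map Suc l @ [2 * length l + 2]) ! j = 2 * Suc (length l) - j) \<longleftrightarrow>
      (\<forall>j < k. rev l ! j = 2 * length l - j)" if "k \<le> length l"
    unfolding All_less_Suc2 using that by (auto simp: rev_map nth_Cons' Suc_diff_le)
  then show ?thesis unfolding terminal_run_def by auto
qed

lemma syt_rcomp_lam:
  assumes "syt n (u, l)"
  shows "syt_rcomp (u', map Suc l @ [2 * n + 2]) = Suc (syt_rcomp (u, l))"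
  unfolding syt_rcomp_eq sytD(2)[OF assms, symmetric]
proof (rule Greatest_equality)
  fix k assume k: "terminal_run (map Suc l @ [2 * length l + 2]) k"
  show "k \<le> Suc (GREATEST k. terminal_run l k)"
  proof (cases k)
    case (Suc j)
    with k have "terminal_run l j" by (simp only: terminal_run_lam)
    from terminal_run_GREATEST(2)[OF this] Suc show ?thesis by simp
  qed simp
qed (simp only: terminal_run_lam terminal_run_GREATEST)

text \<open>A run longer than \<open>n\<close> would require the value 2(m + n) - n = 2m + n in
  \<open>l1\<close>, whose entries are at most 2m.\<close>

lemma syt_rcomp_oplus:
  assumes T: "syt m (u1, l1)" and U: "syt n (u2, l2)" and n: "n \<ge> 1"
  shows "syt_rcomp (u, l1 @ map (\<lambda>x. x + 2 * m) l2) = syt_rcomp (u2, l2)"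
proof -
  note D = sytD[OF T] and E = sytD[OF U]
  let ?l = "l1 @ map (\<lambda>x. x + 2 * m) l2"
  have "terminal_run ?l k \<longleftrightarrow> terminal_run l2 k" for k
  proof (cases "k \<le> n")
    case True
    then have "rev ?l ! j = 2 * length ?l - j \<longleftrightarrow> rev l2 ! j = 2 * length l2 - j" if "j < k" for j
      using that D(2) E(2) by (auto simp: nth_append rev_map)
    with True D(2) E(2) show ?thesis by (auto simp: terminal_run_def simp del: rev_append)
  next
    case False
    have "\<not> terminal_run ?l k"
    proof
      assume t: "terminal_run ?l k"
      then have k: "k \<le> m + n" "rev ?l ! n = 2 * (m + n) - n"
        using False D(2) E(2) by (auto simp: terminal_run_def simp del: rev_append)
      then have m: "m \<noteq> 0" using False by auto
      then have "rev ?l ! n = rev l1 ! 0" using D(2) E(2) by (simp add: nth_append)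
      moreover have "rev l1 ! 0 \<in> set l1" using m D(2) nth_mem[of 0 "rev l1"] by simp
      ultimately show False using k(2) syt_lower[OF T, of "rev l1 ! 0"] n by simp
    qed
    moreover have "\<not> terminal_run l2 k" using False E(2) by (simp add: terminal_run_def)
    ultimately show ?thesis by blast
  qed
  then show ?thesis by (simp add: syt_rcomp_eq)
qed

text \<open>The old 1 is in the top row and the old maximum in the bottom row, so neither the new 1
  nor the new maximum forms a counted pair. Over the empty tableau the two new entries form one with
  each other.\<close>

lemma noncons_lam:
  assumes T: "syt (Suc n) (u, l)"
  shows "noncons (1 # map Suc u, map Suc l @ [2 * Suc n + 2]) = noncons (u, l)"
proof -
  have "{i \<in> set (1 # map Suc u). i + 1 \<in> set (map Suc l @ [2 * Suc n + 2])} =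
      Suc ` {i \<in> set u. i + 1 \<in> set l}"
    using syt_upper[OF T] syt_lower[OF T] by fastforce
  then show ?thesis by (simp only: noncons_def prod.case) (simp add: card_image)
qed

lemma noncons_oplus:
  assumes T: "syt m (u1, l1)" and U: "syt n (u2, l2)"
  shows "noncons (u1 @ map (\<lambda>x. x + 2 * m) u2, l1 @ map (\<lambda>x. x + 2 * m) l2) =
    noncons (u1, l1) + noncons (u2, l2)"
proof -
  let ?A = "{i \<in> set u1. i + 1 \<in> set l1}" and ?B = "{i \<in> set u2. i + 1 \<in> set l2}"
  have "{i \<in> set (u1 @ map (\<lambda>x. x + 2 * m) u2). i + 1 \<in> set (l1 @ map (\<lambda>x. x + 2 * m) l2)} =
      ?A \<union> (\<lambda>x. x + 2 * m) ` ?B"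
    using syt_upper[OF T] syt_lower[OF T] syt_upper[OF U] syt_lower[OF U] by fastforce
  moreover have "?A \<inter> (\<lambda>x. x + 2 * m) ` ?B = {}"
    using syt_upper[OF T] by fastforce
  ultimately show ?thesis
    by (simp only: noncons_def prod.case) (subst card_Un_disjoint, auto simp: card_image)
qed

text \<open>A top entry is below 2n, so its successor occurs in exactly one row.\<close>

lemma noncons_plus_cons:
  assumes T: "syt n (u, l)"
  shows "noncons (u, l) + cons (u, l) = n + 1"
proof -
  let ?A = "{i \<in> set u. i + 1 \<in> set l}" and ?B = "{i \<in> set u. i + 1 \<in> set u}"
  note D = sytD[OF T]
  have "?A \<union> ?B = set u"
  proof (intro equalityI subsetI)
    fix i assume i: "i \<in> set u"
    then have "i + 1 \<in> {1..2 * n}" using syt_upper[OF T i] by simp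
    with i show "i \<in> ?A \<union> ?B" unfolding D(3)[symmetric] by blast
  qed auto
  moreover have "?A \<inter> ?B = {}" using syt_disjoint[OF T] by auto
  moreover have "card (set u) = n" using D by (auto simp: distinct_card strict_sorted_iff)
  ultimately show ?thesis
    using card_Un_disjoint[of ?A ?B] by (simp add: noncons_def cons_def)
qed

lemma canonical_stats_tableaux:
  "canonical_stats_equal (canonical_bijection plane_trees tableaux) syt_comp syt_rcomp noncons cons"
proof -
  have ops: "neutral tableaux = ([], [])" "lam tableaux = syt_lam" "oplus tableaux = syt_oplus"
    "x \<in> graded tableaux n \<longleftrightarrow> syt n x" for x n
    by (simp_all add: tableaux_def)
  show ?thesis
  proof (rule tableaux.canonical_stats_equalI, unfold ops, goal_cases)
    case 1
    show ?case by (simp add: syt_comp_def)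
  next
    case (2 x n)
    then show ?case by (cases x) (simp only: syt_lam_eq syt_comp_lam)
  next
    case (3 x y m n)
    then show ?case by (cases x; cases y) (simp only: syt_oplus_eq syt_comp_oplus)
  next
    case 4
    show ?case using terminal_run_GREATEST(1)[of "[]"] by (simp add: syt_rcomp_eq terminal_run_def)
  next
    case (5 x n)
    then show ?case by (cases x) (simp only: syt_lam_eq syt_rcomp_lam)
  next
    case (6 x y m n)
    then show ?case by (cases x; cases y) (simp add: syt_oplus_eq syt_rcomp_oplus del: mult_Suc_right)
  next
    case 7
    have "{i. i = 1 \<and> i + 1 = 2} = {1::nat}" by auto
    then show ?case by (simp add: syt_lam_def noncons_def)
  next
    case (8 x n)
    then show ?case by (cases x) (simp only: syt_lam_eq noncons_lam)
  next
    case (9 x y m n)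
    then show ?case by (cases x; cases y) (simp only: syt_oplus_eq noncons_oplus)
  next
    case (10 x n)
    then show ?case using noncons_plus_cons by (cases x) simp
  qed
qed

section \<open>Non-crossing partitions\<close>

abbreviation shift :: "nat \<Rightarrow> nat set \<Rightarrow> nat set" where
  "shift m X \<equiv> (\<lambda>x. x + m) ` X"

definition ncp :: "nat \<Rightarrow> nat set set \<Rightarrow> bool" where
  "ncp n P \<longleftrightarrow> partition_on {1..n} P \<and> noncrossing P"

lemma ncpD:
  assumes "ncp n P"
  shows "\<Union>P = {1..n}" "disjoint P" "{} \<notin> P" "noncrossing P" "finite P"
    and "\<And>X. X \<in> P \<Longrightarrow> finite X \<and> X \<noteq> {}"
    and "\<And>X x. X \<in> P \<Longrightarrow> x \<in> X \<Longrightarrow> 1 \<le> x \<and> x \<le> n"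
proof -
  show *: "\<Union>P = {1..n}" "disjoint P" "{} \<notin> P" "noncrossing P"
    using assms by (auto simp: ncp_def partition_on_def)
  show "finite P" using *(1) by (simp add: finite_UnionD)
  show "1 \<le> x \<and> x \<le> n" if "X \<in> P" "x \<in> X" for X x
    using that *(1) by force
  show "finite X \<and> X \<noteq> {}" if "X \<in> P" for X
    using that * by (metis Sup_upper finite_atLeastAtMost finite_subset)
qed

lemma ncp_block_unique: "ncp n P \<Longrightarrow> X \<in> P \<Longrightarrow> Y \<in> P \<Longrightarrow> x \<in> X \<Longrightarrow> x \<in> Y \<Longrightarrow> X = Y"
  using disjointD[OF ncpD(2), of n P X Y] by blast

text \<open>Turns the conditional image in \<open>ncp_lam\<close> into the enlargement of one
  isolated block.\<close>

lemma ncp_first_block: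
  assumes P: "ncp (Suc n) P"
  obtains X P' where "P = insert X P'" "X \<notin> P'" "1 \<in> X" "\<And>Y. Y \<in> P' \<Longrightarrow> 1 \<notin> Y"
    "ncp_lam P = insert (insert (Suc n + 1) X) P'"
proof -
  have "1 \<in> \<Union>P" using ncpD(1)[OF P] by simp
  then obtain X where X: "X \<in> P" "1 \<in> X" by blast
  define P' where "P' = P - {X}"
  have 1: "1 \<notin> Y" if "Y \<in> P'" for Y
    using that X ncp_block_unique[OF P, of X Y 1] by (auto simp: P'_def)
  have "ncp_lam P = (\<lambda>X. if 1 \<in> X then insert (Suc n + 1) X else X) ` insert X P'"
    using X ncpD(1)[OF P] by (auto simp: ncp_lam_def P'_def insert_absorb)
  also have "\<dots> = insert (insert (Suc n + 1) X) P'"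
    using X 1 by auto
  finally show ?thesis
    using that[of X P'] X 1 by (auto simp: P'_def)
qed

lemma ncp_0: "ncp 0 P \<longleftrightarrow> P = {}"
proof
  assume "ncp 0 P"
  then show "P = {}" using ncpD(1,3)[of 0 P] by (metis Sup_bot_conv(1) all_not_in_conv atLeastatMost_empty less_one)
qed (simp add: ncp_def partition_on_def noncrossing_def)

lemma noncrossingD:
  assumes "noncrossing P" "X \<in> P" "Y \<in> P" "X \<noteq> Y" "a < b" "b < c" "c < d"
    "a \<in> X" "c \<in> X" "b \<in> Y" "d \<in> Y"
  shows False
proof -
  have "\<exists>a b c d. a < b \<and> b < c \<and> c < d \<and> a \<in> X \<and> c \<in> X \<and> b \<in> Y \<and> d \<in> Y"
    by (intro exI[of _ a] exI[of _ b] exI[of _ c] exI[of _ d] conjI assms)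
  then have "\<exists>X \<in> P. \<exists>Y \<in> P. X \<noteq> Y \<and>
      (\<exists>a b c d. a < b \<and> b < c \<and> c < d \<and> a \<in> X \<and> c \<in> X \<and> b \<in> Y \<and> d \<in> Y)"
    by (intro bexI[of _ X] bexI[of _ Y] conjI assms)
  with assms(1) show False unfolding noncrossing_def by (rule notE)
qed

lemma ncp_lam_Empty: "ncp_lam {} = {{1}}"
  by (simp add: ncp_lam_def)

lemma ncp_ncp_lam:
  assumes P: "ncp n P"
  shows "ncp (Suc n) (ncp_lam P)"
proof (cases n)
  case 0
  with P have "ncp_lam P = {{1}}" by (simp add: ncp_0 ncp_lam_Empty)
  moreover have "noncrossing {{1}}"
    unfolding noncrossing_def by blast
  ultimately show ?thesis using 0 by (simp add: ncp_def partition_on_def)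
next
  case (Suc m)
  note D = ncpD[OF P]
  from P Suc obtain X P' where X: "P = insert X P'" "X \<notin> P'" "1 \<in> X" "\<And>Y. Y \<in> P' \<Longrightarrow> 1 \<notin> Y"
    "ncp_lam P = insert (insert (n + 1) X) P'"
    using ncp_first_block[of m P] by metis
  have le: "x \<le> n" if "Y \<in> P" "x \<in> Y" for x Y using D(7) that by blast
  have dj: "X \<inter> Y = {}" if "Y \<in> P'" for Y
    using that X(1,2) by (intro disjointD[OF D(2)]) auto
  have dj': "insert (n + 1) X \<inter> Y = {}" if "Y \<in> P'" for Y
    using dj[OF that] le[of Y "n + 1"] that X(1) by auto
  have "disjoint P'" using D(2) X(1) by (auto simp: disjoint_def)
  then have "disjoint (insert (insert (n + 1) X) P')"
    using dj' by (simp add: pairwise_insert disjnt_def Int_commute)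
  moreover have "\<Union>(insert (insert (n + 1) X) P') = {1..Suc n}"
    using D(1) X(1) by (auto simp: atLeastAtMostSuc_conv)
  moreover have "{} \<notin> insert (insert (n + 1) X) P'" using D(3) X(1) by auto
  moreover have "noncrossing (insert (insert (n + 1) X) P')"
    unfolding noncrossing_def
  proof (intro notI, elim bexE exE conjE)
    fix Y Z a b c d
    assume Y: "Y \<in> insert (insert (n + 1) X) P'" and Z: "Z \<in> insert (insert (n + 1) X) P'"
      and *: "Y \<noteq> Z" "a < b" "b < c" "c < d" "a \<in> Y" "c \<in> Y" "b \<in> Z" "d \<in> Z"
    consider "Y \<in> P'" "Z \<in> P'" | "Y = insert (n + 1) X" "Z \<in> P'" | "Y \<in> P'" "Z = insert (n + 1) X"
      using Y Z *(1) by blast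
    then show False
    proof cases
      case 1
      with * X(1) show False using noncrossingD[OF D(4), of Y Z a b c d] by blast
    next
      case 2
      then have "d \<le> n" using le[of Z d] * X(1) by blast
      then have "a \<in> X" "c \<in> X" using 2 * by auto
      moreover have "X \<noteq> Z" using 2 X(2) by blast
      ultimately show False using noncrossingD[OF D(4), of X Z a b c d] * 2 X(1) by blast
    next
      \<comment> \<open>\<open>d\<close> may be the new \<open>n + 1\<close>, so it is discarded and
        1, which lies in the same block, is used instead: 1 < a < b < c is a crossing already
        present in \<open>P\<close>.\<close>
      case 3
      then have "c \<le> n" "1 \<le> a" "a \<noteq> 1" using le[of Y c] D(7)[of Y a] X(1,4) * by auto
      then have "b \<in> X" "1 < a" using 3 * by auto
      moreover have "X \<noteq> Y" using 3 X(2) by blast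
      ultimately show False
        using noncrossingD[OF D(4), of X Y 1 a b c] * 3 X(1,3) by blast
    qed
  qed
  ultimately show ?thesis unfolding X(5) ncp_def partition_on_def by blast
qed

lemma ncp_oplus_eq: "ncp m P \<Longrightarrow> ncp_oplus P Q = P \<union> shift m ` Q"
  by (simp add: ncp_oplus_def ncpD)

lemma inj_shift: "inj (shift m)"
  by (simp add: inj_image_eq_iff inj_def)

lemma ncp_ncp_oplus:
  assumes P: "ncp m P" and Q: "ncp n Q"
  shows "ncp (m + n) (P \<union> shift m ` Q)"
proof -
  note D = ncpD[OF P] and E = ncpD[OF Q]
  have low: "x \<le> m" if "X \<in> P" "x \<in> X" for X x using D(7) that by blast
  have high: "m < x" if "Y \<in> shift m ` Q" "x \<in> Y" for Y x
    using that E(7) by fastforce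
  have "\<Union>(P \<union> shift m ` Q) = {1..m} \<union> shift m (\<Union>Q)" using D(1) by auto
  also have "\<dots> = {1..m + n}"
    using atLeastAtMost_Un_shift_eq_iff[of "\<Union>Q" m n] E(1) by simp
  finally have union: "\<Union>(P \<union> shift m ` Q) = {1..m + n}" .
  have dj_Q: "disjoint (shift m ` Q)"
  proof (rule disjointI)
    fix A B assume "A \<in> shift m ` Q" "B \<in> shift m ` Q" "A \<noteq> B"
    then obtain X Y where XY: "A = shift m X" "B = shift m Y" "X \<in> Q" "Y \<in> Q" "X \<noteq> Y" by blast
    then have "X \<inter> Y = {}" using disjointD[OF E(2)] by blast
    then show "A \<inter> B = {}" unfolding XY(1,2) by auto
  qed
  have "X \<inter> Y = {}" if "X \<in> P" "Y \<in> shift m ` Q" for X Y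
    using low[OF that(1)] high[OF that(2)] by (meson disjoint_iff not_less)
  then have "disjoint (P \<union> shift m ` Q)"
    by (intro disjoint_union D(2) dj_Q) (simp only: Int_Union2 Union_disjoint, blast)
  moreover have "{} \<notin> P \<union> shift m ` Q" using D(3) E(3) by auto
  moreover have "noncrossing (P \<union> shift m ` Q)"
    unfolding noncrossing_def
  proof (intro notI, elim bexE exE conjE)
    fix Y Z a b c d
    assume Y: "Y \<in> P \<union> shift m ` Q" and Z: "Z \<in> P \<union> shift m ` Q"
      and *: "Y \<noteq> Z" "a < b" "b < c" "c < d" "a \<in> Y" "c \<in> Y" "b \<in> Z" "d \<in> Z"
    consider "Y \<in> P" "Z \<in> P" | "Y \<in> shift m ` Q" "Z \<in> shift m ` Q"
      | "Y \<in> P" "Z \<in> shift m ` Q" | "Y \<in> shift m ` Q" "Z \<in> P"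
      using Y Z by blast
    then show False
    proof cases
      case 1
      with * show False using noncrossingD[OF D(4), of Y Z a b c d] by blast
    next
      case 2
      then obtain Y' Z' where YZ: "Y = shift m Y'" "Z = shift m Z'" "Y' \<in> Q" "Z' \<in> Q" by blast
      with * obtain a' b' c' d' where "a = a' + m" "b = b' + m" "c = c' + m" "d = d' + m"
        "a' \<in> Y'" "c' \<in> Y'" "b' \<in> Z'" "d' \<in> Z'" by blast
      with YZ * show False using noncrossingD[OF E(4), of Y' Z' a' b' c' d'] by auto
    next
      case 3
      with * low[of Y c] high[of Z b] show False by linarith
    next
      case 4
      with * low[of Z b] high[of Y a] show False by linarith
    qed
  qed
  ultimately show ?thesis using union unfolding ncp_def partition_on_def by blast
qed

interpretation noncrossing_partitions: catalan_algebra noncrossing_partitions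
proof unfold_locales
  fix x n assume "x \<in> graded noncrossing_partitions n"
  then show "lam noncrossing_partitions x \<in> graded noncrossing_partitions (Suc n)"
    using ncp_ncp_lam[of n x] by (simp add: noncrossing_partitions_def ncp_def)
next
  fix x y m n
  assume "x \<in> graded noncrossing_partitions m" "y \<in> graded noncrossing_partitions n"
  then show "oplus noncrossing_partitions x y \<in> graded noncrossing_partitions (m + n)"
    using ncp_ncp_oplus[of m x n y] ncp_oplus_eq[of m x y]
    by (simp add: noncrossing_partitions_def ncp_def)
next
  fix x y z l m n
  assume "x \<in> graded noncrossing_partitions l" "y \<in> graded noncrossing_partitions m"
    "z \<in> graded noncrossing_partitions n"
  then have *: "ncp l x" "ncp m y" by (simp_all add: noncrossing_partitions_def ncp_def)
  have "shift (l + m) X = shift l (shift m X)" for X by (simp add: image_image add_ac)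
  then show "oplus noncrossing_partitions (oplus noncrossing_partitions x y) z =
      oplus noncrossing_partitions x (oplus noncrossing_partitions y z)"
    using * ncp_ncp_oplus[OF *]
    by (simp add: noncrossing_partitions_def ncp_oplus_eq image_Un image_image Un_assoc)
qed (auto simp: noncrossing_partitions_def ncp_oplus_def partition_on_def noncrossing_def)

section \<open>Components of partitions\<close>

lemma ncp_comp_eq: "ncp n P \<Longrightarrow> ncp_comp P = card {k \<in> {1..n}. \<exists>Q \<subseteq> P. \<Union>Q = {1..k}}"
  by (simp add: ncp_comp_def ncpD)

text \<open>The block of 1 also contains the largest element, so a union of blocks that contains 1
  reaches to the end.\<close>

lemma ncp_comp_lam:
  assumes P: "ncp n P"
  shows "ncp_comp (ncp_lam P) = 1"
proof -
  have last: "Suc n \<in> X" if "X \<in> ncp_lam P" "1 \<in> X" for X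
  proof (cases n)
    case 0
    with P that show ?thesis by (simp add: ncp_0 ncp_lam_Empty)
  next
    case (Suc m)
    with P show ?thesis using ncp_first_block[of m P] that by (metis Suc_eq_plus1 insertE insertI1)
  qed
  note D = ncpD[OF ncp_ncp_lam[OF P]]
  have "{k \<in> {1..Suc n}. \<exists>Q \<subseteq> ncp_lam P. \<Union>Q = {1..k}} = {Suc n}" (is "?L = ?R")
  proof (intro equalityI subsetI)
    fix k assume "k \<in> ?L"
    then obtain Q where Q: "k \<in> {1..Suc n}" "Q \<subseteq> ncp_lam P" "\<Union>Q = {1..k}" by blast
    then have "1 \<in> \<Union>Q" by simp
    then have "Suc n \<in> \<Union>Q" using last Q(2) by blast
    with Q show "k \<in> ?R" by simp
  next
    fix k assume "k \<in> ?R"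
    then show "k \<in> ?L" using D(1) by auto
  qed
  then show ?thesis unfolding ncp_comp_eq[OF ncp_ncp_lam[OF P]] by simp
qed

lemma ncp_comp_oplus:
  assumes P: "ncp m P" and Q: "ncp n Q"
  shows "ncp_comp (P \<union> shift m ` Q) = ncp_comp P + ncp_comp Q"
proof -
  note D = ncpD[OF P] and E = ncpD[OF Q]
  have high: "m < x" if "Y \<in> shift m ` Q" "x \<in> Y" for Y x
    using that E(7) by fastforce
  have "(\<exists>R \<subseteq> P \<union> shift m ` Q. \<Union>R = {1..k}) \<longleftrightarrow> (\<exists>R \<subseteq> P. \<Union>R = {1..k})" if k: "k \<le> m" for k
  proof
    assume "\<exists>R \<subseteq> P \<union> shift m ` Q. \<Union>R = {1..k}"
    then obtain R where R: "R \<subseteq> P \<union> shift m ` Q" "\<Union>R = {1..k}" by blast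
    have not_Q: "X \<notin> shift m ` Q" if "X \<in> R" for X
    proof
      assume X: "X \<in> shift m ` Q"
      then have "X \<noteq> {}" using E(3) by auto
      then obtain x where "x \<in> X" by blast
      moreover from this that R(2) have "x \<le> k" by auto
      ultimately show False using high[OF X] k by fastforce
    qed
    with R(1) have "R \<subseteq> P" by blast
    with R(2) show "\<exists>R \<subseteq> P. \<Union>R = {1..k}" by blast
  next
    assume "\<exists>R \<subseteq> P. \<Union>R = {1..k}"
    then obtain R where "R \<subseteq> P" "\<Union>R = {1..k}" by blast
    then show "\<exists>R \<subseteq> P \<union> shift m ` Q. \<Union>R = {1..k}" by (intro exI[of _ R]) auto
  qed
  moreover have "(\<exists>R \<subseteq> P \<union> shift m ` Q. \<Union>R = {1..m + k}) \<longleftrightarrow> (\<exists>R \<subseteq> Q. \<Union>R = {1..k})" for k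
  proof
    assume "\<exists>R \<subseteq> P \<union> shift m ` Q. \<Union>R = {1..m + k}"
    then obtain R where R: "R \<subseteq> P \<union> shift m ` Q" "\<Union>R = {1..m + k}" by blast
    define S where "S = {X \<in> Q. shift m X \<in> R}"
    \<comment> \<open>Adding \<open>{1..m}\<close> to both sides hides which blocks of
      \<open>P\<close> occur in \<open>R\<close>, so that only the shifted blocks remain to be
      compared.\<close>
    have "{1..m} \<union> shift m (\<Union>S) = {1..m} \<union> \<Union>R"
    proof (intro equalityI subsetI)
      fix x assume "x \<in> {1..m} \<union> \<Union>R"
      then consider "x \<in> {1..m}" | X where "X \<in> R" "x \<in> X" by blast
      then show "x \<in> {1..m} \<union> shift m (\<Union>S)"
      proof cases
        case (2 X)
        with R(1) consider "X \<in> P" | Y where "Y \<in> Q" "X = shift m Y" by blast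
        then show ?thesis
        proof cases
          case 1
          with 2 D(1) show ?thesis by blast
        next
          case (2 Y)
          with \<open>X \<in> R\<close> \<open>x \<in> X\<close> show ?thesis by (auto simp: S_def)
        qed
      qed blast
    qed (auto simp: S_def)
    also have "\<dots> = {1..m + k}" using R(2) by auto
    finally have "\<Union>S = {1..k}"
      using E(7) by (subst (asm) atLeastAtMost_Un_shift_eq_iff) (force simp: S_def)+
    moreover have "S \<subseteq> Q" by (auto simp: S_def)
    ultimately show "\<exists>R \<subseteq> Q. \<Union>R = {1..k}" by blast
  next
    assume "\<exists>R \<subseteq> Q. \<Union>R = {1..k}"
    then obtain S where S: "S \<subseteq> Q" "\<Union>S = {1..k}" by blast
    have "\<Union>(P \<union> shift m ` S) = {1..m} \<union> shift m (\<Union>S)" using D(1) by auto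
    also have "\<dots> = {1..m + k}"
      using atLeastAtMost_Un_shift_eq_iff[of "\<Union>S" m k] S(2) by simp
    finally show "\<exists>R \<subseteq> P \<union> shift m ` Q. \<Union>R = {1..m + k}"
      using S(1) by (intro exI[of _ "P \<union> shift m ` S"]) blast
  qed
  ultimately show ?thesis
    unfolding ncp_comp_eq[OF P] ncp_comp_eq[OF Q] ncp_comp_eq[OF ncp_ncp_oplus[OF P Q]]
      card_interval_add
    by (intro arg_cong2[where f = "(+)"] arg_cong[where f = card] Collect_cong conj_cong refl) auto
qed

section \<open>Block minima and the flattened word\<close>

lemma ncp_inj_on_Min:
  assumes "ncp n P"
  shows "inj_on Min P"
proof (rule inj_onI)
  fix X Y assume "X \<in> P" "Y \<in> P" "Min X = Min Y"
  then show "X = Y"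
    using ncp_block_unique[OF assms, of X Y "Min X"] ncpD(6)[OF assms] Min_in by metis
qed

lemma card_blocks_le:
  assumes "ncp n P"
  shows "card P \<le> n"
proof -
  have "Min ` P \<subseteq> {1..n}" using ncpD(6,7)[OF assms] Min_in by (metis atLeastAtMost_iff image_subsetI)
  then have "card (Min ` P) \<le> card {1..n}" by (rule card_mono[rotated]) simp
  then show ?thesis by (simp add: card_image ncp_inj_on_Min[OF assms])
qed

text \<open>\<open>Min\<close> is injective only on the blocks of a given partition, so the sorting
  locale is instantiated on that set. The last clause lets a sorted list be exhibited rather than
  computed.\<close>

lemma (in linorder) sorted_key_list_of_set_inj_on:
  assumes "inj_on f A" "finite A"
  shows "set (sorted_key_list_of_set f A) = A"
    "sorted_wrt (<) (map f (sorted_key_list_of_set f A))"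
    "set l = A \<Longrightarrow> sorted_wrt (<) (map f l) \<Longrightarrow> sorted_key_list_of_set f A = l"
proof -
  interpret key: folding_insort_key "(\<le>)" "(<)" A f
    by unfold_locales (rule assms)
  show "set (sorted_key_list_of_set f A) = A" using assms(2) by simp
  show "sorted_wrt (<) (map f (sorted_key_list_of_set f A))" by simp
  show "sorted_key_list_of_set f A = l" if "set l = A" "sorted_wrt (<) (map f l)"
  proof -
    have "distinct l" using that(2) by (auto simp: strict_sorted_iff distinct_map)
    with that show ?thesis
      using key.sorted_key_list_of_set_unique[of A l] assms(2) by (auto simp: distinct_card)
  qed
qed

lemma sorted_blocks:
  assumes P: "ncp n P"
  shows "set (sorted_key_list_of_set Min P) = P"
    "sorted_wrt (<) (map Min (sorted_key_list_of_set Min P))"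
    "set l = P \<Longrightarrow> sorted_wrt (<) (map Min l) \<Longrightarrow> sorted_key_list_of_set Min P = l"
  using sorted_key_list_of_set_inj_on[OF ncp_inj_on_Min[OF P] ncpD(5)[OF P]] by blast+

lemma set_flattened:
  assumes P: "ncp n P"
  shows "set (flattened P) = {1..n}"
  using sorted_blocks(1)[OF P] ncpD(1,6)[OF P] by (auto simp: flattened_def)

lemma sorted_list_of_set_insert_max:
  assumes "finite X" "\<And>x. x \<in> X \<Longrightarrow> x < (m::nat)"
  shows "sorted_list_of_set (insert m X) = sorted_list_of_set X @ [m]"
proof -
  have "m \<notin> X" using assms(2) by blast
  with assms show ?thesis
    by (intro sorted_list_of_set_unique[THEN iffD1]) (auto simp: sorted_wrt_append)
qed

lemma sorted_list_of_set_shift: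
  assumes "finite X"
  shows "sorted_list_of_set (shift m X) = map (\<lambda>x. x + m) (sorted_list_of_set X)"
  using assms by (intro sorted_list_of_set_unique[THEN iffD1])
    (auto simp: sorted_wrt_map card_image)

text \<open>The block of 1 is listed first because of its minimum, and in decreasing order, so its
  new largest element opens the word, as with lambda on 231-avoiding permutations.\<close>

lemma flattened_lam:
  assumes P: "ncp (Suc n) P"
  shows "flattened (ncp_lam P) = (Suc n + 1) # flattened P"
proof -
  note D = ncpD[OF P]
  obtain X P' where X: "P = insert X P'" "X \<notin> P'" "1 \<in> X" "\<And>Y. Y \<in> P' \<Longrightarrow> 1 \<notin> Y"
    "ncp_lam P = insert (insert (Suc n + 1) X) P'"
    using ncp_first_block[OF P] by metis
  let ?L = "sorted_key_list_of_set Min P"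
  have fin: "finite X" using D(6) X(1) by blast
  have "1 \<le> x" if "x \<in> X" for x using D(7) that X(1) by blast
  then have Min_X: "Min X = 1" "Min (insert (Suc n + 1) X) = 1"
    using X(3) fin by (auto intro!: Min_eqI)
  have Min_P': "1 < Min Y" if "Y \<in> P'" for Y
  proof -
    have "Min Y \<in> Y" using D(6)[of Y] that X(1) by (intro Min_in) auto
    then have "1 \<le> Min Y" "Min Y \<noteq> 1" using D(7)[of Y "Min Y"] X(1,4) that by auto
    then show ?thesis by simp
  qed
  obtain l where l: "?L = X # l"
  proof (cases ?L)
    case Nil
    then show ?thesis using sorted_blocks(1)[OF P] X(1) by auto
  next
    case (Cons Z l)
    have "Z = X"
    proof (rule ccontr)
      assume "Z \<noteq> X"
      then have "Z \<in> P'" "X \<in> set l" using sorted_blocks(1)[OF P] Cons X(1) by auto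
      then have "Min Z < Min X" using sorted_blocks(2)[OF P] Cons by simp
      with Min_P'[OF \<open>Z \<in> P'\<close>] Min_X show False by simp
    qed
    with Cons that show ?thesis by simp
  qed
  have "X \<notin> set l" using sorted_blocks(2)[OF P] l by auto
  then have set_l: "set l = P'" using sorted_blocks(1)[OF P] l X(1,2) by auto
  have "sorted_key_list_of_set Min (ncp_lam P) = insert (Suc n + 1) X # l"
    using sorted_blocks(2)[OF P] l set_l Min_P' Min_X
    by (intro sorted_blocks(3)[OF ncp_ncp_lam[OF P]]) (simp_all add: X(5))
  moreover have "sorted_list_of_set (insert (Suc n + 1) X) = sorted_list_of_set X @ [Suc n + 1]"
    using D(7)[of X] X(1) fin by (intro sorted_list_of_set_insert_max) (auto simp: less_Suc_eq_le)
  ultimately show ?thesis by (simp add: flattened_def l)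
qed

text \<open>All block minima of \<open>P\<close> are at most \<open>m\<close>, those of the shifted
  blocks are larger, so the sorted block lists simply concatenate.\<close>

lemma flattened_oplus:
  assumes P: "ncp m P" and Q: "ncp n Q"
  shows "flattened (P \<union> shift m ` Q) = flattened P @ map (\<lambda>x. x + m) (flattened Q)"
proof -
  note D = ncpD[OF P] and E = ncpD[OF Q]
  let ?K = "sorted_key_list_of_set Min P" and ?L = "sorted_key_list_of_set Min Q"
  have Min_shift: "Min (shift m X) = Min X + m" if "X \<in> Q" for X
    using E(6)[OF that] by (intro mono_Min_commute[symmetric]) (simp_all add: mono_def)
  have "Min X < Min (shift m Y)" if "X \<in> P" "Y \<in> Q" for X Y
  proof -
    have "Min X \<in> X" "Min Y \<in> Y" using D(6)[OF that(1)] E(6)[OF that(2)] by (auto intro: Min_in)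
    then have "Min X \<le> m" "1 \<le> Min Y" using D(7)[OF that(1)] E(7)[OF that(2)] by blast+
    then show ?thesis using Min_shift[OF that(2)] by simp
  qed
  moreover have "map Min (map (shift m) ?L) = map (\<lambda>x. x + m) (map Min ?L)"
    using sorted_blocks(1)[OF Q] Min_shift by simp
  then have "sorted_wrt (<) (map Min (map (shift m) ?L))"
    using sorted_blocks(2)[OF Q] by (simp only: sorted_wrt_map) simp
  ultimately have "sorted_key_list_of_set Min (P \<union> shift m ` Q) = ?K @ map (shift m) ?L"
    using sorted_blocks(1,2)[OF P] sorted_blocks(1)[OF Q]
    by (intro sorted_blocks(3)[OF ncp_ncp_oplus[OF P Q]]) (simp_all add: sorted_wrt_append)
  moreover have "map (\<lambda>X. rev (sorted_list_of_set (shift m X))) ?L =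
      map (\<lambda>X. map (\<lambda>x. x + m) (rev (sorted_list_of_set X))) ?L"
    using sorted_blocks(1)[OF Q] E(6) by (simp add: sorted_list_of_set_shift rev_map)
  ultimately show ?thesis
    by (simp add: flattened_def comp_def map_concat del: map_eq_conv)
qed

lemma canonical_stats_noncrossing_partitions:
  "canonical_stats_equal (canonical_bijection plane_trees noncrossing_partitions)
     ncp_comp ncp_rcomp blocks nonmin"
proof -
  have ops: "neutral noncrossing_partitions = {}" "lam noncrossing_partitions = ncp_lam"
    "oplus noncrossing_partitions = ncp_oplus"
    "x \<in> graded noncrossing_partitions n \<longleftrightarrow> ncp n x" for x n
    by (simp_all add: noncrossing_partitions_def ncp_def)
  have flattened_Empty: "flattened {} = []"
    using set_flattened[of 0 "{}"] by (simp add: ncp_0)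
  show ?thesis
  proof (rule noncrossing_partitions.canonical_stats_equalI, unfold ops, goal_cases)
    case 1
    show ?case by (simp add: ncp_comp_def)
  next
    case (2 x n)
    then show ?case by (rule ncp_comp_lam)
  next
    case (3 x y m n)
    then show ?case by (simp only: ncp_oplus_eq ncp_comp_oplus)
  next
    case 4
    show ?case by (simp add: ncp_rcomp_def flattened_Empty rmax_def rl_max_def)
  next
    case (5 x n)
    have "flattened (ncp_lam x) = (n + 1) # flattened x"
    proof (cases n)
      \<comment> \<open>Lambda(e) creates the block \<open>{1}\<close> instead of enlarging one, so
        \<open>flattened_lam\<close> does not apply.\<close>
      case 0
      have "sorted_key_list_of_set Min {{1}} = [{1::nat}]"
        using sorted_blocks(3)[OF ncp_ncp_lam, of 0 "{}" "[{1}]"] by (simp add: ncp_0 ncp_lam_Empty)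
      with 0 5 show ?thesis by (simp add: ncp_0 ncp_lam_Empty flattened_Empty) (simp add: flattened_def)
    next
      case (Suc k)
      with 5 flattened_lam[of k x] show ?thesis by simp
    qed
    moreover have "rmax ((n + 1) # flattened x) = Suc (rmax (flattened x))"
      using set_flattened[OF 5] by (intro rmax_Cons) auto
    ultimately show ?case by (simp add: ncp_rcomp_def)
  next
    case (6 x y m n)
    have "rmax (flattened x @ map (\<lambda>z. z + Suc m) (flattened y)) = rmax (flattened y)"
    proof (rule rmax_append_shift)
      show "flattened y \<noteq> []" using set_flattened[OF 6(2)] by auto
    qed (use set_flattened[OF 6(1)] set_flattened[OF 6(2)] in auto)
    with 6 show ?case by (simp only: ncp_oplus_eq ncp_rcomp_def flattened_oplus)
  next
    case 7
    show ?case by (simp add: blocks_def ncp_lam_Empty)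
  next
    case (8 x n)
    obtain X P' where X: "x = insert X P'" "X \<notin> P'" "1 \<in> X" "\<And>Y. Y \<in> P' \<Longrightarrow> 1 \<notin> Y"
      "ncp_lam x = insert (insert (Suc n + 1) X) P'"
      using ncp_first_block[OF 8] by metis
    \<comment> \<open>The enlarged block still contains 1, so it cannot coincide with another block
      and the number of blocks is kept.\<close>
    moreover have "insert (Suc n + 1) X \<notin> P'" using X(3,4) by blast
    moreover have "finite P'" using ncpD(5)[OF 8] X(1) by simp
    ultimately show ?case by (simp add: blocks_def)
  next
    case (9 x y m n)
    have "x \<inter> shift (Suc m) ` y = {}"
    proof (rule ccontr)
      assume "x \<inter> shift (Suc m) ` y \<noteq> {}"
      then obtain Y where Y: "Y \<in> y" "shift (Suc m) Y \<in> x" by blast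
      then obtain z where z: "z \<in> Y" using ncpD(6)[OF 9(2)] by blast
      then have "z + Suc m \<le> Suc m" "1 \<le> z"
        using ncpD(7)[OF 9(1) Y(2), of "z + Suc m"] ncpD(7)[OF 9(2) Y(1)] by auto
      then show False by simp
    qed
    moreover have "card (shift (Suc m) ` y) = card y"
      by (rule card_image) (rule inj_on_subset[OF inj_shift subset_UNIV])
    ultimately show ?case
      using ncpD(5)[OF 9(1)] ncpD(5)[OF 9(2)]
      by (simp only: ncp_oplus_eq[OF 9(1)] blocks_def card_Un_disjoint finite_imageI)
  next
    case (10 x n)
    then show ?case using card_blocks_le[OF 10] ncpD(1)[OF 10] by (simp add: blocks_def nonmin_def)
  qed
qed

section \<open>Transport of the canonical statistics\<close>

theorem mainTheorem3:
  shows
    "canonical_stats_equal (canonical_bijection plane_trees dyck_paths)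
       dyck_comp dyck_rcomp peak nonpeak \<and>
     canonical_stats_equal (canonical_bijection plane_trees triangulations)
       tri_comp tri_rcomp tr nontr \<and>
     canonical_stats_equal (canonical_bijection plane_trees perms_231)
       perm_comp rmax rmin nonrmin \<and>
     canonical_stats_equal (canonical_bijection plane_trees perms_321)
       perm_comp rcomp_321 rmin nonrmin \<and>
     canonical_stats_equal (canonical_bijection plane_trees binary_trees)
       bt_comp bt_rcomp redge ledge \<and>
     canonical_stats_equal (canonical_bijection plane_trees tableaux)
       syt_comp syt_rcomp noncons cons \<and>
     canonical_stats_equal (canonical_bijection plane_trees noncrossing_partitions)
       ncp_comp ncp_rcomp blocks nonmin"
  using canonical_stats_dyck_paths canonical_stats_triangulations canonical_stats_perms_231
    canonical_stats_perms_321 canonical_stats_binary_trees canonical_stats_tableaux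
    canonical_stats_noncrossing_partitions
  by blast

end
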